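(* Let $X$ be a smooth affine factorial threefold over $\mathbb{C}$ with a locally trivial $\mathbb{G}_a$-action that is not equivariantly trivial. Let $\delta$ be the locally nilpotent derivation of $\mathbb{C}[X]$ generating the action, let $C_0=\ker\delta$ be the ring of invariants, and let $I=\sqrt{C_0\cap\delta(\mathbb{C}[X])}$, the radical in $C_0$ of the ideal $C_0\cap\delta(\mathbb{C}[X])$ of $C_0$. Assume that $C_0$ is regular. For a maximal ideal $\mathfrak{m}$ of $C_0$, set $S=C_0\setminus\mathfrak{m}$. Then, with $u,v$ denoting algebraically independent indeterminates: 1. $S^{-1}\mathbb{C}[X]\cong (C_0)_{\mathfrak m}[u]$ if $I\not\subseteq\mathfrak m$; and 2. $S^{-1}\mathbb{C}[X]\cong (C_0)_{\mathfrak m}[u,v]/(au-bv-1)$ for some regular sequence $(a,b)$ in $\mathfrak m$ if $I\subseteq\mathfrak m$.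
   Context: $\mathbb{G}_a$ is the additive group of $\mathbb{C}$; actions are algebraic. Every $\mathbb{G}_a$-action on a complex affine variety $X$ is the exponential of a locally nilpotent derivation $\delta$ of the coordinate ring $\mathbb{C}[X]$, and the ring of $\mathbb{G}_a$-invariants in $\mathbb{C}[X]$ is $C_0=\ker\delta$. A variety is factorial if its coordinate ring is a unique factorization domain. The action is equivariantly trivial if there is a variety $Y$ such that $X$ is $\mathbb{G}_a$-equivariantly isomorphic to $Y\times\mathbb{G}_a$ with $\mathbb{G}_a$ acting by translations on the second factor. The action is locally trivial if a geometric quotient $\pi:X\to Y$ exists in the category of algebraic spaces for which $\pi$ is a principal $\mathbb{G}_a$-bundle; for factorial affine $X$ this is equivalent to $C_0\cap\delta(\mathbb{C}[X])$ generating the unit ideal of $\mathbb{C}[X]$. *)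

theory Defs
  imports Complex_Main "HOL-Algebra.Algebra" "HOL-Algebra.Algebraic_Closure_Type"
    "HOL-Library.Extended_Nat"
begin

section \<open>Localization\<close>

text \<open>The fraction \<open>a / s\<close> is the class of \<open>(a, s)\<close> under
  \<open>(a, s) \<sim> (b, t) \<longleftrightarrow> (\<exists>w \<in> S. w (b s - a t) = 0)\<close>.\<close>

definition fraction :: "('a, 'm) ring_scheme \<Rightarrow> 'a set \<Rightarrow> 'a \<Rightarrow> 'a \<Rightarrow> ('a \<times> 'a) set" where
  "fraction R S a s =
     {(b, t). b \<in> carrier R \<and> t \<in> S \<and>
       (\<exists>w\<in>S. w \<otimes>\<^bsub>R\<^esub> (b \<otimes>\<^bsub>R\<^esub> s \<ominus>\<^bsub>R\<^esub> a \<otimes>\<^bsub>R\<^esub> t) = \<zero>\<^bsub>R\<^esub>)}"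

text \<open>For a multiplicative subset \<open>S\<close> of a commutative ring, each union below is over copies of
  one and the same class (see \<open>fraction_mult\<close> and \<open>fraction_add\<close>).\<close>

definition localization :: "('a, 'm) ring_scheme \<Rightarrow> 'a set \<Rightarrow> ('a \<times> 'a) set ring" where
  "localization R S =
     \<lparr> carrier = {fraction R S a s | a s. a \<in> carrier R \<and> s \<in> S},
       monoid.mult = (\<lambda>P Q. \<Union>{fraction R S (a \<otimes>\<^bsub>R\<^esub> b) (s \<otimes>\<^bsub>R\<^esub> t) | a s b t.
                         (a, s) \<in> P \<and> (b, t) \<in> Q}),
       one = fraction R S \<one>\<^bsub>R\<^esub> \<one>\<^bsub>R\<^esub>,
       ring.zero = fraction R S \<zero>\<^bsub>R\<^esub> \<one>\<^bsub>R\<^esub>,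
       add = (\<lambda>P Q. \<Union>{fraction R S (a \<otimes>\<^bsub>R\<^esub> t \<oplus>\<^bsub>R\<^esub> b \<otimes>\<^bsub>R\<^esub> s) (s \<otimes>\<^bsub>R\<^esub> t) | a s b t.
                   (a, s) \<in> P \<and> (b, t) \<in> Q}) \<rparr>"

lemma Union_constant:
  assumes "\<And>a s b t. (a, s) \<in> P \<Longrightarrow> (b, t) \<in> Q \<Longrightarrow> f a s b t = z"
    and "(a0, s0) \<in> P" "(b0, t0) \<in> Q"
  shows "\<Union>{f a s b t | a s b t. (a, s) \<in> P \<and> (b, t) \<in> Q} = z"
proof -
  have "f a s b t = z" if "(a, s) \<in> P \<and> (b, t) \<in> Q" for a s b t
    using assms(1) that by blast
  moreover have "\<exists>a s b t. f a0 s0 b0 t0 = f a s b t \<and> (a, s) \<in> P \<and> (b, t) \<in> Q"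
    using assms(2,3) by blast
  ultimately have "{f a s b t | a s b t. (a, s) \<in> P \<and> (b, t) \<in> Q} = {z}"
    by blast
  then show ?thesis
    by (simp only: cSup_singleton)
qed

locale mult_subset = cring R for R (structure) +
  fixes S
  assumes S_carrier: "S \<subseteq> carrier R"
    and S_one: "\<one> \<in> S"
    and S_mult: "\<lbrakk>s \<in> S; t \<in> S\<rbrakk> \<Longrightarrow> s \<otimes> t \<in> S"
begin

lemma S_closed: "s \<in> S \<Longrightarrow> s \<in> carrier R"
  using S_carrier by blast

definition rel :: "'a \<times> 'a \<Rightarrow> 'a \<times> 'a \<Rightarrow> bool" where
  "rel p q \<longleftrightarrow> (\<exists>w\<in>S. w \<otimes> (fst q \<otimes> snd p) = w \<otimes> (fst p \<otimes> snd q))"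

lemma rel_iff:
  assumes "a \<in> carrier R" "s \<in> S" "b \<in> carrier R" "t \<in> S"
  shows "rel (a, s) (b, t) \<longleftrightarrow> (\<exists>w\<in>S. w \<otimes> (b \<otimes> s \<ominus> a \<otimes> t) = \<zero>)"
proof -
  note [simp] = assms assms(2,4)[THEN S_closed]
  have "w \<otimes> (b \<otimes> s) = w \<otimes> (a \<otimes> t) \<longleftrightarrow> w \<otimes> (b \<otimes> s \<ominus> a \<otimes> t) = \<zero>" if "w \<in> S" for w
  proof -
    note [simp] = that[THEN S_closed]
    have "w \<otimes> (b \<otimes> s \<ominus> a \<otimes> t) = w \<otimes> (b \<otimes> s) \<ominus> w \<otimes> (a \<otimes> t)"
      by (simp add: a_minus_def r_distr r_minus)
    then show ?thesis
      by (simp add: r_right_minus_eq)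
  qed
  then show ?thesis
    by (auto simp: rel_def)
qed

lemma fraction_eq:
  assumes "a \<in> carrier R" "s \<in> S"
  shows "fraction R S a s = {p \<in> carrier R \<times> S. rel (a, s) p}"
  using assms by (auto simp: fraction_def rel_iff)

lemma rel_sym: "rel p q \<Longrightarrow> rel q p"
  by (force simp: rel_def)

lemma rel_refl: "rel p p"
  using S_one by (auto simp: rel_def)

lemma rel_trans:
  assumes "p \<in> carrier R \<times> S" "q \<in> carrier R \<times> S" "r \<in> carrier R \<times> S"
    and "rel p q" "rel q r"
  shows "rel p r"
proof -
  obtain a s b t c x where p: "p = (a, s)" "q = (b, t)" "r = (c, x)"
    by (metis surj_pair)
  have [simp]: "a \<in> carrier R" "s \<in> S" "b \<in> carrier R" "t \<in> S" "c \<in> carrier R" "x \<in> S"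
    using assms p by auto
  note [simp] = \<open>s \<in> S\<close>[THEN S_closed] \<open>t \<in> S\<close>[THEN S_closed] \<open>x \<in> S\<close>[THEN S_closed]
  obtain w where w: "w \<in> S" "w \<otimes> (b \<otimes> s) = w \<otimes> (a \<otimes> t)"
    using assms(4) p by (auto simp: rel_def)
  obtain z where z: "z \<in> S" "z \<otimes> (c \<otimes> t) = z \<otimes> (b \<otimes> x)"
    using assms(5) p by (auto simp: rel_def)
  note [simp] = w(1)[THEN S_closed] z(1)[THEN S_closed]
  have "(w \<otimes> z \<otimes> t) \<otimes> (c \<otimes> s) = (w \<otimes> s) \<otimes> (z \<otimes> (c \<otimes> t))"
    by (simp add: m_ac)
  also have "\<dots> = (z \<otimes> x) \<otimes> (w \<otimes> (b \<otimes> s))"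
    unfolding z(2) by (simp add: m_ac)
  also have "\<dots> = (w \<otimes> z \<otimes> t) \<otimes> (a \<otimes> x)"
    unfolding w(2) by (simp add: m_ac)
  finally show ?thesis
    using w(1) z(1) p by (auto simp: rel_def intro!: bexI[of _ "w \<otimes> z \<otimes> t"] S_mult)
qed

lemma fraction_eq_iff:
  assumes "a \<in> carrier R" "s \<in> S" "b \<in> carrier R" "t \<in> S"
  shows "fraction R S a s = fraction R S b t \<longleftrightarrow>
    (\<exists>w\<in>S. w \<otimes> (b \<otimes> s) = w \<otimes> (a \<otimes> t))"
proof -
  have "fraction R S a s = fraction R S b t \<longleftrightarrow> rel (a, s) (b, t)"
  proof
    assume "fraction R S a s = fraction R S b t"
    moreover have "(b, t) \<in> fraction R S b t"
      using assms by (simp add: fraction_eq rel_refl)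
    ultimately have "(b, t) \<in> fraction R S a s" by simp
    then show "rel (a, s) (b, t)"
      using assms by (simp add: fraction_eq)
  next
    assume *: "rel (a, s) (b, t)"
    have "(a, s) \<in> carrier R \<times> S" "(b, t) \<in> carrier R \<times> S"
      using assms by auto
    then have "rel (a, s) p \<longleftrightarrow> rel (b, t) p" if "p \<in> carrier R \<times> S" for p
      using * that rel_trans rel_sym by meson
    then show "fraction R S a s = fraction R S b t"
      using assms by (simp add: fraction_eq cong: conj_cong)
  qed
  then show ?thesis by (simp add: rel_def)
qed

lemma fraction_mult:
  assumes "a \<in> carrier R" "s \<in> S" "b \<in> carrier R" "t \<in> S"
  shows "fraction R S a s \<otimes>\<^bsub>localization R S\<^esub> fraction R S b t = fraction R S (a \<otimes> b) (s \<otimes> t)"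
proof -
  have "fraction R S (c \<otimes> d) (x \<otimes> y) = fraction R S (a \<otimes> b) (s \<otimes> t)"
    if c: "(c, x) \<in> fraction R S a s" and d: "(d, y) \<in> fraction R S b t" for c x d y
  proof -
    have [simp]: "c \<in> carrier R" "x \<in> S" "d \<in> carrier R" "y \<in> S"
      using c d assms by (auto simp: fraction_eq)
    obtain w where w: "w \<in> S" "w \<otimes> (c \<otimes> s) = w \<otimes> (a \<otimes> x)"
      using c assms by (auto simp: fraction_eq rel_def)
    obtain z where z: "z \<in> S" "z \<otimes> (d \<otimes> t) = z \<otimes> (b \<otimes> y)"
      using d assms by (auto simp: fraction_eq rel_def)
    note [simp] = assms(1,3) S_closed[OF assms(2)] S_closed[OF assms(4)]
      S_closed[OF \<open>x \<in> S\<close>] S_closed[OF \<open>y \<in> S\<close>] S_closed[OF w(1)] S_closed[OF z(1)]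
    have "(w \<otimes> z) \<otimes> ((a \<otimes> b) \<otimes> (x \<otimes> y)) = (w \<otimes> (a \<otimes> x)) \<otimes> (z \<otimes> (b \<otimes> y))"
      by (simp add: m_ac)
    also have "\<dots> = (w \<otimes> z) \<otimes> ((c \<otimes> d) \<otimes> (s \<otimes> t))"
      unfolding w(2)[symmetric] z(2)[symmetric] by (simp add: m_ac)
    finally show ?thesis
      using w(1) z(1) assms
      by (intro fraction_eq_iff[THEN iffD2] bexI[of _ "w \<otimes> z"]) (simp_all add: S_mult)
  qed
  moreover have "(a, s) \<in> fraction R S a s" "(b, t) \<in> fraction R S b t"
    using assms by (simp_all add: fraction_eq rel_refl)
  ultimately show ?thesis
    unfolding localization_def monoid.select_convs ring.select_convs by (rule Union_constant)
qed

lemma fraction_add: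
  assumes "a \<in> carrier R" "s \<in> S" "b \<in> carrier R" "t \<in> S"
  shows "fraction R S a s \<oplus>\<^bsub>localization R S\<^esub> fraction R S b t =
    fraction R S (a \<otimes> t \<oplus> b \<otimes> s) (s \<otimes> t)"
proof -
  have "fraction R S (c \<otimes> y \<oplus> d \<otimes> x) (x \<otimes> y) = fraction R S (a \<otimes> t \<oplus> b \<otimes> s) (s \<otimes> t)"
    if c: "(c, x) \<in> fraction R S a s" and d: "(d, y) \<in> fraction R S b t" for c x d y
  proof -
    have [simp]: "c \<in> carrier R" "x \<in> S" "d \<in> carrier R" "y \<in> S"
      using c d assms by (auto simp: fraction_eq)
    obtain w where w: "w \<in> S" "w \<otimes> (c \<otimes> s) = w \<otimes> (a \<otimes> x)"
      using c assms by (auto simp: fraction_eq rel_def)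
    obtain z where z: "z \<in> S" "z \<otimes> (d \<otimes> t) = z \<otimes> (b \<otimes> y)"
      using d assms by (auto simp: fraction_eq rel_def)
    note [simp] = assms(1,3) S_closed[OF assms(2)] S_closed[OF assms(4)]
      S_closed[OF \<open>x \<in> S\<close>] S_closed[OF \<open>y \<in> S\<close>] S_closed[OF w(1)] S_closed[OF z(1)]
    have p: "(w \<otimes> z) \<otimes> ((a \<otimes> t) \<otimes> (x \<otimes> y)) = (z \<otimes> t \<otimes> y) \<otimes> (w \<otimes> (a \<otimes> x))"
      "(w \<otimes> z) \<otimes> ((c \<otimes> y) \<otimes> (s \<otimes> t)) = (z \<otimes> t \<otimes> y) \<otimes> (w \<otimes> (c \<otimes> s))"
      "(w \<otimes> z) \<otimes> ((b \<otimes> s) \<otimes> (x \<otimes> y)) = (w \<otimes> s \<otimes> x) \<otimes> (z \<otimes> (b \<otimes> y))"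
      "(w \<otimes> z) \<otimes> ((d \<otimes> x) \<otimes> (s \<otimes> t)) = (w \<otimes> s \<otimes> x) \<otimes> (z \<otimes> (d \<otimes> t))"
      by (simp_all add: m_ac)
    have distr: "e \<otimes> ((f \<oplus> g) \<otimes> h) = e \<otimes> (f \<otimes> h) \<oplus> e \<otimes> (g \<otimes> h)"
      if "e \<in> carrier R" "f \<in> carrier R" "g \<in> carrier R" "h \<in> carrier R" for e f g h
      using that by (simp add: l_distr r_distr)
    have "(w \<otimes> z) \<otimes> ((a \<otimes> t \<oplus> b \<otimes> s) \<otimes> (x \<otimes> y)) =
        (w \<otimes> z) \<otimes> ((a \<otimes> t) \<otimes> (x \<otimes> y)) \<oplus> (w \<otimes> z) \<otimes> ((b \<otimes> s) \<otimes> (x \<otimes> y))"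
      by (intro distr) auto
    also have "\<dots> = (w \<otimes> z) \<otimes> ((c \<otimes> y) \<otimes> (s \<otimes> t)) \<oplus> (w \<otimes> z) \<otimes> ((d \<otimes> x) \<otimes> (s \<otimes> t))"
      unfolding p w(2) z(2) ..
    also have "\<dots> = (w \<otimes> z) \<otimes> ((c \<otimes> y \<oplus> d \<otimes> x) \<otimes> (s \<otimes> t))"
      by (intro distr[symmetric]) auto
    finally show ?thesis
      using w(1) z(1) assms
      by (intro fraction_eq_iff[THEN iffD2] bexI[of _ "w \<otimes> z"]) (simp_all add: S_mult)
  qed
  moreover have "(a, s) \<in> fraction R S a s" "(b, t) \<in> fraction R S b t"
    using assms by (simp_all add: fraction_eq rel_refl)
  ultimately show ?thesis
    unfolding localization_def monoid.select_convs ring.select_convs by (rule Union_constant)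
qed

end


section \<open>Commutative algebra\<close>

text \<open>The supremum of the lengths \<open>n\<close> of chains of primes \<open>P 0 \<subset> \<dots> \<subset> P n\<close>.\<close>

definition krull_dim :: "('a, 'm) ring_scheme \<Rightarrow> enat" where
  "krull_dim R = Sup {enat n | n. \<exists>P. (\<forall>i\<le>n. primeideal (P i) R) \<and> (\<forall>i<n. P i \<subset> P (Suc i))}"

definition regular_local_ring :: "('a, 'm) ring_scheme \<Rightarrow> bool" where
  "regular_local_ring R \<longleftrightarrow>
     cring R \<and> noetherian_ring R \<and>
     (\<exists>m. maximalideal m R \<and> (\<forall>m'. maximalideal m' R \<longrightarrow> m' = m) \<and>
       (\<exists>E\<subseteq>carrier R. finite E \<and> Idl\<^bsub>R\<^esub> E = m \<and> enat (card E) = krull_dim R))"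

definition regular_ring :: "('a, 'm) ring_scheme \<Rightarrow> bool" where
  "regular_ring R \<longleftrightarrow>
     cring R \<and> noetherian_ring R \<and>
     (\<forall>p. primeideal p R \<longrightarrow> regular_local_ring (localization R (carrier R - p)))"

definition ideal_radical :: "('a, 'm) ring_scheme \<Rightarrow> 'a set \<Rightarrow> 'a set" where
  "ideal_radical R J = {r \<in> carrier R. \<exists>n::nat. n > 0 \<and> r [^]\<^bsub>R\<^esub> n \<in> J}"

definition regular_sequence :: "('a, 'm) ring_scheme \<Rightarrow> 'a list \<Rightarrow> bool" where
  "regular_sequence R xs \<longleftrightarrow>
     set xs \<subseteq> carrier R \<and>
     (\<forall>i<length xs. \<forall>r\<in>carrier R.
        xs ! i \<otimes>\<^bsub>R\<^esub> r \<in> Idl\<^bsub>R\<^esub> (set (take i xs)) \<longrightarrow> r \<in> Idl\<^bsub>R\<^esub> (set (take i xs))) \<and>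
     Idl\<^bsub>R\<^esub> (set xs) \<noteq> carrier R"

text \<open>\<open>f : K \<rightarrow> R\<close> and \<open>g : K \<rightarrow> T\<close> are the structure maps of two \<open>K\<close>-algebras.\<close>

definition isomorphic_over ::
  "('k, 'l) ring_scheme \<Rightarrow> ('a, 'm) ring_scheme \<Rightarrow> ('k \<Rightarrow> 'a) \<Rightarrow> ('b, 'n) ring_scheme \<Rightarrow> ('k \<Rightarrow> 'b) \<Rightarrow> bool"
where
  "isomorphic_over K R f T g \<longleftrightarrow> (\<exists>h\<in>ring_iso R T. \<forall>k\<in>carrier K. h (f k) = g k)"


section \<open>Affine varieties over the complex numbers, given by their coordinate rings\<close>

definition affine_variety :: "(complex, 'a) module \<Rightarrow> bool" where
  "affine_variety A \<longleftrightarrow>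
     algebra (ring_of_type_algebra :: complex ring) A \<and> domain A \<and>
     (\<exists>E\<subseteq>carrier A. finite E \<and>
        generate_ring A (range (\<lambda>c. c \<odot>\<^bsub>A\<^esub> \<one>\<^bsub>A\<^esub>) \<union> E) = carrier A)"

text \<open>Over \<open>\<complex>\<close> a variety is smooth iff it is nonsingular at its (closed) points.\<close>

definition smooth_affine_variety :: "(complex, 'a) module \<Rightarrow> bool" where
  "smooth_affine_variety A \<longleftrightarrow>
     affine_variety A \<and>
     (\<forall>M. maximalideal M A \<longrightarrow> regular_local_ring (localization A (carrier A - M)))"


section \<open>Actions of the additive group\<close>

text \<open>An action of \<open>\<bbbG>\<^sub>a\<close> on \<open>Spec A\<close> is given by the locally nilpotent derivation
  \<open>\<delta>\<close> of \<open>A\<close> over \<open>\<complex>\<close> whose exponential it is.\<close>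

definition locally_nilpotent_derivation :: "(complex, 'a) module \<Rightarrow> ('a \<Rightarrow> 'a) \<Rightarrow> bool" where
  "locally_nilpotent_derivation A \<delta> \<longleftrightarrow>
     \<delta> \<in> carrier A \<rightarrow> carrier A \<and>
     (\<forall>x\<in>carrier A. \<forall>y\<in>carrier A. \<delta> (x \<oplus>\<^bsub>A\<^esub> y) = \<delta> x \<oplus>\<^bsub>A\<^esub> \<delta> y) \<and>
     (\<forall>c. \<forall>x\<in>carrier A. \<delta> (c \<odot>\<^bsub>A\<^esub> x) = c \<odot>\<^bsub>A\<^esub> \<delta> x) \<and>
     (\<forall>x\<in>carrier A. \<forall>y\<in>carrier A. \<delta> (x \<otimes>\<^bsub>A\<^esub> y) = x \<otimes>\<^bsub>A\<^esub> \<delta> y \<oplus>\<^bsub>A\<^esub> \<delta> x \<otimes>\<^bsub>A\<^esub> y) \<and>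
     (\<forall>x\<in>carrier A. \<exists>n. (\<delta> ^^ n) x = \<zero>\<^bsub>A\<^esub>)"

definition invariant_ring :: "(complex, 'a) module \<Rightarrow> ('a \<Rightarrow> 'a) \<Rightarrow> (complex, 'a) module" where
  "invariant_ring A \<delta> = A\<lparr>carrier := {x \<in> carrier A. \<delta> x = \<zero>\<^bsub>A\<^esub>}\<rparr>"

text \<open>The ideal \<open>ker \<delta> \<inter> im \<delta>\<close> of \<open>ker \<delta>\<close>.\<close>

definition plinth_ideal :: "(complex, 'a) module \<Rightarrow> ('a \<Rightarrow> 'a) \<Rightarrow> 'a set" where
  "plinth_ideal A \<delta> = carrier (invariant_ring A \<delta>) \<inter> \<delta> ` carrier A"

text \<open>For a \<^emph>\<open>factorial\<close> affine variety this ideal condition is equivalent to the existence of a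
  geometric quotient that is a principal \<open>\<bbbG>\<^sub>a\<close>-bundle: on the open set where a plinth element
  \<open>\<delta> s\<close> does not vanish, the action is trivialized by the slice \<open>s / \<delta> s\<close>. The definition is
  only meant for factorial \<open>A\<close>.\<close>

definition locally_trivial :: "(complex, 'a) module \<Rightarrow> ('a \<Rightarrow> 'a) \<Rightarrow> bool" where
  "locally_trivial A \<delta> \<longleftrightarrow> Idl\<^bsub>A\<^esub> (plinth_ideal A \<delta>) = carrier A"

definition up_deriv :: "('a, 'm) ring_scheme \<Rightarrow> (nat \<Rightarrow> 'a) \<Rightarrow> nat \<Rightarrow> 'a" where
  "up_deriv R p = (\<lambda>n. add_pow R (Suc n) (p (Suc n)))"

text \<open>\<open>Spec A\<close> is equivariantly isomorphic to \<open>Y \<times> \<bbbG>\<^sub>a\<close>, where \<open>B\<close> is the coordinate ring of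
  \<open>Y\<close> and \<open>B[t]\<close> that of \<open>Y \<times> \<bbbG>\<^sub>a\<close>; translation on the second factor is the exponential of
  \<open>d/dt\<close>. Such a \<open>Y\<close> is isomorphic to the closed subvariety \<open>Y \<times> {0}\<close>, hence affine, and \<open>B\<close> embeds
  into \<open>A\<close>, so that letting \<open>B\<close> range over algebras on the same type loses nothing.\<close>

definition equivariantly_trivial :: "(complex, 'a) module \<Rightarrow> ('a \<Rightarrow> 'a) \<Rightarrow> bool" where
  "equivariantly_trivial A \<delta> \<longleftrightarrow>
     (\<exists>B :: (complex, 'a) module. affine_variety B \<and>
       (\<exists>\<phi>\<in>ring_iso (UP B) A.
          (\<forall>c. \<phi> (up_ring.monom (UP B) (c \<odot>\<^bsub>B\<^esub> \<one>\<^bsub>B\<^esub>) 0) = c \<odot>\<^bsub>A\<^esub> \<one>\<^bsub>A\<^esub>) \<and>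
          (\<forall>p\<in>carrier (UP B). \<phi> (up_deriv B p) = \<delta> (\<phi> p))))"


section \<open>The local models\<close>

text \<open>\<open>L[u, v]\<close> is the iterated polynomial ring \<open>L[u][v]\<close>.\<close>

definition const2 :: "('a, 'm) ring_scheme \<Rightarrow> 'a \<Rightarrow> nat \<Rightarrow> nat \<Rightarrow> 'a" where
  "const2 L r = up_ring.monom (UP (UP L)) (up_ring.monom (UP L) r 0) 0"

definition var_u :: "('a, 'm) ring_scheme \<Rightarrow> nat \<Rightarrow> nat \<Rightarrow> 'a" where
  "var_u L = up_ring.monom (UP (UP L)) (up_ring.monom (UP L) \<one>\<^bsub>L\<^esub> 1) 0"

definition var_v :: "('a, 'm) ring_scheme \<Rightarrow> nat \<Rightarrow> nat \<Rightarrow> 'a" where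
  "var_v L = up_ring.monom (UP (UP L)) \<one>\<^bsub>UP L\<^esub> 1"

text \<open>The ideal \<open>(a u - b v - 1)\<close> of \<open>L[u, v]\<close>.\<close>

definition hypersurface_ideal :: "('a, 'm) ring_scheme \<Rightarrow> 'a \<Rightarrow> 'a \<Rightarrow> (nat \<Rightarrow> nat \<Rightarrow> 'a) set" where
  "hypersurface_ideal L a b =
     Idl\<^bsub>UP (UP L)\<^esub>
       {const2 L a \<otimes>\<^bsub>UP (UP L)\<^esub> var_u L \<ominus>\<^bsub>UP (UP L)\<^esub> const2 L b \<otimes>\<^bsub>UP (UP L)\<^esub> var_v L
          \<ominus>\<^bsub>UP (UP L)\<^esub> \<one>\<^bsub>UP (UP L)\<^esub>}"

end

theory Submission
  imports Defs "HOL-Analysis.Continuum_Not_Denumerable"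
begin

text \<open>Let \<open>\<delta>\<close> be the derivation, \<open>C\<close> its kernel, \<open>m\<close> a maximal ideal of \<open>C\<close>, \<open>S = C - m\<close> and \<open>L\<close>, \<open>B\<close> the rings of
  fractions of \<open>C\<close> and of the coordinate ring \<open>A\<close> with denominators in \<open>S\<close>. The argument revolves
  around the \<open>C\<close>-module of slices, the elements \<open>t\<close> with \<open>\<delta> (\<delta> t) = 0\<close>: by \<open>\<delta>\<close> it maps onto the plinth
  ideal \<open>C \<inter> \<delta> A\<close>, with kernel \<open>C\<close>.

  If \<open>\<delta> t\<close> lies in \<open>S\<close> for some slice \<open>t\<close>, then \<open>t\<close> is a coordinate: as in the case of polynomials, the
  top term of an element, seen as a polynomial in \<open>t / \<delta> t\<close>, can be cancelled, and \<open>t\<close> satisfies no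
  equation over the kernel (\<open>local_slice_generates\<close>, \<open>local_slice_transcendental\<close>). So \<open>B = L[u]\<close>. Since
  \<open>m\<close> is prime, it contains the plinth ideal iff it contains the radical of that ideal; this
  settles the first half of the theorem.

  Suppose that \<open>m\<close> contains the plinth ideal. The first ingredient is that \<open>L\<close> has dimension at most
  two. A chain of primes of \<open>C\<close> of length \<open>n\<close> gives \<open>n\<close> successively transcendental elements of \<open>C\<close>, and
  a slice is one more such element in \<open>A\<close> (\<open>invariant_dimension\<close>). In a finitely generated domain over
  \<open>\<complex>\<close> such a tower gives back a chain of primes of the same length; the step from one prime to a
  larger one (\<open>larger_prime_avoiding\<close>) uses that \<open>A\<close> has countable dimension as a vector space while \<open>\<complex>\<close>
  is uncountable. As \<open>L\<close> is regular, \<open>m\<close> is locally generated by two elements \<open>x\<close> and \<open>y\<close>, and by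
  factoriality \<open>x\<close> may be chosen prime in \<open>A\<close>.

  The second ingredient is that the slices are then locally free of rank two. Freeness
  (\<open>slices_locally_free\<close>) holds because \<open>x, y\<close> acts on the slices like a regular sequence: if \<open>x p + y q = 0\<close>
  for slices \<open>p\<close> and \<open>q\<close>, then \<open>x\<close> divides \<open>q\<close> in \<open>A\<close>, and the quotient is again a slice, since the kernel is
  factorially closed. The rank is two because two slices differ, up to multiples from the
  kernel, by an element of the kernel.

  Let \<open>u, v\<close> be a local basis of the slices. The slice \<open>1\<close> is a combination of them up to a factor
  from \<open>S\<close>; removing the common factor of its coefficients gives \<open>a u - b v = s\<close> with \<open>s \<in> S\<close> and with \<open>a\<close>
  and \<open>b\<close> coprime in \<open>A\<close>. Applying \<open>\<delta>\<close> yields \<open>\<delta> u = b w\<close> and \<open>\<delta> v = a w\<close> for some \<open>w\<close>. This \<open>w\<close> divides the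
  plinth ideal locally; as the plinth ideal generates the unit ideal of \<open>A\<close>, it follows that \<open>w \<in> S\<close>,
  and therefore that \<open>a\<close> and \<open>b\<close> lie in \<open>m\<close> (\<open>local_equation\<close>).

  Finally, \<open>L[u, v] / (a u - b v - 1)\<close> maps to \<open>B\<close>, with \<open>u\<close> and \<open>v\<close> going to \<open>u / s\<close> and \<open>v / s\<close>. Where \<open>b\<close> is
  invertible, \<open>v\<close> can be eliminated on the left and \<open>u\<close> is a coordinate on the right, because \<open>\<delta> u = b w\<close>;
  where \<open>a\<close> is invertible the roles of \<open>u\<close> and \<open>v\<close> are exchanged. On both sides \<open>a u - b v = 1\<close>, so these
  two open sets cover everything and the map is an isomorphism (\<open>model_inside_plinth\<close>).\<close>

section \<open>Rings of fractions\<close>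

context mult_subset
begin

lemma carrier_localization:
  "carrier (localization R S) = {fraction R S a s | a s. a \<in> carrier R \<and> s \<in> S}"
  by (simp add: localization_def)

lemma zero_localization: "\<zero>\<^bsub>localization R S\<^esub> = fraction R S \<zero> \<one>"
  and one_localization: "\<one>\<^bsub>localization R S\<^esub> = fraction R S \<one> \<one>"
  by (simp_all add: localization_def)

lemma fraction_closed:
  "a \<in> carrier R \<Longrightarrow> s \<in> S \<Longrightarrow> fraction R S a s \<in> carrier (localization R S)"
  by (auto simp: carrier_localization)

lemma fraction_eqI:
  assumes "a \<in> carrier R" "s \<in> S" "b \<in> carrier R" "t \<in> S" "a \<otimes> t = b \<otimes> s"
  shows "fraction R S a s = fraction R S b t"
  using assms S_one by (auto simp: fraction_eq_iff)

lemma localization_cring: "cring (localization R S)"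
proof (rule cringI)
  let ?L = "localization R S"
  note [simp] = zero_localization one_localization fraction_add fraction_mult fraction_closed
    S_closed S_one S_mult
  have E: thesis if "x \<in> carrier ?L" "\<And>a s. \<lbrakk>x = fraction R S a s; a \<in> carrier R; s \<in> S\<rbrakk> \<Longrightarrow> thesis"
    for x thesis
    using that by (auto simp: carrier_localization)
  show "abelian_group ?L"
  proof (rule abelian_groupI)
    fix x y z assume x: "x \<in> carrier ?L" and y: "y \<in> carrier ?L" and z: "z \<in> carrier ?L"
    obtain a s where 1: "x = fraction R S a s" "a \<in> carrier R" "s \<in> S" using x by (rule E)
    obtain b t where 2: "y = fraction R S b t" "b \<in> carrier R" "t \<in> S" using y by (rule E)
    obtain c r where 3: "z = fraction R S c r" "c \<in> carrier R" "r \<in> S" using z by (rule E)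
    show "x \<oplus>\<^bsub>?L\<^esub> y \<in> carrier ?L" using 1 2 by simp
    show "x \<oplus>\<^bsub>?L\<^esub> y = y \<oplus>\<^bsub>?L\<^esub> x" using 1 2 by (simp add: a_comm m_comm)
    show "x \<oplus>\<^bsub>?L\<^esub> y \<oplus>\<^bsub>?L\<^esub> z = x \<oplus>\<^bsub>?L\<^esub> (y \<oplus>\<^bsub>?L\<^esub> z)"
      using 1 2 3 by (simp add: l_distr r_distr m_ac a_ac)
  next
    fix x assume x: "x \<in> carrier ?L"
    obtain a s where 1: "x = fraction R S a s" "a \<in> carrier R" "s \<in> S" using x by (rule E)
    show "\<zero>\<^bsub>?L\<^esub> \<oplus>\<^bsub>?L\<^esub> x = x" using 1 by simp
    have "fraction R S (\<ominus> a) s \<oplus>\<^bsub>?L\<^esub> x = fraction R S \<zero> \<one>"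
      using 1 by (simp add: l_minus l_neg) (rule fraction_eqI, auto)
    moreover have "fraction R S (\<ominus> a) s \<in> carrier ?L" using 1 by simp
    ultimately show "\<exists>y\<in>carrier ?L. y \<oplus>\<^bsub>?L\<^esub> x = \<zero>\<^bsub>?L\<^esub>"
      unfolding zero_localization by blast
  qed simp
  show "comm_monoid ?L"
  proof (rule comm_monoidI)
    fix x y z assume x: "x \<in> carrier ?L" and y: "y \<in> carrier ?L" and z: "z \<in> carrier ?L"
    obtain a s where 1: "x = fraction R S a s" "a \<in> carrier R" "s \<in> S" using x by (rule E)
    obtain b t where 2: "y = fraction R S b t" "b \<in> carrier R" "t \<in> S" using y by (rule E)
    obtain c r where 3: "z = fraction R S c r" "c \<in> carrier R" "r \<in> S" using z by (rule E)
    show "x \<otimes>\<^bsub>?L\<^esub> y \<in> carrier ?L" using 1 2 by simp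
    show "x \<otimes>\<^bsub>?L\<^esub> y = y \<otimes>\<^bsub>?L\<^esub> x" using 1 2 by (simp add: m_comm)
    show "x \<otimes>\<^bsub>?L\<^esub> y \<otimes>\<^bsub>?L\<^esub> z = x \<otimes>\<^bsub>?L\<^esub> (y \<otimes>\<^bsub>?L\<^esub> z)" using 1 2 3 by (simp add: m_assoc)
    show "\<one>\<^bsub>?L\<^esub> \<otimes>\<^bsub>?L\<^esub> x = x" using 1 by simp
  qed simp
  fix x y z assume x: "x \<in> carrier ?L" and y: "y \<in> carrier ?L" and z: "z \<in> carrier ?L"
  obtain a s where 1: "x = fraction R S a s" "a \<in> carrier R" "s \<in> S" using x by (rule E)
  obtain b t where 2: "y = fraction R S b t" "b \<in> carrier R" "t \<in> S" using y by (rule E)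
  obtain c r where 3: "z = fraction R S c r" "c \<in> carrier R" "r \<in> S" using z by (rule E)
  show "(x \<oplus>\<^bsub>?L\<^esub> y) \<otimes>\<^bsub>?L\<^esub> z = x \<otimes>\<^bsub>?L\<^esub> z \<oplus>\<^bsub>?L\<^esub> y \<otimes>\<^bsub>?L\<^esub> z"
    using 1 2 3 by simp (rule fraction_eqI, simp_all add: l_distr r_distr m_ac)
qed

lemma localization_hom: "(\<lambda>a. fraction R S a \<one>) \<in> ring_hom R (localization R S)"
  by (rule ring_hom_memI)
    (simp_all add: fraction_closed fraction_mult fraction_add S_one one_localization)

lemma fraction_unit:
  assumes "s \<in> S"
  shows "fraction R S s \<one> \<otimes>\<^bsub>localization R S\<^esub> fraction R S \<one> s = \<one>\<^bsub>localization R S\<^esub>"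
  using assms S_one S_closed
  by (simp add: fraction_mult one_localization) (rule fraction_eqI, auto)

lemma fraction_split:
  assumes "a \<in> carrier R" "s \<in> S"
  shows "fraction R S a s = fraction R S a \<one> \<otimes>\<^bsub>localization R S\<^esub> fraction R S \<one> s"
  using assms S_one S_closed by (simp add: fraction_mult)

end

locale domain_mult_subset = mult_subset R S + domain R for R (structure) and S +
  assumes S_nonzero: "\<zero> \<notin> S"
begin

lemma fraction_eq_cross:
  assumes "a \<in> carrier R" "s \<in> S" "b \<in> carrier R" "t \<in> S"
  shows "fraction R S a s = fraction R S b t \<longleftrightarrow> a \<otimes> t = b \<otimes> s"
proof -
  have "(w \<otimes> (b \<otimes> s) = w \<otimes> (a \<otimes> t)) = (a \<otimes> t = b \<otimes> s)" if "w \<in> S" for w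
    using that assms S_closed S_nonzero by (subst m_lcancel) auto
  then show ?thesis using assms S_one by (auto simp: fraction_eq_iff)
qed

lemma fraction_eq_zero:
  assumes "a \<in> carrier R" "s \<in> S"
  shows "fraction R S a s = \<zero>\<^bsub>localization R S\<^esub> \<longleftrightarrow> a = \<zero>"
  using assms S_one S_closed by (simp add: zero_localization fraction_eq_cross)

end

text \<open>Localizing a subring \<open>R\<close> of \<open>A\<close> at \<open>S\<close> gives a subring of the localization of \<open>A\<close> at \<open>S\<close>.
  Since a fraction is a set of pairs over the ring in which it is formed, the inclusion is a
  map between different sets; it takes any representative.\<close>

definition fraction_inclusion ::
  "('a, 'm) ring_scheme \<Rightarrow> 'a set \<Rightarrow> ('a \<times> 'a) set \<Rightarrow> ('a \<times> 'a) set" where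
  "fraction_inclusion A S x = (case (SOME p. p \<in> x) of (a, s) \<Rightarrow> fraction A S a s)"

locale subring_localization =
  A: domain_mult_subset A S + subring R A for A (structure) and R and S +
  assumes S_subring: "S \<subseteq> R"
begin

abbreviation "Rr \<equiv> A\<lparr>carrier := R\<rparr>"

lemma R_carrier: "a \<in> R \<Longrightarrow> a \<in> carrier A"
  using subringE(1)[OF subring_axioms] by auto

lemma Rr_domain: "domain Rr"
  using A.subring_is_domain[OF subring_axioms] .

sublocale R: domain_mult_subset Rr S
proof -
  interpret domain Rr by (rule Rr_domain)
  show "domain_mult_subset Rr S"
    by unfold_locales (use S_subring A.S_one A.S_mult A.S_nonzero in auto)
qed

abbreviation "L \<equiv> localization Rr S"
abbreviation "B \<equiv> localization A S"

lemma L_cases: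
  assumes "x \<in> carrier L"
  obtains a s where "x = fraction Rr S a s" "a \<in> R" "s \<in> S"
  using assms by (auto simp: R.carrier_localization)

lemma B_cases:
  assumes "x \<in> carrier B"
  obtains a s where "x = fraction A S a s" "a \<in> carrier A" "s \<in> S"
  using assms by (auto simp: A.carrier_localization)

lemma fraction_inclusion_fraction:
  assumes "a \<in> R" "s \<in> S"
  shows "fraction_inclusion A S (fraction Rr S a s) = fraction A S a s"
proof -
  let ?x = "fraction Rr S a s"
  obtain b t where bt: "(SOME p. p \<in> ?x) = (b, t)" by fastforce
  have "(a, s) \<in> ?x" using assms by (auto simp: R.fraction_eq R.rel_refl)
  then have "(b, t) \<in> ?x" using someI[of "\<lambda>p. p \<in> ?x" "(a, s)"] bt by simp
  then have b: "b \<in> R" "t \<in> S" and "R.rel (a, s) (b, t)" using assms by (auto simp: R.fraction_eq)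
  then obtain w where "w \<in> S" "w \<otimes> (b \<otimes> s) = w \<otimes> (a \<otimes> t)" by (auto simp: R.rel_def)
  then have "fraction A S a s = fraction A S b t"
    using assms b R_carrier by (auto simp: A.fraction_eq_iff)
  then show ?thesis by (simp add: fraction_inclusion_def bt)
qed

lemma fraction_inclusion_hom: "fraction_inclusion A S \<in> ring_hom L B"
proof (rule ring_hom_memI)
  fix x y assume x: "x \<in> carrier L" and y: "y \<in> carrier L"
  obtain a s where 1: "x = fraction Rr S a s" "a \<in> R" "s \<in> S" using x by (rule L_cases)
  obtain b t where 2: "y = fraction Rr S b t" "b \<in> R" "t \<in> S" using y by (rule L_cases)
  note [simp] = R_carrier A.S_mult subringE(6,7)[OF subring_axioms]
    S_subring[THEN subsetD] R.fraction_mult[simplified] R.fraction_add[simplified]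
    A.fraction_mult A.fraction_add fraction_inclusion_fraction
  show "fraction_inclusion A S (x \<otimes>\<^bsub>L\<^esub> y) = fraction_inclusion A S x \<otimes>\<^bsub>B\<^esub> fraction_inclusion A S y"
    using 1 2 by simp
  show "fraction_inclusion A S (x \<oplus>\<^bsub>L\<^esub> y) = fraction_inclusion A S x \<oplus>\<^bsub>B\<^esub> fraction_inclusion A S y"
    using 1 2 by simp
next
  fix x assume x: "x \<in> carrier L"
  obtain a s where 1: "x = fraction Rr S a s" "a \<in> R" "s \<in> S" using x by (rule L_cases)
  show "fraction_inclusion A S x \<in> carrier B"
    using 1 by (simp add: fraction_inclusion_fraction A.fraction_closed R_carrier)
next
  show "fraction_inclusion A S \<one>\<^bsub>L\<^esub> = \<one>\<^bsub>B\<^esub>"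
    using R.S_one subringE(3)[OF subring_axioms]
    by (simp add: R.one_localization A.one_localization fraction_inclusion_fraction)
qed

end

section \<open>Locally nilpotent derivations\<close>

lemma (in ring) subring_finsum:
  assumes "subring H R" "f \<in> I \<rightarrow> H"
  shows "finsum R f I \<in> H"
  using assms(2)
proof (induction I rule: infinite_finite_induct)
  case (insert i I)
  have HR: "H \<subseteq> carrier R" by (rule subringE(1)[OF assms(1)])
  then have "finsum R f (insert i I) = f i \<oplus> finsum R f I"
    using insert by (intro finsum_insert) auto
  then show ?case using insert subringE(7)[OF assms(1)] by auto
qed (use subringE(2)[OF assms(1)] in auto)

lemma (in ring) subring_pow: "subring H R \<Longrightarrow> x \<in> H \<Longrightarrow> x [^] (n::nat) \<in> H"
  by (induction n) (auto intro: subringE(3,6))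

lemma (in domain) pow_nonzero: "x \<in> carrier R \<Longrightarrow> x \<noteq> \<zero> \<Longrightarrow> x [^] (n::nat) \<noteq> \<zero>"
  by (induction n) (auto simp: integral_iff)

locale ga_action = domain A for A :: "(complex, 'a) module" (structure) +
  fixes \<delta> :: "'a \<Rightarrow> 'a"
  assumes complex_algebra: "algebra (ring_of_type_algebra :: complex ring) A"
    and lnd: "locally_nilpotent_derivation A \<delta>"
begin

definition const :: "complex \<Rightarrow> 'a" where "const c = c \<odot> \<one>"

definition ker :: "'a set" where "ker = {x \<in> carrier A. \<delta> x = \<zero>}"

lemma invariant_ring_eq: "invariant_ring A \<delta> = A\<lparr>carrier := ker\<rparr>"
  by (simp add: invariant_ring_def ker_def)

lemma const_closed [simp]: "const c \<in> carrier A"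
  and const_add: "const (c + d) = const c \<oplus> const d"
  and const_mult: "const (c * d) = const c \<otimes> const d"
  and const_one [simp]: "const 1 = \<one>"
  and smult_const: "x \<in> carrier A \<Longrightarrow> c \<odot> x = const c \<otimes> x"
proof -
  interpret alg: algebra "ring_of_type_algebra :: complex ring" A by (rule complex_algebra)
  note d = ring_of_type_algebra_def
  show 1: "const c \<in> carrier A" for c using alg.smult_closed[of c \<one>] by (simp add: const_def d)
  show "const (c + d) = const c \<oplus> const d"
    using alg.smult_l_distr[of c d \<one>] by (simp add: const_def d)
  show "const 1 = \<one>" using alg.smult_one[of \<one>] by (simp add: const_def d)
  show 2: "x \<in> carrier A \<Longrightarrow> c \<odot> x = const c \<otimes> x" for x c
    using alg.smult_assoc2[of c \<one> x] by (simp add: const_def d)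
  have "const (c * d) = c \<odot> const d"
    using alg.smult_assoc1[of c d \<one>] by (simp add: const_def d)
  then show "const (c * d) = const c \<otimes> const d" by (simp only: 2[OF 1])
qed

lemma const_zero [simp]: "const 0 = \<zero>"
  using const_add[of 0 0] const_closed[of 0] by (metis add_0 add.l_cancel_one)

lemma const_uminus: "const (- c) = \<ominus> const c"
proof -
  have "const (- c) \<oplus> const c = \<zero>" using const_add[of "-c" c] by simp
  then show ?thesis by (metis const_closed minus_equality)
qed

lemma const_diff: "const (c - d) = const c \<ominus> const d"
  using const_add[of c "- d"] by (simp add: const_uminus a_minus_def)

lemma const_inverse: "c \<noteq> 0 \<Longrightarrow> const c \<otimes> const (inverse c) = \<one>"
  by (simp flip: const_mult)

lemma const_eq_zero [simp]: "const c = \<zero> \<longleftrightarrow> c = 0"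
  using const_inverse[of c] by (cases "c = 0") auto

lemma D_closed [simp]: "x \<in> carrier A \<Longrightarrow> \<delta> x \<in> carrier A"
  and D_add: "x \<in> carrier A \<Longrightarrow> y \<in> carrier A \<Longrightarrow> \<delta> (x \<oplus> y) = \<delta> x \<oplus> \<delta> y"
  and D_mult: "x \<in> carrier A \<Longrightarrow> y \<in> carrier A \<Longrightarrow> \<delta> (x \<otimes> y) = x \<otimes> \<delta> y \<oplus> \<delta> x \<otimes> y"
  and D_smult: "x \<in> carrier A \<Longrightarrow> \<delta> (const c \<otimes> x) = const c \<otimes> \<delta> x"
  and D_nilpotent: "x \<in> carrier A \<Longrightarrow> \<exists>n. (\<delta> ^^ n) x = \<zero>"
  using lnd by (auto simp: locally_nilpotent_derivation_def Pi_def smult_const[symmetric])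

lemma D_zero [simp]: "\<delta> \<zero> = \<zero>"
  using D_add[of \<zero> \<zero>] by (metis D_closed zero_closed r_zero add.l_cancel_one)

lemma D_one [simp]: "\<delta> \<one> = \<zero>"
  using D_mult[of \<one> \<one>] by (metis D_closed one_closed l_one r_one add.l_cancel_one)

lemma D_const [simp]: "\<delta> (const c) = \<zero>"
  using D_smult[of \<one> c] by simp

lemma D_uminus: assumes "x \<in> carrier A" shows "\<delta> (\<ominus> x) = \<ominus> \<delta> x"
proof -
  have "\<delta> (\<ominus> x) \<oplus> \<delta> x = \<delta> (\<ominus> x \<oplus> x)" using assms by (subst D_add) auto
  then have "\<delta> (\<ominus> x) \<oplus> \<delta> x = \<zero>" using assms by (simp add: l_neg)
  then show ?thesis using assms by (metis D_closed a_inv_closed minus_equality)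
qed

lemma D_diff: "x \<in> carrier A \<Longrightarrow> y \<in> carrier A \<Longrightarrow> \<delta> (x \<ominus> y) = \<delta> x \<ominus> \<delta> y"
  by (simp add: a_minus_def D_add D_uminus)

lemma kerI: "x \<in> carrier A \<Longrightarrow> \<delta> x = \<zero> \<Longrightarrow> x \<in> ker"
  and ker_carrier: "x \<in> ker \<Longrightarrow> x \<in> carrier A"
  and D_ker: "x \<in> ker \<Longrightarrow> \<delta> x = \<zero>"
  by (auto simp: ker_def)

lemma ker_subring: "subring ker A"
  by (rule subringI) (auto intro!: kerI simp: D_uminus D_add D_mult D_ker ker_carrier)

lemma const_ker [simp]: "const c \<in> ker"
  by (simp add: kerI)

lemma zero_ker [simp]: "\<zero> \<in> ker"
  and one_ker [simp]: "\<one> \<in> ker"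
  and add_ker [simp]: "x \<in> ker \<Longrightarrow> y \<in> ker \<Longrightarrow> x \<oplus> y \<in> ker"
  and mult_ker [simp]: "x \<in> ker \<Longrightarrow> y \<in> ker \<Longrightarrow> x \<otimes> y \<in> ker"
  and uminus_ker [simp]: "x \<in> ker \<Longrightarrow> \<ominus> x \<in> ker"
  using subringE[OF ker_subring] by auto

lemma diff_ker [simp]: "x \<in> ker \<Longrightarrow> y \<in> ker \<Longrightarrow> x \<ominus> y \<in> ker"
  by (simp add: a_minus_def)

lemma pow_ker [simp]: "x \<in> ker \<Longrightarrow> x [^] (n::nat) \<in> ker"
  by (induction n) auto

lemma D_ker_mult: "c \<in> ker \<Longrightarrow> x \<in> carrier A \<Longrightarrow> \<delta> (c \<otimes> x) = c \<otimes> \<delta> x"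
  by (simp add: D_mult D_ker ker_carrier)

lemma Dn_closed [simp]: "x \<in> carrier A \<Longrightarrow> (\<delta> ^^ n) x \<in> carrier A"
  by (induction n) auto

lemma Dn_zero [simp]: "(\<delta> ^^ n) \<zero> = \<zero>"
  by (induction n) auto

lemma Dn_add: "x \<in> carrier A \<Longrightarrow> y \<in> carrier A \<Longrightarrow> (\<delta> ^^ n) (x \<oplus> y) = (\<delta> ^^ n) x \<oplus> (\<delta> ^^ n) y"
  by (induction n) (auto simp: D_add)

lemma Dn_diff: "x \<in> carrier A \<Longrightarrow> y \<in> carrier A \<Longrightarrow> (\<delta> ^^ n) (x \<ominus> y) = (\<delta> ^^ n) x \<ominus> (\<delta> ^^ n) y"
  by (induction n) (auto simp: D_diff)

lemma Dn_ker_mult: "c \<in> ker \<Longrightarrow> x \<in> carrier A \<Longrightarrow> (\<delta> ^^ n) (c \<otimes> x) = c \<otimes> (\<delta> ^^ n) x"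
  by (induction n) (auto simp: D_ker_mult ker_carrier)

lemma Dn_finsum:
  "finite I \<Longrightarrow> (\<And>i. i \<in> I \<Longrightarrow> g i \<in> carrier A) \<Longrightarrow>
    (\<delta> ^^ n) (\<Oplus>i\<in>I. g i) = (\<Oplus>i\<in>I. (\<delta> ^^ n) (g i))"
proof (induction rule: finite_induct)
  case (insert i I)
  then show ?case by (simp add: Pi_def Dn_add)
qed simp

lemma Dn_mono: "(\<delta> ^^ m) x = \<zero> \<Longrightarrow> m \<le> n \<Longrightarrow> (\<delta> ^^ n) x = \<zero>"
  using funpow_add[of "n - m" m \<delta>] by simp

text \<open>The order of nilpotency of \<open>x\<close> plays the part of the degree of a polynomial.\<close>

lemma exact_order:
  assumes "x \<in> carrier A" "x \<noteq> \<zero>"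
  obtains n where "(\<delta> ^^ n) x \<noteq> \<zero>" "(\<delta> ^^ Suc n) x = \<zero>"
proof -
  define k where "k = (LEAST n. (\<delta> ^^ n) x = \<zero>)"
  have k: "(\<delta> ^^ k) x = \<zero>" unfolding k_def using D_nilpotent[OF assms(1)] by (rule LeastI_ex)
  then obtain n where n: "k = Suc n" using assms(2) by (cases k) auto
  then have "n < k" by simp
  then have "(\<delta> ^^ n) x \<noteq> \<zero>" unfolding k_def by (rule not_less_Least)
  then show ?thesis using that k n by simp
qed

text \<open>In the iterated Leibniz formula for \<open>x y\<close> the term with \<open>m\<close> derivatives on \<open>x\<close> and \<open>n\<close> on \<open>y\<close> is the
  only one that survives.\<close>

lemma Dn_mult_top:
  assumes "x \<in> carrier A" "y \<in> carrier A" "(\<delta> ^^ Suc m) x = \<zero>" "(\<delta> ^^ Suc n) y = \<zero>"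
  shows "(\<delta> ^^ (m + n)) (x \<otimes> y) = const (of_nat ((m + n) choose m)) \<otimes> ((\<delta> ^^ m) x \<otimes> (\<delta> ^^ n) y)"
  using assms
proof (induction "m + n" arbitrary: x y m n)
  case 0
  then show ?case by simp
next
  case (Suc k)
  have 1: "(\<delta> ^^ (m + n)) (x \<otimes> y) = (\<delta> ^^ k) (x \<otimes> \<delta> y) \<oplus> (\<delta> ^^ k) (\<delta> x \<otimes> y)"
    using Suc.prems Suc.hyps(2)[symmetric]
    by (simp add: funpow_swap1 del: funpow.simps) (simp add: funpow_swap1 D_mult Dn_add)
  consider "m = 0" "n = Suc k" | "n = 0" "m = Suc k" | i j where "m = Suc i" "n = Suc j"
    using Suc.hyps(2) by (cases m; cases n) auto
  then show ?case
  proof cases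
    case 1
    then have "x \<in> ker" using Suc.prems by (intro kerI) simp_all
    then show ?thesis using 1 Suc.prems by (simp add: Dn_ker_mult del: funpow.simps)
  next
    case 2
    then have "y \<in> ker" using Suc.prems by (intro kerI) simp_all
    then show ?thesis using 2 Suc.prems Dn_ker_mult[of y x "Suc k"]
      by (simp add: m_comm del: funpow.simps)
  next
    case 3
    have k: "k = m + j" "k = i + n" using Suc.hyps(2) 3 by auto
    have a: "(\<delta> ^^ k) (x \<otimes> \<delta> y) = const (of_nat (k choose m)) \<otimes> ((\<delta> ^^ m) x \<otimes> (\<delta> ^^ j) (\<delta> y))"
      using Suc.hyps(1)[of m j x "\<delta> y"] k Suc.prems 3 by (simp add: funpow_swap1)
    have b: "(\<delta> ^^ k) (\<delta> x \<otimes> y) = const (of_nat (k choose i)) \<otimes> ((\<delta> ^^ i) (\<delta> x) \<otimes> (\<delta> ^^ n) y)"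
      using Suc.hyps(1)[of i n "\<delta> x" y] k Suc.prems 3 by (simp add: funpow_swap1)
    have c: "(\<delta> ^^ j) (\<delta> y) = (\<delta> ^^ n) y" "(\<delta> ^^ i) (\<delta> x) = (\<delta> ^^ m) x"
      using 3 by (simp_all add: funpow_swap1)
    have "(m + n) choose m = (k choose m) + (k choose i)"
      using binomial_Suc_Suc[of k i] Suc.hyps(2) 3(1) by simp
    then show ?thesis unfolding 1 a b c
      using Suc.prems(1,2) by (simp add: const_add l_distr)
  qed
qed

text \<open>The kernel is factorially closed: orders of nilpotency add up in a product.\<close>

lemma ker_factor:
  assumes "x \<in> carrier A" "y \<in> carrier A" "x \<otimes> y \<in> ker" "x \<otimes> y \<noteq> \<zero>"
  shows "x \<in> ker"
proof -
  have "x \<noteq> \<zero>" "y \<noteq> \<zero>" using assms by auto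
  obtain m where m: "(\<delta> ^^ m) x \<noteq> \<zero>" "(\<delta> ^^ Suc m) x = \<zero>"
    using exact_order[OF assms(1) \<open>x \<noteq> \<zero>\<close>] .
  obtain n where n: "(\<delta> ^^ n) y \<noteq> \<zero>" "(\<delta> ^^ Suc n) y = \<zero>"
    using exact_order[OF assms(2) \<open>y \<noteq> \<zero>\<close>] .
  have "(\<delta> ^^ (m + n)) (x \<otimes> y) \<noteq> \<zero>"
    using Dn_mult_top[OF assms(1,2) m(2) n(2)] m(1) n(1) assms(1,2)
    by (simp add: integral_iff)
  moreover have "(\<delta> ^^ (m + n)) (x \<otimes> y) = \<zero>" if "m \<noteq> 0"
    using Dn_mono[of 1 "x \<otimes> y" "m + n"] D_ker[OF assms(3)] that by simp
  ultimately have "m = 0" by blast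
  then have "\<delta> x = \<zero>" using m(2) by simp
  with assms(1) show ?thesis by (rule kerI)
qed

lemma ker_factor2:
  assumes "x \<in> carrier A" "y \<in> carrier A" "x \<otimes> y \<in> ker" "x \<otimes> y \<noteq> \<zero>"
  shows "y \<in> ker"
proof -
  have e: "x \<otimes> y = y \<otimes> x" by (rule m_comm[OF assms(1,2)])
  show ?thesis by (rule ker_factor[OF assms(2,1) assms(3,4)[unfolded e]])
qed

text \<open>A preimage \<open>s\<close> of a nonzero invariant \<open>f\<close> behaves like a coordinate on the open
  set \<open>f \<noteq> 0\<close>: \<open>\<delta>\<close> acts on polynomials in \<open>s\<close> over the kernel as \<open>f \<cdot> d/ds\<close>.\<close>

lemma D_pow:
  assumes s: "s \<in> carrier A"
  shows "\<delta> (s [^] Suc n) = const (of_nat (Suc n)) \<otimes> (\<delta> s \<otimes> s [^] n)"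
proof (induction n)
  case 0
  have "\<delta> s \<in> carrier A" using s by simp
  then show ?case using s by simp
next
  case (Suc n)
  define f where "f = \<delta> s"
  define q where "q = const (of_nat (Suc n))"
  have f: "f \<in> carrier A" and q: "q \<in> carrier A" using s by (simp_all add: f_def q_def)
  have c: "const (of_nat (Suc (Suc n))) = \<one> \<oplus> q"
    using const_add[of 1 "of_nat (Suc n)"] by (simp only: of_nat_Suc[of "Suc n"] const_one q_def)
  have "\<delta> (s [^] Suc (Suc n)) = s [^] Suc n \<otimes> \<delta> s \<oplus> \<delta> (s [^] Suc n) \<otimes> s"
    unfolding nat_pow_Suc[of s "Suc n"] using s by (intro D_mult) simp_all
  also have "\<dots> = s [^] Suc n \<otimes> f \<oplus> (q \<otimes> (f \<otimes> s [^] n)) \<otimes> s"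
    unfolding Suc q_def f_def ..
  also have "\<dots> = (\<one> \<oplus> q) \<otimes> (f \<otimes> s [^] Suc n)"
    using s f q by (simp add: l_distr r_distr m_ac)
  finally show ?case unfolding c f_def .
qed

lemma Dn_pow:
  assumes "s \<in> carrier A" "\<delta> s = f" "f \<in> ker"
  shows "(\<delta> ^^ n) (s [^] n) = const (fact n) \<otimes> f [^] n"
proof (induction n)
  case (Suc n)
  have "(\<delta> ^^ Suc n) (s [^] Suc n) = (\<delta> ^^ n) (\<delta> (s [^] Suc n))" by (simp add: funpow_swap1)
  also have "\<dots> = const (of_nat (Suc n)) \<otimes> (f \<otimes> (const (fact n) \<otimes> f [^] n))"
    using assms Suc ker_carrier[OF assms(3)] by (simp only: D_pow[OF assms(1)]) (simp add: Dn_ker_mult)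
  also have "\<dots> = const (fact (Suc n)) \<otimes> f [^] Suc n"
    using ker_carrier[OF assms(3)] const_mult[of "of_nat (Suc n)" "fact n"] by (simp add: m_ac)
  finally show ?case .
qed simp

lemma Dn_pow_zero:
  assumes "s \<in> carrier A" "\<delta> s = f" "f \<in> ker" "n < m"
  shows "(\<delta> ^^ m) (s [^] n) = \<zero>"
proof (rule Dn_mono)
  show "(\<delta> ^^ Suc n) (s [^] n) = \<zero>"
    using Dn_pow[OF assms(1-3), of n] assms(3) D_ker[of "const (fact n) \<otimes> f [^] n"] by simp
qed (use assms in simp)

text \<open>Applying \<open>\<delta>\<close> as often as the degree to an equation for \<open>s\<close> leaves only the leading coefficient,
  times a nonzero integer and a power of \<open>\<delta> s\<close>.\<close>

lemma local_slice_transcendental: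
  assumes "s \<in> carrier A" "\<delta> s \<in> ker" "\<delta> s \<noteq> \<zero>"
    and "\<And>i. i \<le> n \<Longrightarrow> c i \<in> ker" "(\<Oplus>i\<in>{..n}. c i \<otimes> s [^] i) = \<zero>" "i \<le> (n::nat)"
  shows "c i = \<zero>"
  using assms(4-)
proof (induction n arbitrary: i)
  case 0
  have "c 0 \<in> carrier A" using 0(1)[of 0] ker_carrier by simp
  then show ?case using 0(2,3) by (simp del: atMost_0)
next
  case (Suc n)
  let ?f = "\<delta> s"
  have cl: "c i \<otimes> s [^] i \<in> carrier A" if "i \<le> Suc n" for i
    using that Suc.prems(1)[THEN ker_carrier] assms(1) by simp
  have "\<zero> = (\<delta> ^^ Suc n) (\<Oplus>i\<in>{..Suc n}. c i \<otimes> s [^] i)" using Suc.prems by simp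
  also have "\<dots> = (\<Oplus>i\<in>{..Suc n}. (\<delta> ^^ Suc n) (c i \<otimes> s [^] i))"
    by (rule Dn_finsum) (use cl in auto)
  also have "\<dots> = (\<Oplus>i\<in>{..Suc n}. if i = Suc n then c i \<otimes> (const (fact i) \<otimes> ?f [^] i) else \<zero>)"
  proof (rule finsum_cong')
    fix i assume "i \<in> {..Suc n}"
    then have i: "i \<le> Suc n" by simp
    then have "(\<delta> ^^ Suc n) (c i \<otimes> s [^] i) = c i \<otimes> (\<delta> ^^ Suc n) (s [^] i)"
      using Suc.prems(1) assms(1) by (intro Dn_ker_mult) auto
    moreover have "(\<delta> ^^ Suc n) (s [^] i) =
      (if i = Suc n then const (fact i) \<otimes> ?f [^] i else \<zero>)"
    proof (cases "i = Suc n")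
      case True
      show ?thesis unfolding if_P[OF True] unfolding True by (rule Dn_pow[OF assms(1) refl assms(2)])
    next
      case False
      then show ?thesis using Dn_pow_zero[OF assms(1) refl assms(2), of i "Suc n"] i by auto
    qed
    ultimately show "(\<delta> ^^ Suc n) (c i \<otimes> s [^] i) =
        (if i = Suc n then c i \<otimes> (const (fact i) \<otimes> ?f [^] i) else \<zero>)"
      using ker_carrier[OF Suc.prems(1)[OF i]] by (simp del: funpow.simps)
  qed (use Suc.prems(1)[THEN ker_carrier] assms(1) assms(2)[THEN ker_carrier] in auto)
  also have "\<dots> = c (Suc n) \<otimes> (const (fact (Suc n)) \<otimes> ?f [^] Suc n)"
    using Suc.prems(1)[THEN ker_carrier] assms(1) assms(2)[THEN ker_carrier] by (subst finsum_Suc) (auto cong: finsum_cong)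
  finally have "c (Suc n) \<otimes> (const (fact (Suc n)) \<otimes> ?f [^] Suc n) = \<zero>" by (rule sym)
  moreover have "const (fact (Suc n)) \<otimes> ?f [^] Suc n \<noteq> \<zero>"
  proof -
    have "const (fact (Suc n)) \<noteq> \<zero>" unfolding const_eq_zero by (rule fact_nonzero)
    moreover have "?f [^] Suc n \<noteq> \<zero>"
      using assms(3) assms(2)[THEN ker_carrier] by (rule pow_nonzero[rotated])
    ultimately show ?thesis using assms(2)[THEN ker_carrier] by (metis const_closed integral nat_pow_closed)
  qed
  ultimately have top: "c (Suc n) = \<zero>"
    using Suc.prems(1)[of "Suc n", THEN ker_carrier] assms(2)[THEN ker_carrier]
    by (metis const_closed integral m_closed nat_pow_closed order_refl)
  have "(\<Oplus>i\<in>{..n}. c i \<otimes> s [^] i) = \<zero>"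
    using Suc.prems(2) top cl assms(1) by simp
  then show ?case using Suc.IH Suc.prems(1,3) top by (metis le_SucE le_SucI)
qed

lemma local_slice_generates:
  assumes "s \<in> carrier A" "\<delta> s = f" "f \<in> ker" "t \<in> carrier A"
  shows "\<exists>N::nat. f [^] N \<otimes> t \<in> generate_ring A (insert s ker)"
proof -
  let ?G = "generate_ring A (insert s ker)"
  have "insert s ker \<subseteq> carrier A" using assms(1) ker_carrier by auto
  then have sub: "subring ?G A" by (rule generate_ring_is_subring)
  have kG: "c \<in> ?G" if "c \<in> ker" for c using that by (auto intro: generate_ring.incl)
  have sG: "s [^] (k::nat) \<in> ?G" for k
    by (induction k) (auto intro: generate_ring.intros)
  have f: "f \<in> carrier A" using assms(3) by (rule ker_carrier)
  have gen: "\<exists>N::nat. f [^] N \<otimes> t \<in> ?G" if "t \<in> carrier A" "(\<delta> ^^ n) t = \<zero>" for t n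
    using that
  proof (induction n arbitrary: t)
    case 0
    then show ?case using kG[of \<zero>] by (auto intro!: exI[of _ 0])
  next
    case (Suc n)
    define e where "e = (\<delta> ^^ n) t"
    have e: "e \<in> ker" using Suc.prems by (intro kerI) (simp_all add: e_def)
    note e' = ker_carrier[OF e]
    \<comment> \<open>Cancel the top term of \<open>t\<close>, viewed as a polynomial in \<open>s / f\<close>.\<close>
    define t' where "t' = const (fact n) \<otimes> f [^] n \<otimes> t \<ominus> e \<otimes> s [^] n"
    have t': "t' \<in> carrier A" using Suc.prems(1) e' assms(1) f by (simp add: t'_def)
    have "(\<delta> ^^ n) t' = const (fact n) \<otimes> f [^] n \<otimes> e \<ominus> e \<otimes> (const (fact n) \<otimes> f [^] n)"
      using Suc.prems(1) e e' assms f Dn_pow[OF assms(1-3)]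
      by (simp add: t'_def Dn_diff Dn_ker_mult e_def[symmetric])
    also have "\<dots> = \<zero>" using e' f by (simp add: m_ac)
    finally obtain N :: nat where N: "f [^] N \<otimes> t' \<in> ?G" using Suc.IH[OF t'] by auto
    define w where "w = const (inverse (fact n))"
    have w: "w \<in> carrier A" "w \<in> ker" "w \<otimes> const (fact n) = \<one>"
      using const_inverse[of "fact n"] by (auto simp: w_def m_comm)
    have "f [^] N \<otimes> t' \<oplus> f [^] N \<otimes> (e \<otimes> s [^] n) = f [^] N \<otimes> (const (fact n) \<otimes> f [^] n \<otimes> t)"
      using t' Suc.prems(1) e' assms(1) f by (simp add: t'_def a_minus_def r_distr[symmetric] a_assoc l_neg)
    then have "w \<otimes> (f [^] N \<otimes> t' \<oplus> f [^] N \<otimes> (e \<otimes> s [^] n)) = (w \<otimes> const (fact n)) \<otimes> (f [^] N \<otimes> f [^] n \<otimes> t)"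
      using w(1) f Suc.prems(1) by (simp add: m_ac)
    then have "w \<otimes> (f [^] N \<otimes> t' \<oplus> f [^] N \<otimes> (e \<otimes> s [^] n)) = f [^] (N + n) \<otimes> t"
      using w f Suc.prems(1) by (simp add: nat_pow_mult)
    moreover have "w \<otimes> (f [^] N \<otimes> t' \<oplus> f [^] N \<otimes> (e \<otimes> s [^] n)) \<in> ?G"
    proof -
      have "f [^] N \<otimes> (e \<otimes> s [^] n) \<in> ?G"
        using kG[OF e] kG[OF pow_ker[OF assms(3)]] sG by (intro subringE(6)[OF sub]) auto
      then show ?thesis using N kG[OF w(2)] subringE(6,7)[OF sub] by blast
    qed
    ultimately have "f [^] (N + n) \<otimes> t \<in> ?G" by (simp only:)
    then show ?case by blast
  qed
  obtain n where "(\<delta> ^^ n) t = \<zero>" using D_nilpotent[OF assms(4)] ..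
  then show ?thesis by (rule gen[OF assms(4)])
qed

end

section \<open>Transcendence towers and chains of prime ideals\<close>

text \<open>Gaussian elimination: each equation either is trivial or allows one unknown to be expressed in
  terms of the others.\<close>

lemma underdetermined_system:
  fixes \<gamma> :: "'i \<Rightarrow> 'm \<Rightarrow> 'k::field"
  assumes "finite F" "finite I" "card F < card I"
  shows "\<exists>l. (\<exists>i\<in>I. l i \<noteq> 0) \<and> (\<forall>m\<in>F. (\<Sum>i\<in>I. l i * \<gamma> i m) = 0)"
  using assms
proof (induction F arbitrary: I \<gamma> rule: finite_induct)
  case empty
  then have "I \<noteq> {}" by auto
  then show ?case by (intro exI[of _ "\<lambda>_. 1"]) auto
next
  case (insert m F)
  show ?case
  proof (cases "\<forall>i\<in>I. \<gamma> i m = 0")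
    case True
    have "card F < card I" using insert by simp
    then obtain l where "\<exists>i\<in>I. l i \<noteq> 0" "\<forall>k\<in>F. (\<Sum>i\<in>I. l i * \<gamma> i k) = 0"
      using insert.IH[of I \<gamma>] insert.prems by auto
    then show ?thesis using True by (intro exI[of _ l]) auto
  next
    case False
    then obtain p where p: "p \<in> I" "\<gamma> p m \<noteq> 0" by auto
    define J where "J = I - {p}"
    have J: "finite J" "card F < card J" "I = insert p J" "p \<notin> J"
      using insert.prems insert.hyps p by (auto simp: J_def)
    \<comment> \<open>Eliminate the unknown at the pivot \<open>p\<close>.\<close>
    obtain l where l: "\<exists>i\<in>J. l i \<noteq> 0"
      "\<forall>k\<in>F. (\<Sum>i\<in>J. l i * (\<gamma> i k - \<gamma> i m / \<gamma> p m * \<gamma> p k)) = 0"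
      using insert.IH[of J "\<lambda>i k. \<gamma> i k - \<gamma> i m / \<gamma> p m * \<gamma> p k"] J by auto
    define w where "w = - (\<Sum>i\<in>J. l i * \<gamma> i m) / \<gamma> p m"
    define l' where "l' = (\<lambda>i. if i = p then w else l i)"
    have sum: "(\<Sum>i\<in>I. l' i * \<gamma> i k) = w * \<gamma> p k + (\<Sum>i\<in>J. l i * \<gamma> i k)" for k
    proof -
      have "(\<Sum>i\<in>J. l' i * \<gamma> i k) = (\<Sum>i\<in>J. l i * \<gamma> i k)"
        using J by (intro sum.cong) (auto simp: l'_def)
      then show ?thesis using J by (simp add: l'_def)
    qed
    have "(\<Sum>i\<in>I. l' i * \<gamma> i m) = 0" unfolding sum using p by (simp add: w_def)
    moreover have "(\<Sum>i\<in>I. l' i * \<gamma> i k) = 0" if "k \<in> F" for k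
    proof -
      have "0 = (\<Sum>i\<in>J. l i * (\<gamma> i k - \<gamma> i m / \<gamma> p m * \<gamma> p k))" using l(2) that by simp
      also have "\<dots> = (\<Sum>i\<in>J. l i * \<gamma> i k) - (\<Sum>i\<in>J. l i * \<gamma> i m) * \<gamma> p k / \<gamma> p m"
        by (simp add: right_diff_distrib sum_subtractf sum_distrib_right sum_divide_distrib mult.assoc)
      finally show ?thesis unfolding sum by (simp add: w_def)
    qed
    moreover have "\<exists>i\<in>I. l' i \<noteq> 0" using l(1) J by (auto simp: l'_def)
    ultimately show ?thesis by (intro exI[of _ l']) auto
  qed
qed

subsection \<open>Ideals\<close>

lemma (in cring) ideal_adjoin:
  assumes "ideal J R" "a \<in> carrier R"
  defines "J' \<equiv> {j \<oplus> r \<otimes> a | j r. j \<in> J \<and> r \<in> carrier R}"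
  shows "ideal J' R" "J \<subseteq> J'" "a \<in> J'"
proof -
  interpret J: ideal J R by fact
  have J': "J' = J <+>\<^bsub>R\<^esub> PIdl a"
    by (auto simp: J'_def set_add_def' cgenideal_def)
  show "ideal J' R" unfolding J' using assms(1) cgenideal_ideal[OF assms(2)] by (rule add_ideals)
  show "J \<subseteq> J'"
  proof
    fix j assume "j \<in> J"
    then have "j = j \<oplus> \<zero> \<otimes> a" using assms(2) J.Icarr by simp
    then show "j \<in> J'" using \<open>j \<in> J\<close> unfolding J'_def by blast
  qed
  have "a = \<zero> \<oplus> \<one> \<otimes> a" using assms(2) by simp
  then show "a \<in> J'" unfolding J'_def using J.zero_closed by blast
qed

text \<open>Zorn's lemma gives an ideal \<open>M\<close> that is maximal among those containing \<open>J\<close> and disjoint from \<open>T\<close>. If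
  neither \<open>a\<close> nor \<open>b\<close> is in \<open>M\<close>, then adjoining either of them yields an element of \<open>T\<close>; the product of
  the two elements lies in \<open>T\<close>, so \<open>a b\<close> cannot be in \<open>M\<close>.\<close>

lemma (in cring) prime_avoiding:
  assumes J: "ideal J R" and T: "T \<subseteq> carrier R" "\<one> \<in> T" "\<And>s t. s \<in> T \<Longrightarrow> t \<in> T \<Longrightarrow> s \<otimes> t \<in> T"
    and disj: "J \<inter> T = {}"
  shows "\<exists>P. primeideal P R \<and> J \<subseteq> P \<and> P \<inter> T = {}"
proof -
  define Q where "Q = {K. ideal K R \<and> J \<subseteq> K \<and> K \<inter> T = {}}"
  have "\<exists>M\<in>Q. \<forall>Y\<in>Q. M \<subseteq> Y \<longrightarrow> Y = M"
  proof (rule subset_Zorn_nonempty)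
    show "Q \<noteq> {}" using J disj by (auto simp: Q_def)
    fix C assume C: "C \<noteq> {}" "subset.chain Q C"
    then have "subset.chain {K. ideal K R} C" by (auto simp: pred_on.chain_def Q_def)
    from chain_Union_is_ideal[OF this] C(1) have "ideal (\<Union>C) R" by simp
    then show "\<Union>C \<in> Q" using C by (auto simp: Q_def pred_on.chain_def)
  qed
  then obtain M where M: "ideal M R" "J \<subseteq> M" "M \<inter> T = {}"
    and max: "\<And>Y. ideal Y R \<Longrightarrow> M \<subseteq> Y \<Longrightarrow> Y \<inter> T = {} \<Longrightarrow> Y = M"
    by (auto simp: Q_def)
  interpret M: ideal M R by fact
  have "primeideal M R"
  proof (rule primeidealI[OF M(1) is_cring])
    show "carrier R \<noteq> M" using M(3) T(2) by auto
    fix a b assume ab: "a \<in> carrier R" "b \<in> carrier R" "a \<otimes> b \<in> M"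
    have meet: "\<exists>t\<in>T. \<exists>j r. j \<in> M \<and> r \<in> carrier R \<and> t = j \<oplus> r \<otimes> c"
      if "c \<in> carrier R" "c \<notin> M" for c
    proof (rule ccontr)
      assume *: "\<not> ?thesis"
      note adj = ideal_adjoin[OF M(1) that(1)]
      from * have "{j \<oplus> r \<otimes> c | j r. j \<in> M \<and> r \<in> carrier R} \<inter> T = {}" by blast
      from max[OF adj(1,2) this] adj(3) that(2) show False by simp
    qed
    show "a \<in> M \<or> b \<in> M"
    proof (rule ccontr)
      assume *: "\<not> ?thesis"
      obtain t j r where 1: "t \<in> T" "j \<in> M" "r \<in> carrier R" "t = j \<oplus> r \<otimes> a"
        using meet[OF ab(1)] * by auto
      obtain t' j' r' where 2: "t' \<in> T" "j' \<in> M" "r' \<in> carrier R" "t' = j' \<oplus> r' \<otimes> b"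
        using meet[OF ab(2)] * by auto
      have c: "j \<in> carrier R" "j' \<in> carrier R" "t' \<in> carrier R" using 1 2 M.Icarr T(1) by auto
      have "t \<otimes> t' = j \<otimes> t' \<oplus> (r \<otimes> a) \<otimes> j' \<oplus> (r \<otimes> r') \<otimes> (a \<otimes> b)"
      proof -
        have "t \<otimes> t' = j \<otimes> t' \<oplus> (r \<otimes> a) \<otimes> t'" using 1 ab c by (simp add: l_distr)
        also have "(r \<otimes> a) \<otimes> t' = (r \<otimes> a) \<otimes> j' \<oplus> (r \<otimes> r') \<otimes> (a \<otimes> b)"
          unfolding 2(4) using 1 2 ab c by (simp add: r_distr m_ac)
        finally show ?thesis using 1 2 ab c by (simp add: a_assoc)
      qed
      moreover have "\<dots> \<in> M"
      proof -
        have "j \<otimes> t' \<in> M" "(r \<otimes> a) \<otimes> j' \<in> M" "(r \<otimes> r') \<otimes> (a \<otimes> b) \<in> M"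
          using 1 2 ab c by (simp_all add: M.I_l_closed M.I_r_closed)
        then show ?thesis by (intro M.a_closed)
      qed
      ultimately show False using T(3)[OF 1(1) 2(1)] M(3) by auto
    qed
  qed
  then show ?thesis using M by auto
qed

lemma (in ideal) finsum_congruent:
  assumes "finite Y" "\<And>i. i \<in> Y \<Longrightarrow> f i \<in> carrier R" "\<And>i. i \<in> Y \<Longrightarrow> g i \<in> carrier R"
    and "\<And>i. i \<in> Y \<Longrightarrow> f i \<ominus> g i \<in> I"
  shows "(\<Oplus>i\<in>Y. f i) \<ominus> (\<Oplus>i\<in>Y. g i) \<in> I"
  using assms
proof (induction rule: finite_induct)
  case (insert x Y)
  have c: "(\<Oplus>i\<in>Y. f i) \<in> carrier R" "(\<Oplus>i\<in>Y. g i) \<in> carrier R" "f x \<in> carrier R" "g x \<in> carrier R"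
    using insert.prems by (auto intro!: finsum_closed)
  have "(\<Oplus>i\<in>insert x Y. f i) \<ominus> (\<Oplus>i\<in>insert x Y. g i) =
      (f x \<ominus> g x) \<oplus> ((\<Oplus>i\<in>Y. f i) \<ominus> (\<Oplus>i\<in>Y. g i))"
    using insert c by (simp add: Pi_def a_minus_def minus_add a_ac)
  also have "\<dots> \<in> I"
    by (rule additive_subgroup.a_closed[OF additive_subgroup_axioms]) (use insert in auto)
  finally show ?case .
qed (simp add: a_minus_def)

subsection \<open>Polynomial values\<close>

text \<open>Transcendence of \<open>z\<close> over \<open>D\<close> modulo an ideal \<open>P\<close>; for \<open>P = {\<zero>}\<close> it is the usual notion.\<close>

definition (in ring) transcendental_mod :: "'a set \<Rightarrow> 'a set \<Rightarrow> 'a \<Rightarrow> bool" where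
  "transcendental_mod D P z \<longleftrightarrow>
    (\<forall>(n::nat) c. (\<forall>i\<le>n. c i \<in> D) \<longrightarrow> (\<Oplus>i\<in>{..n}. c i \<otimes> z [^] i) \<in> P \<longrightarrow> (\<forall>i\<le>n. c i = \<zero>))"

locale subring_eval = cring R + subring D R for R (structure) and D +
  fixes z
  assumes z_closed [simp]: "z \<in> carrier R"
begin

abbreviation "Dr \<equiv> R\<lparr>carrier := D\<rparr>"
abbreviation "value_at \<equiv> UnivPoly.eval Dr R id z"
abbreviation "DP \<equiv> UP Dr"
abbreviation "cst a \<equiv> up_ring.monom DP a 0"
abbreviation "indet \<equiv> up_ring.monom DP \<one> (Suc 0)"

lemma Dr_cring: "cring Dr"
  using subcringI'[OF subring_axioms] subcring_iff subcringE(1) by blast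

lemma D_carrier: "a \<in> D \<Longrightarrow> a \<in> carrier R"
  using subringE(1)[OF subring_axioms] by auto

lemma pre: "UP_pre_univ_prop Dr R id"
proof -
  interpret Dr: cring Dr by (rule Dr_cring)
  show ?thesis
    by (intro UP_pre_univ_propI Dr_cring is_cring) (auto intro!: ring_hom_memI D_carrier)
qed

lemma poly_cring: "cring DP"
  by (rule UP_cring.UP_cring) (simp add: UP_cring_def Dr_cring)

lemma value_hom: "value_at \<in> ring_hom DP R"
  using UP_pre_univ_prop.eval_ring_hom[OF pre] by simp

sublocale ev: ring_hom_cring DP R value_at
  by (rule ring_hom_cringI[OF poly_cring is_cring value_hom])

lemma cst_closed: "a \<in> D \<Longrightarrow> cst a \<in> carrier DP"
  and indet_closed: "indet \<in> carrier DP"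
proof -
  interpret UP_cring Dr DP by (simp_all add: UP_cring_def Dr_cring)
  show "a \<in> D \<Longrightarrow> cst a \<in> carrier DP" by (rule monom_closed) simp
  show "indet \<in> carrier DP" using monom_closed[of \<one> "Suc 0"] R.one_closed by simp
qed

lemma value_cst: "a \<in> D \<Longrightarrow> value_at (cst a) = a"
  using UP_pre_univ_prop.eval_const[OF pre, of z a] by simp

lemma value_indet: "value_at indet = z"
  using UP_pre_univ_prop.eval_monom1[OF pre, of z] by simp

lemma value_eq:
  assumes "p \<in> carrier DP"
  shows "value_at p = (\<Oplus>i\<in>{..deg Dr p}. up_ring.coeff DP p i \<otimes> z [^] i)"
  using assms by (simp add: UnivPoly.eval_def)

lemma coeff_closed: "p \<in> carrier DP \<Longrightarrow> up_ring.coeff DP p i \<in> D"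
proof -
  interpret UP_cring Dr DP by (simp_all add: UP_cring_def Dr_cring)
  show "p \<in> carrier DP \<Longrightarrow> up_ring.coeff DP p i \<in> D"
    using coeff_closed[of p i] by simp
qed

lemma transcendental_value:
  assumes tr: "transcendental_mod D P z" and p: "p \<in> carrier DP" "value_at p \<in> P"
  shows "p = \<zero>\<^bsub>DP\<^esub>"
proof -
  have "up_ring.coeff DP p i = \<zero>" if "i \<le> deg Dr p" for i
    using tr p(2) coeff_closed[OF p(1)] that unfolding transcendental_mod_def value_eq[OF p(1)]
    by blast
  moreover
  interpret UP_cring Dr DP by (simp_all add: UP_cring_def Dr_cring) have "up_ring.coeff DP p i = \<zero>" if "\<not> i \<le> deg Dr p" for i
    using deg_aboveD[of p i] p(1) that by simp
  ultimately have "up_ring.coeff DP p i = \<zero>" for i by blast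
  then show ?thesis using p(1) by (intro up_eqI) auto
qed

lemma value_image: "subring (value_at ` carrier DP) R" "D \<subseteq> value_at ` carrier DP"
  "z \<in> value_at ` carrier DP"
proof -
  show "subring (value_at ` carrier DP) R"
    using ring_hom_ring.img_is_subring[OF ev.ring.is_ring_hom_ring ev.R.carrier_is_subring] .
  show "D \<subseteq> value_at ` carrier DP"
    using value_cst cst_closed by (metis image_eqI subsetI)
  show "z \<in> value_at ` carrier DP"
    using value_indet indet_closed by (metis image_eqI)
qed

end

subsection \<open>Finitely generated algebras are countably spanned\<close>

context ga_action
begin

text \<open>The complex linear span of \<open>M\<close>. Building combinations term by term admits an infinite \<open>M\<close>.\<close>

inductive_set cspan :: "'a set \<Rightarrow> 'a set" for M where
  cspan_zero: "\<zero> \<in> cspan M"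
| cspan_step: "m \<in> M \<Longrightarrow> x \<in> cspan M \<Longrightarrow> const c \<otimes> m \<oplus> x \<in> cspan M"

lemma cspan_coordinates:
  assumes "x \<in> cspan M" "M \<subseteq> carrier A"
  shows "\<exists>F \<gamma>. finite F \<and> F \<subseteq> M \<and> x = (\<Oplus>m\<in>F. const (\<gamma> m) \<otimes> m)"
  using assms(1)
proof induction
  case cspan_zero
  then show ?case by (intro exI[of _ "{}"]) simp
next
  case (cspan_step m x c)
  then obtain F \<gamma> where F: "finite F" "F \<subseteq> M" "x = (\<Oplus>m\<in>F. const (\<gamma> m) \<otimes> m)" by auto
  have cl: "k \<in> carrier A" if "k \<in> F" for k using that F(2) assms(2) by auto
  have m: "m \<in> carrier A" using cspan_step.hyps assms(2) by auto
  define \<gamma>' where "\<gamma>' = (\<lambda>k. if k = m then c + (if m \<in> F then \<gamma> m else 0) else \<gamma> k)"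
  define G where "G = F - {m}"
  have G: "finite G" "m \<notin> G" "insert m F = insert m G" "\<And>k. k \<in> G \<Longrightarrow> k \<in> carrier A"
    using F cl by (auto simp: G_def)
  let ?s = "\<Oplus>k\<in>G. const (\<gamma> k) \<otimes> k"
  have s: "?s \<in> carrier A" using G by (auto intro!: finsum_closed)
  have x: "x = const (if m \<in> F then \<gamma> m else 0) \<otimes> m \<oplus> ?s"
  proof (cases "m \<in> F")
    case True
    then have "F = insert m G" by (auto simp: G_def)
    then show ?thesis using True F(3) G m by (simp add: Pi_def)
  next
    case False
    then show ?thesis using F(3) m s by (simp add: G_def)
  qed
  have "(\<Oplus>k\<in>insert m F. const (\<gamma>' k) \<otimes> k) = const (\<gamma>' m) \<otimes> m \<oplus> (\<Oplus>k\<in>G. const (\<gamma>' k) \<otimes> k)"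
    unfolding G(3) using G m by (simp add: Pi_def)
  also have "(\<Oplus>k\<in>G. const (\<gamma>' k) \<otimes> k) = ?s"
    using G by (intro finsum_cong') (auto simp: \<gamma>'_def)
  also have "const (\<gamma>' m) \<otimes> m \<oplus> ?s = const c \<otimes> m \<oplus> x"
    unfolding x using m s by (simp add: \<gamma>'_def const_add l_distr a_assoc)
  finally show ?case using F cspan_step.hyps by (intro exI[of _ "insert m F"] exI[of _ \<gamma>']) auto
qed

context
  fixes M assumes M: "M \<subseteq> carrier A"
begin

lemma cspan_carrier: "x \<in> cspan M \<Longrightarrow> x \<in> carrier A"
  by (induction rule: cspan.induct) (use M in auto)

lemma cspan_base: "m \<in> M \<Longrightarrow> const c \<otimes> m \<in> cspan M"
  using cspan_step[of m M \<zero> c, OF _ cspan_zero] M by auto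

lemma cspan_add: "x \<in> cspan M \<Longrightarrow> y \<in> cspan M \<Longrightarrow> x \<oplus> y \<in> cspan M"
proof (induction rule: cspan.induct)
  case (cspan_step m x c)
  have "const c \<otimes> m \<oplus> (x \<oplus> y) \<in> cspan M"
    using cspan_step by (intro cspan.cspan_step) auto
  moreover have "const c \<otimes> m \<oplus> (x \<oplus> y) = (const c \<otimes> m \<oplus> x) \<oplus> y"
    using cspan_step M cspan_carrier by (subst a_assoc) auto
  ultimately show ?case by simp
qed (use cspan_carrier in auto)

lemma cspan_scale:
  assumes "\<And>m k. m \<in> M \<Longrightarrow> k \<in> M \<Longrightarrow> m \<otimes> k \<in> M"
  shows "x \<in> cspan M \<Longrightarrow> k \<in> M \<Longrightarrow> (const c \<otimes> k) \<otimes> x \<in> cspan M"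
proof (induction rule: cspan.induct)
  case cspan_zero
  then show ?case using cspan.cspan_zero M by auto
next
  case (cspan_step m x d)
  have cl: "m \<in> carrier A" "x \<in> carrier A" "k \<in> carrier A"
    using cspan_step M cspan_carrier by auto
  have "const (c * d) \<otimes> (k \<otimes> m) \<oplus> (const c \<otimes> k) \<otimes> x \<in> cspan M"
    using cspan_step assms by (intro cspan.cspan_step) auto
  moreover have "const (c * d) \<otimes> (k \<otimes> m) \<oplus> (const c \<otimes> k) \<otimes> x = (const c \<otimes> k) \<otimes> (const d \<otimes> m \<oplus> x)"
    using cl by (simp add: const_mult r_distr m_ac)
  ultimately show ?case by simp
qed

lemma cspan_mult:
  assumes "\<And>m k. m \<in> M \<Longrightarrow> k \<in> M \<Longrightarrow> m \<otimes> k \<in> M"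
  shows "x \<in> cspan M \<Longrightarrow> y \<in> cspan M \<Longrightarrow> x \<otimes> y \<in> cspan M"
proof (induction rule: cspan.induct)
  case cspan_zero
  then show ?case using cspan.cspan_zero cspan_carrier by auto
next
  case (cspan_step m x c)
  have cl: "m \<in> carrier A" "x \<in> carrier A" "y \<in> carrier A"
    using cspan_step M cspan_carrier by auto
  have "(const c \<otimes> m) \<otimes> y \<oplus> x \<otimes> y \<in> cspan M"
    using cspan_step by (intro cspan_add cspan_scale assms) auto
  then show ?case using cl by (simp add: l_distr)
qed

end

text \<open>The monomials in a finite set of generators span the algebra, and there are countably many.\<close>

lemma countably_spanned:
  assumes "affine_variety A"
  obtains M where "M \<subseteq> carrier A" "countable M" "carrier A = cspan M"
proof -
  obtain E where E: "E \<subseteq> carrier A" "finite E"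
    "generate_ring A (range (\<lambda>c. c \<odot> \<one>) \<union> E) = carrier A"
    using assms by (auto simp: affine_variety_def)
  define monomial where "monomial = (\<lambda>es. foldr (\<otimes>) es \<one>)"
  define M where "M = monomial ` lists E"
  have cl: "monomial es \<in> carrier A" if "es \<in> lists E" for es
    using that E(1) by (induction es) (auto simp: monomial_def)
  have app: "monomial es \<otimes> monomial fs = monomial (es @ fs)" if "es \<in> lists E" "fs \<in> lists E" for es fs
    using that(1)
  proof (induction es)
    case Nil
    then show ?case using cl[OF that(2)] by (simp add: monomial_def)
  next
    case (Cons e es)
    then show ?case using cl[of es] cl[OF that(2)] E(1)
      by (auto simp: monomial_def m_assoc subset_iff)
  qed
  have M: "M \<subseteq> carrier A" using cl by (auto simp: M_def)
  have mult: "m \<otimes> k \<in> M" if mk: "m \<in> M" "k \<in> M" for m k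
  proof -
    obtain es fs where "m = monomial es" "es \<in> lists E" "k = monomial fs" "fs \<in> lists E"
      using mk unfolding M_def image_iff by blast
    then show ?thesis unfolding M_def using app[of es fs] by (intro image_eqI[of _ _ "es @ fs"]) auto
  qed
  have one: "\<one> \<in> M" unfolding M_def by (rule image_eqI[of _ _ "[]"]) (auto simp: monomial_def)
  have inE: "e \<in> M" if "e \<in> E" for e
    unfolding M_def using that E(1) by (intro image_eqI[of _ _ "[e]"]) (auto simp: monomial_def)
  have cst: "const c \<in> cspan M" for c using cspan_base[OF M one, of c] by simp
  have "h \<in> cspan M" if "h \<in> generate_ring A (range (\<lambda>c. c \<odot> \<one>) \<union> E)" for h
    using that
  proof induction
    case one
    then show ?case using cst[of 1] by simp
  next
    case (incl h)
    then show ?case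
    proof
      assume "h \<in> range (\<lambda>c. c \<odot> \<one>)"
      then show ?thesis using cst by (auto simp: const_def)
    next
      assume "h \<in> E"
      then show ?thesis using cspan_base[OF M inE, of h 1] E(1) by auto
    qed
  next
    case (a_inv h)
    have "const (- 1) \<otimes> h \<in> cspan M" using a_inv cst by (intro cspan_mult[OF M mult]) auto
    moreover have "const (- 1) \<otimes> h = \<ominus> h"
      using cspan_carrier[OF M a_inv(2)] const_uminus[of 1] by (simp add: l_minus)
    ultimately show ?case by simp
  next
    case (eng_add h1 h2)
    then show ?case by (intro cspan_add[OF M])
  next
    case (eng_mult h1 h2)
    then show ?case by (intro cspan_mult[OF M mult])
  qed
  then have "carrier A = cspan M" using E(3) cspan_carrier[OF M] by auto
  moreover have "countable M" unfolding M_def using E(2) by (simp add: countable_finite)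
  ultimately show ?thesis using that M by blast
qed

text \<open>Among infinitely many, let alone uncountably many, elements indexed injectively there is a
  linear relation as soon as they lie in one finite-dimensional space; uncountably many elements
  of a countably spanned space have infinitely many members in one such space.\<close>

lemma uncountable_dependent:
  assumes "affine_variety A" "uncountable U" "\<And>i. i \<in> U \<Longrightarrow> b i \<in> carrier A"
  shows "\<exists>I l. finite I \<and> I \<subseteq> U \<and> (\<exists>i\<in>I. l i \<noteq> 0) \<and> (\<Oplus>i\<in>I. const (l i) \<otimes> b i) = \<zero>"
proof -
  obtain M where M: "M \<subseteq> carrier A" "countable M" "carrier A = cspan M"
    using countably_spanned[OF assms(1)] .
  have "\<forall>i\<in>U. \<exists>F \<gamma>. finite F \<and> F \<subseteq> M \<and> b i = (\<Oplus>m\<in>F. const (\<gamma> m) \<otimes> m)"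
    using assms(3) M(1,3) cspan_coordinates by metis
  then obtain F \<gamma> where F: "\<And>i. i \<in> U \<Longrightarrow> finite (F i)" "\<And>i. i \<in> U \<Longrightarrow> F i \<subseteq> M"
    "\<And>i. i \<in> U \<Longrightarrow> b i = (\<Oplus>m\<in>F i. const (\<gamma> i m) \<otimes> m)"
    by metis
  have "countable (F ` U)"
  proof (rule countable_subset)
    show "F ` U \<subseteq> {F. finite F \<and> F \<subseteq> M}" using F by auto
    show "countable {F. finite F \<and> F \<subseteq> M}"
      using countable_Collect_finite_subset[OF M(2)] by (simp add: conj_commute)
  qed
  have "\<exists>G\<in>F ` U. infinite {i \<in> U. F i = G}"
  proof (rule ccontr)
    assume "\<not> ?thesis"
    then have "countable (\<Union>G\<in>F ` U. {i \<in> U. F i = G})"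
      using \<open>countable (F ` U)\<close> by (intro countable_UN) (auto intro: countable_finite)
    moreover have "(\<Union>G\<in>F ` U. {i \<in> U. F i = G}) = U" by auto
    ultimately show False using assms(2) by simp
  qed
  then obtain G where G: "G \<in> F ` U" "infinite {i \<in> U. F i = G}" by blast
  then obtain I where I: "finite I" "card I = Suc (card G)" "I \<subseteq> {i \<in> U. F i = G}"
    using infinite_arbitrarily_large by metis
  have fG: "finite G" "G \<subseteq> carrier A" using G(1) F(1,2) M(1) by blast+
  obtain l where l: "\<exists>i\<in>I. l i \<noteq> 0" "\<forall>m\<in>G. (\<Sum>i\<in>I. l i * \<gamma> i m) = 0"
    using underdetermined_system[of G I \<gamma>] fG I by auto
  have cl: "m \<in> carrier A" if "m \<in> G" for m using that fG by auto
  have fs: "(\<Oplus>i\<in>J. const (l i) \<otimes> (\<Oplus>m\<in>G. const (\<gamma> i m) \<otimes> m)) =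
      (\<Oplus>m\<in>G. const (\<Sum>i\<in>J. l i * \<gamma> i m) \<otimes> m)" if "finite J" for J
    using that
  proof (induction rule: finite_induct)
    case empty
    then show ?case using cl by (simp cong: finsum_cong)
  next
    case (insert j J)
    have "const (l j) \<otimes> (\<Oplus>m\<in>G. const (\<gamma> j m) \<otimes> m) = (\<Oplus>m\<in>G. const (l j * \<gamma> j m) \<otimes> m)"
      using cl fG(1) by (subst finsum_rdistr) (auto intro!: finsum_cong' simp: const_mult m_assoc)
    then have "(\<Oplus>i\<in>insert j J. const (l i) \<otimes> (\<Oplus>m\<in>G. const (\<gamma> i m) \<otimes> m)) =
       (\<Oplus>m\<in>G. const (l j * \<gamma> j m) \<otimes> m) \<oplus> (\<Oplus>m\<in>G. const (\<Sum>i\<in>J. l i * \<gamma> i m) \<otimes> m)"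
      using insert cl by (subst finsum_insert) (auto intro!: finsum_closed)
    also have "\<dots> = (\<Oplus>m\<in>G. const (l j * \<gamma> j m) \<otimes> m \<oplus> const (\<Sum>i\<in>J. l i * \<gamma> i m) \<otimes> m)"
      using cl by (intro finsum_addf[symmetric]) auto
    also have "\<dots> = (\<Oplus>m\<in>G. const (\<Sum>i\<in>insert j J. l i * \<gamma> i m) \<otimes> m)"
      using cl insert by (intro finsum_cong') (auto simp: const_add l_distr)
    finally show ?case .
  qed
  have "(\<Oplus>i\<in>I. const (l i) \<otimes> b i) = (\<Oplus>i\<in>I. const (l i) \<otimes> (\<Oplus>m\<in>G. const (\<gamma> i m) \<otimes> m))"
    using I(3) F(3) cl by (intro finsum_cong') (auto intro!: finsum_closed)
  also have "\<dots> = (\<Oplus>m\<in>G. const (\<Sum>i\<in>I. l i * \<gamma> i m) \<otimes> m)" by (rule fs[OF I(1)])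
  also have "\<dots> = (\<Oplus>m\<in>G. \<zero>)" using l(2) cl by (intro finsum_cong') auto
  finally have "(\<Oplus>i\<in>I. const (l i) \<otimes> b i) = \<zero>" by simp
  then show ?thesis using I l(1) by blast
qed

end

context ga_action
begin

subsection \<open>Descending a tower through a chain of primes\<close>

lemma subring_evalI: "subring D A \<Longrightarrow> z \<in> carrier A \<Longrightarrow> subring_eval A D z"
  using is_cring by (simp add: subring_eval_def subring_eval_axioms_def)

text \<open>If \<open>z\<close> is transcendental over \<open>D\<close> modulo \<open>P\<close>, then \<open>P\<close> is not maximal among the primes
  meeting \<open>D\<close> trivially. Otherwise every \<open>z - c\<close> with \<open>c \<in> \<complex>\<close> would divide, modulo \<open>P\<close>, a nonzero
  element of \<open>D\<close>. The cofactors \<open>b c\<close> form an uncountable family in a countably spanned space, so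
  they satisfy a linear relation; multiplied by the product of the \<open>z - c\<close> involved, it turns into
  an equation for \<open>z\<close> over \<open>D\<close> modulo \<open>P\<close>. It is nontrivial: the polynomial does not vanish at those
  \<open>c\<close> whose coefficient in the relation is nonzero.\<close>

lemma larger_prime_avoiding:
  assumes fg: "affine_variety A" and P: "primeideal P A"
    and D: "subring D A" "range const \<subseteq> D" and DP: "D \<inter> P = {\<zero>}"
    and z: "z \<in> carrier A" "transcendental_mod D P z"
  shows "\<exists>Q. primeideal Q A \<and> P \<subset> Q \<and> D \<inter> Q = {\<zero>}"
proof (rule ccontr)
  assume none: "\<not> ?thesis"
  interpret P: primeideal P A by fact
  interpret E: subring_eval A D z by (rule subring_evalI) fact+
  define T where "T = D - {\<zero>}"
  have T: "T \<subseteq> carrier A" "\<one> \<in> T" "\<And>s t. s \<in> T \<Longrightarrow> t \<in> T \<Longrightarrow> s \<otimes> t \<in> T"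
    using subringE[OF D(1)] E.D_carrier by (auto simp: T_def integral_iff)
  have cD: "const c \<in> D" for c using D(2) by auto
  have zc: "z \<ominus> const c \<in> carrier A" for c using z(1) by simp
  have notin: "z \<ominus> const c \<notin> P" for c
  proof
    assume *: "z \<ominus> const c \<in> P"
    define d where "d = (\<lambda>i::nat. if i = 0 then \<ominus> const c else \<one>)"
    have "(\<Oplus>i\<in>{..Suc 0}. d i \<otimes> z [^] i) = \<one> \<otimes> (\<one> \<otimes> z) \<oplus> \<ominus> const c"
      using z(1) by (simp add: d_def)
    then have "(\<Oplus>i\<in>{..Suc 0}. d i \<otimes> z [^] i) \<in> P"
      using * z(1) by (simp add: a_minus_def)
    moreover have "\<forall>i\<le>Suc 0. d i \<in> D"
      using cD subringE(3,5)[OF D(1)] by (simp add: d_def)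
    ultimately have "d (Suc 0) = \<zero>"
      using z(2) unfolding transcendental_mod_def by blast
    then show False by (simp add: d_def)
  qed
  have "\<exists>t b. t \<in> T \<and> b \<in> carrier A \<and> t \<ominus> b \<otimes> (z \<ominus> const c) \<in> P" for c
  proof -
    define J where "J = {j \<oplus> r \<otimes> (z \<ominus> const c) | j r. j \<in> P \<and> r \<in> carrier A}"
    note J = ideal_adjoin[OF P.is_ideal zc[of c], folded J_def]
    have "J \<inter> T \<noteq> {}"
    proof
      assume "J \<inter> T = {}"
      then obtain Q where Q: "primeideal Q A" "J \<subseteq> Q" "Q \<inter> T = {}"
        using prime_avoiding[OF J(1) T] by blast
      have "\<zero> \<in> Q" by (rule additive_subgroup.zero_closed)
          (use Q(1) in \<open>simp add: primeideal_def ideal_def\<close>)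
      then have "D \<inter> Q = {\<zero>}" using Q(3) subringE(2)[OF D(1)] by (auto simp: T_def)
      moreover have "P \<subset> Q" using J(2,3) Q(2) notin[of c] by blast
      ultimately show False using none Q(1) by blast
    qed
    then obtain t j r where t: "t \<in> T" "j \<in> P" "r \<in> carrier A" "t = j \<oplus> r \<otimes> (z \<ominus> const c)"
      by (auto simp: J_def)
    have "j \<in> carrier A" using t(2) P.Icarr by simp
    then have "t \<ominus> r \<otimes> (z \<ominus> const c) = j"
      unfolding t(4) using t(3) zc by (simp add: a_minus_def a_assoc r_neg)
    then have "t \<ominus> r \<otimes> (z \<ominus> const c) \<in> P" using t(2) by simp
    then show ?thesis using t(1,3) by blast
  qed
  then obtain t b where t: "\<And>c. t c \<in> T" and b: "\<And>c. b c \<in> carrier A"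
    and tb: "\<And>c. t c \<ominus> b c \<otimes> (z \<ominus> const c) \<in> P"
    by metis
  obtain I l where I: "finite I" "\<exists>i\<in>I. l i \<noteq> 0" "(\<Oplus>i\<in>I. const (l i) \<otimes> b i) = \<zero>"
    using uncountable_dependent[OF fg uncountable_UNIV_complex, of b] b by auto
  have tD: "t c \<in> D" "t c \<noteq> \<zero>" "t c \<in> carrier A" for c using t[of c] T(1) by (auto simp: T_def)
  \<comment> \<open>The numerator of \<open>\<Sum> l i t i / (z - i)\<close>, as a polynomial in an indeterminate.\<close>
  define lin where "lin = (\<lambda>c. E.indet \<ominus>\<^bsub>E.DP\<^esub> E.cst (const c))"
  have lin: "lin c \<in> carrier E.DP" for c
    using E.indet_closed E.cst_closed[OF cD] by (simp add: lin_def)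
  have eval_lin: "E.value_at (lin c) = z \<ominus> const c" for c
    using E.indet_closed E.cst_closed[OF cD]
    by (simp add: lin_def a_minus_def E.value_cst[OF cD] E.value_indet[simplified])
  define summand where "summand = (\<lambda>i. E.cst (const (l i) \<otimes> t i) \<otimes>\<^bsub>E.DP\<^esub> finprod E.DP lin (I - {i}))"
  have ltD: "const (l i) \<otimes> t i \<in> D" for i using subringE(6)[OF D(1)] cD tD by blast
  have fp: "finprod E.DP lin K \<in> carrier E.DP" for K using lin by (intro E.ev.R.finprod_closed) auto
  have tm: "summand i \<in> carrier E.DP" for i
    unfolding summand_def by (intro E.ev.R.m_closed E.cst_closed ltD fp)
  define p where "p = finsum E.DP summand I"
  have p: "p \<in> carrier E.DP" unfolding p_def using tm by (intro E.ev.R.finsum_closed) auto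
  define pr where "pr = (\<lambda>K. finprod A (\<lambda>j. z \<ominus> const j) K)"
  have pr: "pr K \<in> carrier A" for K unfolding pr_def using zc by (intro finprod_closed) auto
  have eval_fp: "E.value_at (finprod E.DP lin K) = pr K" for K
    unfolding pr_def using lin zc
    by (subst E.ev.hom_finprod) (auto simp: comp_def eval_lin)
  have eval_term: "E.value_at (summand i) = const (l i) \<otimes> t i \<otimes> pr (I - {i})" for i
    unfolding summand_def using E.cst_closed[OF ltD] fp
    by (simp add: E.value_cst[OF ltD] eval_fp)
  have "E.value_at p = (\<Oplus>i\<in>I. const (l i) \<otimes> t i \<otimes> pr (I - {i}))"
    unfolding p_def using tm pr tD
    by (subst E.ev.hom_finsum) (auto simp: comp_def eval_term)
  moreover have "(\<Oplus>i\<in>I. const (l i) \<otimes> t i \<otimes> pr (I - {i})) \<in> P"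
  proof -
    let ?f = "\<lambda>i. const (l i) \<otimes> t i \<otimes> pr (I - {i})"
    let ?g = "\<lambda>i. const (l i) \<otimes> b i \<otimes> pr I"
    have g: "?g i = const (l i) \<otimes> (b i \<otimes> (z \<ominus> const i)) \<otimes> pr (I - {i})" if "i \<in> I" for i
    proof -
      have "pr I = pr (insert i (I - {i}))" using that by (simp add: insert_absorb)
      also have "\<dots> = (z \<ominus> const i) \<otimes> pr (I - {i})"
        unfolding pr_def using I(1) zc by (subst finprod_insert) auto
      finally show ?thesis using b pr zc by (simp add: m_assoc)
    qed
    have "?f i \<ominus> ?g i \<in> P" if "i \<in> I" for i
    proof -
      have "const (l i) \<otimes> pr (I - {i}) \<otimes> (t i \<ominus> b i \<otimes> (z \<ominus> const i)) \<in> P"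
        using tb pr by (intro P.I_l_closed) auto
      moreover have "const (l i) \<otimes> pr (I - {i}) \<otimes> (t i \<ominus> b i \<otimes> (z \<ominus> const i)) = ?f i \<ominus> ?g i"
        unfolding g[OF that] using b tD(3) pr zc[of i]
        by (simp add: a_minus_def r_distr r_minus m_ac)
      ultimately show ?thesis by simp
    qed
    then have "(\<Oplus>i\<in>I. ?f i) \<ominus> (\<Oplus>i\<in>I. ?g i) \<in> P"
      using b pr tD(3) by (intro P.finsum_congruent I(1)) auto
    moreover have "(\<Oplus>i\<in>I. ?g i) = (\<Oplus>i\<in>I. const (l i) \<otimes> b i) \<otimes> pr I"
      using b pr I(1) by (subst finsum_ldistr) auto
    ultimately show ?thesis
      using I(3) pr tD(3) by (simp add: a_minus_def finsum_closed)
  qed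
  ultimately have "E.value_at p \<in> P" by simp
  then have p0: "p = \<zero>\<^bsub>E.DP\<^esub>" using E.transcendental_value[OF z(2) p] by simp
  \<comment> \<open>All but one summand of the numerator vanish at \<open>k\<close>.\<close>
  obtain k where k: "k \<in> I" "l k \<noteq> 0" using I(2) by auto
  interpret K: subring_eval A D "const k" by (rule subring_evalI) (use D(1) in auto)
  have K_lin: "K.value_at (lin c) = const (k - c)" for c
    using E.indet_closed E.cst_closed[OF cD]
    by (simp add: lin_def a_minus_def K.value_cst[OF cD] K.value_indet[simplified] const_diff)
  have K_fp: "K.value_at (finprod E.DP lin K) = finprod A (\<lambda>j. const (k - j)) K" for K
    using lin by (subst K.ev.hom_finprod) (auto simp: comp_def K_lin)
  have K_term: "K.value_at (summand i) = const (l i) \<otimes> t i \<otimes> finprod A (\<lambda>j. const (k - j)) (I - {i})" for i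
    unfolding summand_def using E.cst_closed[OF ltD] fp
    by (simp add: K.value_cst[OF ltD] K_fp)
  have prod_const: "finprod A (\<lambda>j. const (k - j)) K = const (\<Prod>j\<in>K. k - j)" if "finite K" for K
    using that by (induction rule: finite_induct) (auto simp: const_mult)
  have K0: "K.value_at (summand i) = \<zero>" if "i \<in> I" "i \<noteq> k" for i
  proof -
    have 0: "(\<Prod>j\<in>I - {i}. k - j) = 0" using that k(1) I(1) by (intro prod_zero) auto
    have "finite (I - {i})" using I(1) by simp
    from prod_const[OF this] show ?thesis unfolding K_term 0 using tD(3) by simp
  qed
  have "\<zero> = K.value_at p" using p0 by simp
  also have "\<dots> = (\<Oplus>i\<in>I. K.value_at (summand i))"
    unfolding p_def using tm by (subst K.ev.hom_finsum) (auto simp: comp_def)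
  also have "\<dots> = (\<Oplus>i\<in>I. if k = i then K.value_at (summand i) else \<zero>)"
    using K0 tm by (intro finsum_cong') (auto intro: K.ev.hom_closed)
  also have "\<dots> = K.value_at (summand k)"
    using k(1) I(1) tm by (intro finsum_singleton) (auto intro: K.ev.hom_closed)
  also have "\<dots> = const (l k) \<otimes> t k \<otimes> const (\<Prod>j\<in>I - {k}. k - j)"
    unfolding K_term using prod_const I(1) by simp
  finally have z0: "const (l k) \<otimes> t k \<otimes> const (\<Prod>j\<in>I - {k}. k - j) = \<zero>" by (rule sym)
  have "(\<Prod>j\<in>I - {k}. k - j) \<noteq> 0" using I(1) by simp
  then show False using z0 tD(2,3)[of k] k(2) integral_iff by simp
qed

text \<open>The rings of a tower need not be generated by the elements adjoined: only the transcendence of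
  each new element over the ring before it counts.\<close>

inductive transcendence_tower :: "nat \<Rightarrow> 'a set \<Rightarrow> bool" where
  base: "subring D A \<Longrightarrow> range const \<subseteq> D \<Longrightarrow> transcendence_tower 0 D"
| step: "transcendence_tower n D \<Longrightarrow> subring D' A \<Longrightarrow> D \<subseteq> D' \<Longrightarrow> z \<in> D' \<Longrightarrow>
    transcendental_mod D {\<zero>} z \<Longrightarrow> transcendence_tower (Suc n) D'"

lemma transcendence_tower_subring:
  "transcendence_tower n D \<Longrightarrow> subring D A \<and> range const \<subseteq> D"
  by (induction rule: transcendence_tower.induct) auto

text \<open>The top element of the tower is transcendental modulo \<open>P\<close> as well, because \<open>P\<close> meets the top
  ring trivially. So \<open>P\<close> can be enlarged to a prime that meets the next ring of the tower trivially.\<close>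

lemma tower_prime_chain:
  assumes "affine_variety A"
  shows "transcendence_tower n D \<Longrightarrow> primeideal P A \<Longrightarrow> D \<inter> P = {\<zero>} \<Longrightarrow>
    \<exists>Q. Q 0 = P \<and> (\<forall>i\<le>n. primeideal (Q i) A) \<and> (\<forall>i<n. Q i \<subset> Q (Suc i))"
proof (induction arbitrary: P rule: transcendence_tower.induct)
  case (base D)
  then show ?case by (intro exI[of _ "\<lambda>_. P"]) auto
next
  case (step n D D' z)
  have D: "subring D A" "range const \<subseteq> D" using transcendence_tower_subring step.hyps by auto
  have z: "z \<in> carrier A" using subringE(1)[OF step.hyps(2)] step.hyps(4) by auto
  have "transcendental_mod D P z"
    unfolding transcendental_mod_def
  proof (intro allI impI)
    fix n c i
    assume c: "\<forall>i\<le>n. c i \<in> D" "(\<Oplus>i\<in>{..n}. c i \<otimes> z [^] i) \<in> P" "i \<le> (n::nat)"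
    have "(\<Oplus>i\<in>{..n}. c i \<otimes> z [^] i) \<in> D'"
      using c(1) step.hyps(3,4) subring_pow[OF step.hyps(2)]
      by (intro subring_finsum[OF step.hyps(2)] funcsetI subringE(6)[OF step.hyps(2)]) auto
    then have "(\<Oplus>i\<in>{..n}. c i \<otimes> z [^] i) \<in> {\<zero>}" using c(2) step.prems(2) by blast
    then show "c i = \<zero>" using step.hyps(5) c(1,3) unfolding transcendental_mod_def by blast
  qed
  moreover have "D \<inter> P = {\<zero>}" using step.prems(2) step.hyps(3) subringE(2)[OF D(1)] by auto
  ultimately obtain P' where P': "primeideal P' A" "P \<subset> P'" "D \<inter> P' = {\<zero>}"
    using larger_prime_avoiding[OF assms step.prems(1) D _ z] by blast
  obtain Q where Q: "Q 0 = P'" "\<forall>i\<le>n. primeideal (Q i) A" "\<forall>i<n. Q i \<subset> Q (Suc i)"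
    using step.IH[OF P'(1,3)] by auto
  show ?case
    using Q P' step.prems(1)
    by (intro exI[of _ "case_nat P Q"]) (auto split: nat.splits simp: le_Suc_eq less_Suc_eq_0_disj Nat.less_Suc_eq_le)
qed

text \<open>Hence the transcendence degree of a finitely generated domain is at most its dimension.\<close>

lemma tower_le_krull_dim:
  assumes "affine_variety A" "transcendence_tower n D"
  shows "enat n \<le> krull_dim A"
proof -
  have "\<zero> \<in> D" using transcendence_tower_subring[OF assms(2)] subringE(2) by auto
  then have "D \<inter> {\<zero>} = {\<zero>}" by auto
  then obtain Q where "\<forall>i\<le>n. primeideal (Q i) A" "\<forall>i<n. Q i \<subset> Q (Suc i)"
    using tower_prime_chain[OF assms zeroprimeideal] by blast
  then show ?thesis unfolding krull_dim_def by (intro Sup_upper) auto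
qed

subsection \<open>The dimension of the ring of invariants\<close>

lemma ker_ring_domain: "domain (A\<lparr>carrier := ker\<rparr>)"
  using subring_is_domain[OF ker_subring] .

text \<open>The point is that \<open>D\<close> meets \<open>Q'\<close> trivially: the lowest coefficient of an equation modulo \<open>Q\<close> lies in \<open>Q'\<close>, so it is
  zero, and then \<open>x\<close> can be cancelled modulo the prime \<open>Q\<close>.\<close>

lemma prime_step_transcendental:
  assumes Q: "primeideal Q (A\<lparr>carrier := ker\<rparr>)" and Q': "ideal Q' (A\<lparr>carrier := ker\<rparr>)"
    and "Q \<subseteq> Q'" and x: "x \<in> Q'" "x \<notin> Q" and D: "D \<subseteq> ker" "D \<inter> Q' \<subseteq> {\<zero>}"
  shows "transcendental_mod D Q x"
proof -
  interpret Q: primeideal Q "A\<lparr>carrier := ker\<rparr>" by fact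
  interpret Q': ideal Q' "A\<lparr>carrier := ker\<rparr>" by fact
  have xk: "x \<in> ker" using Q'.Icarr x(1) by simp
  have "c i = \<zero>" if "\<forall>i\<le>n. c i \<in> D" "(\<Oplus>i\<in>{..n}. c i \<otimes> x [^] i) \<in> Q" "i \<le> n" for n i and c :: "nat \<Rightarrow> 'a"
    using that
  proof (induction n arbitrary: c i)
    case 0
    have "c 0 \<in> carrier A" using 0 D(1) ker_carrier by auto
    then have "c 0 \<in> Q" using 0(2) by (simp del: atMost_0)
    then show ?case using 0 D(2) \<open>Q \<subseteq> Q'\<close> by auto
  next
    case (Suc n)
    have ck: "c i \<in> ker" if "i \<le> Suc n" for i using that Suc.prems(1) D(1) by auto
    note cl = ck[THEN ker_carrier] and xc = ker_carrier[OF xk]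
    define r where "r = (\<Oplus>i\<in>{..n}. c (Suc i) \<otimes> x [^] i)"
    have r: "r \<in> ker"
      unfolding r_def using ck xk by (intro subring_finsum[OF ker_subring] funcsetI mult_ker pow_ker) auto
    have eq: "(\<Oplus>i\<in>{..Suc n}. c i \<otimes> x [^] i) = r \<otimes> x \<oplus> c 0"
    proof -
      have "(\<Oplus>i\<in>{..Suc n}. c i \<otimes> x [^] i) = (\<Oplus>i\<in>{..n}. c (Suc i) \<otimes> x [^] Suc i) \<oplus> c 0 \<otimes> x [^] (0::nat)"
        using cl xc by (subst finsum_Suc2) (auto simp del: nat_pow_Suc)
      also have "(\<Oplus>i\<in>{..n}. c (Suc i) \<otimes> x [^] Suc i) = r \<otimes> x"
        unfolding r_def using cl xc by (subst finsum_ldistr) (auto simp: m_assoc intro!: finsum_cong')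
      finally show ?thesis using cl[of 0] by simp
    qed
    have "r \<otimes> x \<in> Q'" using Q'.I_l_closed[OF x(1), of r] r by simp
    moreover have "r \<otimes> x \<oplus> c 0 \<in> Q'" using Suc.prems(2) eq \<open>Q \<subseteq> Q'\<close> by auto
    ultimately have "c 0 \<in> Q'"
    proof -
      assume a: "r \<otimes> x \<in> Q'" "r \<otimes> x \<oplus> c 0 \<in> Q'"
      have "const (- 1) \<otimes> (r \<otimes> x) \<in> Q'" using Q'.I_l_closed[OF a(1), of "const (- 1)"] by simp
      then have "const (- 1) \<otimes> (r \<otimes> x) \<oplus> (r \<otimes> x \<oplus> c 0) \<in> Q'"
        using additive_subgroup.a_closed[OF Q'.additive_subgroup_axioms _ a(2)] by simp
      moreover have "const (- 1) \<otimes> (r \<otimes> x) \<oplus> (r \<otimes> x \<oplus> c 0) = c 0"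
        using cl[of 0] ker_carrier[OF r] xc const_uminus[of 1]
        by (simp add: l_minus a_assoc[symmetric] l_neg)
      ultimately show ?thesis by simp
    qed
    then have c0: "c 0 = \<zero>" using Suc.prems(1) D(2) by auto
    then have "r \<otimes> x \<in> Q" using Suc.prems(2) eq ker_carrier[OF r] xc by simp
    then have "r \<in> Q" using Q.I_prime[of r x] r xk x(2) by auto
    then have rQ: "(\<Oplus>i\<in>{..n}. c (Suc i) \<otimes> x [^] i) \<in> Q" unfolding r_def .
    have cD: "\<forall>i\<le>n. c (Suc i) \<in> D" using Suc.prems(1) by simp
    show ?case
    proof (cases i)
      case 0
      then show ?thesis using c0 by simp
    next
      case (Suc j)
      then have "j \<le> n" using Suc.prems(3) by simp
      then show ?thesis using Suc.IH[OF cD rQ] Suc by simp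
    qed
  qed
  then show ?thesis unfolding transcendental_mod_def by blast
qed

text \<open>The tower is built from the top of the chain downwards: it starts with the constants, which meet
  a prime only in \<open>0\<close>, and each step adjoins an element of \<open>Q (i + 1) - Q i\<close>.\<close>

lemma prime_chain_tower:
  assumes "\<forall>i\<le>n. primeideal (Q i) (A\<lparr>carrier := ker\<rparr>)" "\<forall>i<n. Q i \<subset> Q (Suc i)"
  shows "\<exists>D. transcendence_tower n D \<and> D \<subseteq> ker \<and> D \<inter> Q 0 \<subseteq> {\<zero>}"
  using assms
proof (induction n arbitrary: Q)
  case 0
  interpret Q: primeideal "Q 0" "A\<lparr>carrier := ker\<rparr>" using 0 by simp
  have "c = 0" if "const c \<in> Q 0" for c
  proof (rule ccontr)
    assume "c \<noteq> 0"
    have "const (inverse c) \<otimes> const c \<in> Q 0" using Q.I_l_closed[OF that, of "const (inverse c)"] by simp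
    then have "\<one> \<in> Q 0" using const_inverse[OF \<open>c \<noteq> 0\<close>] by (simp add: m_comm)
    then show False using Q.one_imp_carrier Q.I_notcarr by simp
  qed
  moreover have "subring (range const) A"
  proof (rule subringI)
    show "\<one> \<in> range const" using const_one by (metis rangeI)
  next
    fix x y assume "x \<in> range const" "y \<in> range const"
    then obtain c d where "x = const c" "y = const d" by blast
    then show "x \<otimes> y \<in> range const" "x \<oplus> y \<in> range const" "\<ominus> x \<in> range const"
      using const_mult[of c d] const_add[of c d] const_uminus[of c] by (metis rangeI)+
  qed auto
  ultimately show ?case
    by (intro exI[of _ "range const"]) (auto intro: transcendence_tower.base)
next
  case (Suc n)
  obtain D where D: "transcendence_tower n D" "D \<subseteq> ker" "D \<inter> Q 1 \<subseteq> {\<zero>}"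
    using Suc.IH[of "\<lambda>i. Q (Suc i)"] Suc.prems by auto
  obtain x where x: "x \<in> Q 1" "x \<notin> Q 0" using Suc.prems(2) by auto
  have Q: "primeideal (Q 0) (A\<lparr>carrier := ker\<rparr>)" "primeideal (Q 1) (A\<lparr>carrier := ker\<rparr>)"
    using Suc.prems(1) by auto
  then interpret Q1: primeideal "Q 1" "A\<lparr>carrier := ker\<rparr>" by simp
  interpret Q0: primeideal "Q 0" "A\<lparr>carrier := ker\<rparr>" using Q by simp
  have xk: "x \<in> ker" using x(1) Q1.Icarr by simp
  have sub: "subring D A" using transcendence_tower_subring[OF D(1)] by simp
  interpret E: subring_eval A D x by (rule subring_evalI) (use sub xk ker_carrier in auto)
  have tr: "transcendental_mod D (Q 0) x"
    using prime_step_transcendental[OF Q(1) Q1.is_ideal _ x D(2,3)] Suc.prems(2) by auto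
  have z0: "\<zero> \<in> Q 0" using additive_subgroup.zero_closed[OF Q0.additive_subgroup_axioms] by simp
  then have tr0: "transcendental_mod D {\<zero>} x"
    using tr unfolding transcendental_mod_def by auto
  define D' where "D' = E.value_at ` carrier E.DP"
  have "D' \<subseteq> ker"
  proof
    fix y assume "y \<in> D'"
    then obtain p where p: "p \<in> carrier E.DP" "y = E.value_at p" by (auto simp: D'_def)
    have cl: "up_ring.coeff E.DP p i \<in> ker" for i using E.coeff_closed[OF p(1)] D(2) by auto
    have "(\<Oplus>i\<in>{..m}. up_ring.coeff E.DP p i \<otimes> x [^] i) \<in> ker" for m
      by (intro subring_finsum[OF ker_subring] funcsetI mult_ker pow_ker cl xk)
    then show "y \<in> ker" using p E.value_eq by simp
  qed
  moreover have "D' \<inter> Q 0 \<subseteq> {\<zero>}"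
  proof
    fix y assume y: "y \<in> D' \<inter> Q 0"
    then obtain p where p: "p \<in> carrier E.DP" "y = E.value_at p" by (auto simp: D'_def)
    then have "p = \<zero>\<^bsub>E.DP\<^esub>" using E.transcendental_value[OF tr p(1)] y by simp
    then show "y \<in> {\<zero>}" using p(2) by simp
  qed
  moreover have "transcendence_tower (Suc n) D'"
    using transcendence_tower.step[OF D(1) E.value_image[folded D'_def] tr0] .
  ultimately show ?case by (intro exI[of _ D'] conjI)
qed

text \<open>A chain of primes of the invariants gives a tower of the same length inside the kernel, and
  a local slice is transcendental over the kernel; so the invariants have smaller dimension.\<close>

lemma invariant_dimension:
  assumes "affine_variety A" "s \<in> carrier A" "\<delta> s \<in> ker" "\<delta> s \<noteq> \<zero>"
    and "\<forall>i\<le>n. primeideal (Q i) (A\<lparr>carrier := ker\<rparr>)" "\<forall>i<n. Q i \<subset> Q (Suc i)"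
  shows "enat (Suc n) \<le> krull_dim A"
proof -
  obtain D where D: "transcendence_tower n D" "D \<subseteq> ker"
    using prime_chain_tower[OF assms(5,6)] by auto
  have "transcendental_mod D {\<zero>} s"
    unfolding transcendental_mod_def
  proof (intro allI impI)
    fix m c i
    assume c: "\<forall>i\<le>m. c i \<in> D" "(\<Oplus>i\<in>{..m}. c i \<otimes> s [^] i) \<in> {\<zero>}" "i \<le> (m::nat)"
    then have ck: "c i \<in> ker" if "i \<le> m" for i using that D(2) by blast
    show "c i = \<zero>"
      by (rule local_slice_transcendental[OF assms(2-4) ck _ c(3)]) (use c(2) in simp_all)
  qed
  moreover have "D \<subseteq> carrier A" using D(2) ker_carrier by blast
  ultimately have "transcendence_tower (Suc n) (carrier A)"
    by (intro transcendence_tower.step[OF D(1) carrier_is_subring _ assms(2)])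
  then show ?thesis by (rule tower_le_krull_dim[OF assms(1)])
qed

end

section \<open>Finite sets of local generators\<close>

text \<open>All linear algebra over the localization of a subring \<open>K\<close> at \<open>S\<close> is carried out with
  denominators cleared: a statement holds locally if it holds after multiplication by some
  \<open>s \<in> S\<close>.\<close>

locale clearing_denominators = domain A for A (structure) +
  fixes K S
  assumes K_subring: "subring K A"
    and S_K: "S \<subseteq> K" and S_one [simp]: "\<one> \<in> S" and S_nonzero: "\<zero> \<notin> S"
    and S_mult [simp]: "s \<in> S \<Longrightarrow> t \<in> S \<Longrightarrow> s \<otimes> t \<in> S"
begin

lemma K_A: "x \<in> K \<Longrightarrow> x \<in> carrier A"
  using subringE(1)[OF K_subring] by auto

lemma S_A: "x \<in> S \<Longrightarrow> x \<in> carrier A"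
  using S_K K_A by auto

lemma K_zero [simp]: "\<zero> \<in> K"
  and K_one [simp]: "\<one> \<in> K"
  and K_add [simp]: "x \<in> K \<Longrightarrow> y \<in> K \<Longrightarrow> x \<oplus> y \<in> K"
  and K_mult [simp]: "x \<in> K \<Longrightarrow> y \<in> K \<Longrightarrow> x \<otimes> y \<in> K"
  and K_uminus [simp]: "x \<in> K \<Longrightarrow> \<ominus> x \<in> K"
  using subringE[OF K_subring] by auto

lemma K_diff [simp]: "x \<in> K \<Longrightarrow> y \<in> K \<Longrightarrow> x \<ominus> y \<in> K"
  by (simp add: a_minus_def)

definition K_span :: "'a set \<Rightarrow> 'a set" where
  "K_span T = {\<Oplus>t\<in>T. c t \<otimes> t | c. \<forall>t\<in>T. c t \<in> K}"

definition locally_generates :: "'a set \<Rightarrow> 'a set \<Rightarrow> bool" where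
  "locally_generates T N \<longleftrightarrow> finite T \<and> T \<subseteq> N \<and> (\<forall>x\<in>N. \<exists>s\<in>S. s \<otimes> x \<in> K_span T)"

lemma locally_generatesD: "locally_generates T N \<Longrightarrow> x \<in> N \<Longrightarrow> \<exists>s\<in>S. s \<otimes> x \<in> K_span T"
  by (simp add: locally_generates_def)

lemma K_spanI: "(\<And>t. t \<in> T \<Longrightarrow> c t \<in> K) \<Longrightarrow> (\<Oplus>t\<in>T. c t \<otimes> t) \<in> K_span T"
  unfolding K_span_def by blast

lemma K_spanE:
  assumes "x \<in> K_span T"
  obtains c where "\<And>t. t \<in> T \<Longrightarrow> c t \<in> K" "x = (\<Oplus>t\<in>T. c t \<otimes> t)"
  using assms unfolding K_span_def by blast

context
  fixes T assumes T: "T \<subseteq> carrier A"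
begin

lemma term_carrier: "\<forall>t\<in>T. c t \<in> K \<Longrightarrow> (\<lambda>t. c t \<otimes> t) \<in> T \<rightarrow> carrier A"
  using T K_A by auto

lemma K_span_sum_carrier: "(\<And>t. t \<in> T \<Longrightarrow> c t \<in> K) \<Longrightarrow> (\<Oplus>t\<in>T. c t \<otimes> t) \<in> carrier A"
  by (intro finsum_closed term_carrier) auto

lemma K_span_sum_add:
  assumes "\<And>t. t \<in> T \<Longrightarrow> c t \<in> K" "\<And>t. t \<in> T \<Longrightarrow> d t \<in> K"
  shows "(\<Oplus>t\<in>T. c t \<otimes> t) \<oplus> (\<Oplus>t\<in>T. d t \<otimes> t) = (\<Oplus>t\<in>T. (c t \<oplus> d t) \<otimes> t)"
proof -
  have "(\<Oplus>t\<in>T. c t \<otimes> t) \<oplus> (\<Oplus>t\<in>T. d t \<otimes> t) = (\<Oplus>t\<in>T. c t \<otimes> t \<oplus> d t \<otimes> t)"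
    by (rule finsum_addf[symmetric]) (use assms term_carrier in auto)
  also have "\<dots> = (\<Oplus>t\<in>T. (c t \<oplus> d t) \<otimes> t)"
    using assms T K_A by (intro finsum_cong') (auto simp: l_distr subset_iff)
  finally show ?thesis .
qed

lemma K_span_sum_scale:
  assumes "finite T" "k \<in> K" "\<And>t. t \<in> T \<Longrightarrow> c t \<in> K"
  shows "k \<otimes> (\<Oplus>t\<in>T. c t \<otimes> t) = (\<Oplus>t\<in>T. (k \<otimes> c t) \<otimes> t)"
proof -
  have "k \<otimes> (\<Oplus>t\<in>T. c t \<otimes> t) = (\<Oplus>t\<in>T. k \<otimes> (c t \<otimes> t))"
    using assms term_carrier K_A by (intro finsum_rdistr) auto
  also have "\<dots> = (\<Oplus>t\<in>T. (k \<otimes> c t) \<otimes> t)"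
    using assms T K_A by (intro finsum_cong') (auto simp: m_assoc subset_iff)
  finally show ?thesis .
qed

lemma K_span_sum_uminus:
  assumes "finite T" "\<And>t. t \<in> T \<Longrightarrow> c t \<in> K"
  shows "\<ominus> (\<Oplus>t\<in>T. c t \<otimes> t) = (\<Oplus>t\<in>T. (\<ominus> c t) \<otimes> t)"
proof -
  have "(\<ominus> \<one>) \<otimes> (\<Oplus>t\<in>T. c t \<otimes> t) = (\<Oplus>t\<in>T. (\<ominus> \<one> \<otimes> c t) \<otimes> t)"
    using assms by (intro K_span_sum_scale) auto
  also have "\<dots> = (\<Oplus>t\<in>T. (\<ominus> c t) \<otimes> t)"
    using assms T K_A by (intro finsum_cong') (auto simp: l_minus subset_iff)
  finally show ?thesis using K_span_sum_carrier[of c] assms by (simp add: l_minus)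
qed

lemma K_span_add: "x \<in> K_span T \<Longrightarrow> y \<in> K_span T \<Longrightarrow> x \<oplus> y \<in> K_span T"
  by (elim K_spanE) (auto simp: K_span_sum_add intro!: K_spanI)

lemma K_span_scale: "finite T \<Longrightarrow> k \<in> K \<Longrightarrow> x \<in> K_span T \<Longrightarrow> k \<otimes> x \<in> K_span T"
  by (elim K_spanE) (auto simp: K_span_sum_scale intro!: K_spanI)

lemma K_span_zero: "\<zero> \<in> K_span T"
proof -
  have "(\<Oplus>t\<in>T. \<zero> \<otimes> t) = (\<Oplus>t\<in>T. \<zero>)" using T by (intro finsum_cong') auto
  then show ?thesis using K_spanI[of T "\<lambda>_. \<zero>"] by simp
qed

lemma K_span_single:
  assumes "finite T" "u \<in> T" "k \<in> K"
  shows "(\<Oplus>t\<in>T. (if t = u then k else \<zero>) \<otimes> t) = k \<otimes> u"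
proof -
  have "(\<Oplus>t\<in>T. (if t = u then k else \<zero>) \<otimes> t) = (\<Oplus>t\<in>T. if u = t then k \<otimes> t else \<zero>)"
    using assms T K_A by (intro finsum_cong') auto
  also have "\<dots> = k \<otimes> u"
    using assms T K_A by (intro finsum_singleton) auto
  finally show ?thesis .
qed

lemma K_span_base: "finite T \<Longrightarrow> u \<in> T \<Longrightarrow> u \<in> K_span T"
  using K_span_single[of u \<one>] K_spanI[of T "\<lambda>t. if t = u then \<one> else \<zero>"] T by auto

end

text \<open>Finitely many local statements, each stable under enlarging the denominator, hold with the
  product of their denominators.\<close>

lemma common_denominator:
  assumes "finite T" "\<And>t. t \<in> T \<Longrightarrow> \<exists>s\<in>S. P s t"
    and "\<And>s s' t. t \<in> T \<Longrightarrow> P s t \<Longrightarrow> s \<in> S \<Longrightarrow> s' \<in> S \<Longrightarrow> P (s' \<otimes> s) t"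
  shows "\<exists>s\<in>S. \<forall>t\<in>T. P s t"
  using assms
proof (induction rule: finite_induct)
  case (insert t T)
  then obtain s where s: "s \<in> S" "\<forall>t\<in>T. P s t" by auto
  obtain s' where s': "s' \<in> S" "P s' t" using insert.prems(1) by auto
  have "P (s' \<otimes> s) r" if "r \<in> T" for r using insert.prems(2) s s' that by auto
  moreover have "P (s' \<otimes> s) t" using insert.prems(2)[of t s' s] s s' S_A by (simp add: m_comm)
  ultimately show ?case using s s' by (intro bexI[of _ "s' \<otimes> s"]) auto
qed (use S_one in blast)

text \<open>In a local generating set of least size, a generator with a locally invertible coefficient in
  some relation could be discarded.\<close>

lemma minimal_local_generators:
  assumes "locally_generates T0 N" "N \<subseteq> carrier A"
  shows "\<exists>T. locally_generates T N \<and>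
    (\<forall>c. (\<forall>t\<in>T. c t \<in> K) \<longrightarrow> (\<Oplus>t\<in>T. c t \<otimes> t) = \<zero> \<longrightarrow> (\<forall>t\<in>T. c t \<notin> S))"
proof -
  define T where "T = (ARG_MIN card T. locally_generates T N)"
  have T: "locally_generates T N" and min: "\<And>U. locally_generates U N \<Longrightarrow> card T \<le> card U"
    using arg_min_natI[of "\<lambda>T. locally_generates T N" T0 card]
      arg_min_nat_le[of "\<lambda>T. locally_generates T N" _ card] assms(1) by (simp_all add: T_def)
  have fin: "finite T" "T \<subseteq> N" "T \<subseteq> carrier A" using T assms(2) by (auto simp: locally_generates_def)
  have "c u \<notin> S" if c: "\<And>t. t \<in> T \<Longrightarrow> c t \<in> K" "(\<Oplus>t\<in>T. c t \<otimes> t) = \<zero>" "u \<in> T" for c u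
  proof
    assume u: "c u \<in> S"
    define U where "U = T - {u}"
    have U: "finite U" "U \<subseteq> N" "T = insert u U" "u \<notin> U" using fin c(3) by (auto simp: U_def)
    have "\<exists>s\<in>S. s \<otimes> x \<in> K_span U" if "x \<in> N" for x
    proof -
      obtain s where s: "s \<in> S" "s \<otimes> x \<in> K_span T" using locally_generatesD[OF T \<open>x \<in> N\<close>] by blast
      obtain d where d: "\<And>t. t \<in> T \<Longrightarrow> d t \<in> K" "s \<otimes> x = (\<Oplus>t\<in>T. d t \<otimes> t)"
        using s(2) by (rule K_spanE) blast
      have cl: "x \<in> carrier A" "s \<in> carrier A" "c u \<in> carrier A" using that assms(2) s(1) u S_A by auto
      let ?e = "\<lambda>t. c u \<otimes> d t \<oplus> (\<ominus> d u) \<otimes> c t"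
      have e: "?e t \<in> K" if "t \<in> T" for t using that c d by simp
      have "c u \<otimes> s \<otimes> x = c u \<otimes> (\<Oplus>t\<in>T. d t \<otimes> t) \<oplus> (\<ominus> d u) \<otimes> (\<Oplus>t\<in>T. c t \<otimes> t)"
        using cl d c(2,3) K_A by (simp add: m_assoc d(2)[symmetric])
      also have "\<dots> = (\<Oplus>t\<in>T. (c u \<otimes> d t) \<otimes> t) \<oplus> (\<Oplus>t\<in>T. (\<ominus> d u \<otimes> c t) \<otimes> t)"
        using c d fin by (intro arg_cong2[where f="(\<oplus>)"] K_span_sum_scale) auto
      also have "\<dots> = (\<Oplus>t\<in>T. ?e t \<otimes> t)"
        using c d fin by (intro K_span_sum_add) auto
      also have "\<dots> = ?e u \<otimes> u \<oplus> (\<Oplus>t\<in>U. ?e t \<otimes> t)"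
        unfolding U(3) using U(1,4) e K_A fin(3) U(3) by (intro finsum_insert) auto
      also have "?e u = \<zero>" using K_A[OF c(1)[OF c(3)]] K_A[OF d(1)[OF c(3)]]
        by (simp add: l_minus m_comm[of "d u" "c u"] r_neg)
      finally have "c u \<otimes> s \<otimes> x = (\<Oplus>t\<in>U. ?e t \<otimes> t)"
        using c(3) fin(3) K_span_sum_carrier[of U ?e] e U(3) by auto
      moreover have "(\<Oplus>t\<in>U. ?e t \<otimes> t) \<in> K_span U" using e U(3) by (intro K_spanI) auto
      ultimately show ?thesis using s(1) u by (intro bexI[of _ "c u \<otimes> s"]) auto
    qed
    then have "locally_generates U N" using U by (simp add: locally_generates_def)
    then show False using min[of U] U fin by simp
  qed
  then show ?thesis using T by blast
qed

text \<open>Nakayama's lemma for the ideal \<open>(x, y)\<close>. If \<open>u\<close> is a member of a minimal local generating set, then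
  writing a multiple of \<open>u\<close> as \<open>x a' + y a''\<close> and expanding \<open>a'\<close> and \<open>a''\<close> gives a relation in which \<open>u\<close> has a
  coefficient of the form \<open>s - (x c + y d)\<close>. This is a local unit, against minimality.\<close>

lemma local_Nakayama:
  assumes gen: "locally_generates T0 N" and N: "N \<subseteq> carrier A"
    and x: "x \<in> K" "y \<in> K"
    and rad: "\<And>s c d. s \<in> S \<Longrightarrow> c \<in> K \<Longrightarrow> d \<in> K \<Longrightarrow> s \<ominus> (x \<otimes> c \<oplus> y \<otimes> d) \<in> S"
    and NN: "\<And>a. a \<in> N \<Longrightarrow> \<exists>s\<in>S. \<exists>a'\<in>N. \<exists>a''\<in>N. s \<otimes> a = x \<otimes> a' \<oplus> y \<otimes> a''"
  shows "N \<subseteq> {\<zero>}"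
proof -
  obtain T where T: "locally_generates T N"
    and min: "\<forall>c. (\<forall>t\<in>T. c t \<in> K) \<longrightarrow> (\<Oplus>t\<in>T. c t \<otimes> t) = \<zero> \<longrightarrow> (\<forall>t\<in>T. c t \<notin> S)"
    using minimal_local_generators[OF gen N] by blast
  have fin: "finite T" "T \<subseteq> N" "T \<subseteq> carrier A" using T N by (auto simp: locally_generates_def)
  have "T = {}"
  proof (rule ccontr)
    assume "T \<noteq> {}"
    then obtain u where u: "u \<in> T" by auto
    then obtain s a b where s: "s \<in> S" "a \<in> N" "b \<in> N" "s \<otimes> u = x \<otimes> a \<oplus> y \<otimes> b"
      using NN fin(2) by blast
    obtain p where p: "p \<in> S" "p \<otimes> a \<in> K_span T" using locally_generatesD[OF T s(2)] by blast
    obtain q where q: "q \<in> S" "q \<otimes> b \<in> K_span T" using locally_generatesD[OF T s(3)] by blast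
    obtain c where c: "\<And>t. t \<in> T \<Longrightarrow> c t \<in> K" "p \<otimes> a = (\<Oplus>t\<in>T. c t \<otimes> t)" using p(2) by (rule K_spanE) blast
    obtain d where d: "\<And>t. t \<in> T \<Longrightarrow> d t \<in> K" "q \<otimes> b = (\<Oplus>t\<in>T. d t \<otimes> t)" using q(2) by (rule K_spanE) blast
    have cl: "x \<in> carrier A" "y \<in> carrier A" "a \<in> carrier A" "b \<in> carrier A" "s \<in> carrier A"
      "p \<in> carrier A" "q \<in> carrier A" "u \<in> carrier A" "p \<in> K" "q \<in> K"
      using x s p q u N fin(3) K_A S_A S_K by auto
    let ?z = "p \<otimes> q \<otimes> s"
    define e where "e = (\<lambda>t. (x \<otimes> q) \<otimes> c t \<oplus> (y \<otimes> p) \<otimes> d t)"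
    have e: "e t \<in> K" if "t \<in> T" for t using that c d cl x by (simp add: e_def)
    have "?z \<otimes> u = (p \<otimes> q) \<otimes> (x \<otimes> a \<oplus> y \<otimes> b)" using cl by (simp add: m_assoc s(4))
    also have "\<dots> = (x \<otimes> q) \<otimes> (p \<otimes> a) \<oplus> (y \<otimes> p) \<otimes> (q \<otimes> b)" using cl by (simp add: r_distr m_ac)
    also have "\<dots> = (\<Oplus>t\<in>T. ((x \<otimes> q) \<otimes> c t) \<otimes> t) \<oplus> (\<Oplus>t\<in>T. ((y \<otimes> p) \<otimes> d t) \<otimes> t)"
      unfolding c(2) d(2) using c d fin x cl
      by (intro arg_cong2[where f="(\<oplus>)"] K_span_sum_scale) auto
    also have "\<dots> = (\<Oplus>t\<in>T. e t \<otimes> t)"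
      unfolding e_def using c d fin x cl by (intro K_span_sum_add) auto
    finally have eq: "?z \<otimes> u = (\<Oplus>t\<in>T. e t \<otimes> t)" .
    define r where "r = (\<lambda>t. (if t = u then ?z else \<zero>) \<oplus> \<ominus> e t)"
    have zK: "?z \<in> K" using cl s(1) S_K by auto
    have r: "r t \<in> K" if "t \<in> T" for t using that e zK by (simp add: r_def)
    have "(\<Oplus>t\<in>T. r t \<otimes> t) = (\<Oplus>t\<in>T. (if t = u then ?z else \<zero>) \<otimes> t) \<oplus> (\<Oplus>t\<in>T. (\<ominus> e t) \<otimes> t)"
      unfolding r_def using e zK fin by (intro K_span_sum_add[symmetric]) auto
    also have "\<dots> = ?z \<otimes> u \<oplus> \<ominus> (\<Oplus>t\<in>T. e t \<otimes> t)"
      using K_span_single[OF fin(3,1) u zK] K_span_sum_uminus[OF fin(3,1) e] by simp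
    also have "\<dots> = \<zero>" unfolding eq using K_span_sum_carrier[OF fin(3) e] by (simp add: r_neg)
    finally have "r u \<notin> S" using min r u by blast
    moreover have "r u = ?z \<ominus> (x \<otimes> (q \<otimes> c u) \<oplus> y \<otimes> (p \<otimes> d u))"
      using c(1)[OF u] d(1)[OF u] K_A cl by (simp add: r_def e_def a_minus_def m_assoc)
    moreover have "?z \<ominus> (x \<otimes> (q \<otimes> c u) \<oplus> y \<otimes> (p \<otimes> d u)) \<in> S"
      using c(1)[OF u] d(1)[OF u] p q s cl by (intro rad) auto
    ultimately show False by simp
  qed
  show ?thesis
  proof
    fix a assume a: "a \<in> N"
    then obtain s where "s \<in> S" "s \<otimes> a \<in> K_span {}"
      using T \<open>T = {}\<close> by (auto simp: locally_generates_def)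
    then have "s \<otimes> a = \<zero>" "s \<noteq> \<zero>" by (auto elim!: K_spanE simp: S_nonzero)
    then show "a \<in> {\<zero>}" using a N \<open>s \<in> S\<close> S_A integral_iff by auto
  qed
qed

lemma K_idealI:
  assumes "N \<subseteq> K" "\<zero> \<in> N" "\<And>a b. a \<in> N \<Longrightarrow> b \<in> N \<Longrightarrow> a \<oplus> b \<in> N"
    and scale: "\<And>k a. k \<in> K \<Longrightarrow> a \<in> N \<Longrightarrow> k \<otimes> a \<in> N"
  shows "ideal N (A\<lparr>carrier := K\<rparr>)"
proof (rule idealI)
  let ?Kr = "A\<lparr>carrier := K\<rparr>"
  interpret Kr: ring ?Kr by (rule subring_is_ring[OF K_subring])
  show "ring ?Kr" by (rule Kr.ring_axioms)
  show "subgroup N (add_monoid ?Kr)"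
  proof (rule group.subgroupI)
    show "group (add_monoid ?Kr)" by (rule Kr.a_group)
    show "N \<subseteq> carrier (add_monoid ?Kr)" "N \<noteq> {}" using assms by auto
    fix a assume a: "a \<in> N"
    then have aA: "a \<in> K" "a \<in> carrier A" using assms(1) K_A by auto
    have "\<ominus>\<^bsub>?Kr\<^esub> a = \<ominus> a"
      by (rule Kr.minus_equality) (use aA in \<open>auto simp: l_neg\<close>)
    moreover have "\<ominus> a = (\<ominus> \<one>) \<otimes> a" using aA by (simp add: l_minus)
    moreover have "(\<ominus> \<one>) \<otimes> a \<in> N" using a by (intro scale) auto
    ultimately show "inv\<^bsub>add_monoid ?Kr\<^esub> a \<in> N" by (simp add: a_inv_def)
  next
    fix a b assume "a \<in> N" "b \<in> N"
    then show "a \<otimes>\<^bsub>add_monoid ?Kr\<^esub> b \<in> N" using assms(3) by simp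
  qed
  fix a k assume ak: "a \<in> N" "k \<in> carrier ?Kr"
  then show ka: "k \<otimes>\<^bsub>?Kr\<^esub> a \<in> N" using scale by simp
  have "a \<otimes> k = k \<otimes> a" using ak assms(1) K_A by (intro m_comm) auto
  then show "a \<otimes>\<^bsub>?Kr\<^esub> k \<in> N" using ka by simp
qed

lemma noetherian_generates:
  assumes noeth: "noetherian_ring (A\<lparr>carrier := K\<rparr>)" and J: "ideal J (A\<lparr>carrier := K\<rparr>)"
  shows "\<exists>G\<subseteq>K. finite G \<and> G \<subseteq> J \<and> J \<subseteq> K_span G"
proof -
  let ?Kr = "A\<lparr>carrier := K\<rparr>"
  interpret Kr: noetherian_ring ?Kr by fact
  obtain G where G: "G \<subseteq> K" "finite G" "J = Idl\<^bsub>?Kr\<^esub> G"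
    using Kr.finetely_gen[OF J] by auto
  have GA: "G \<subseteq> carrier A" using G(1) K_A by auto
  have cK: "K_span G \<subseteq> K"
  proof
    fix z assume "z \<in> K_span G"
    then obtain c where c: "\<And>t. t \<in> G \<Longrightarrow> c t \<in> K" "z = (\<Oplus>t\<in>G. c t \<otimes> t)" by (rule K_spanE) blast
    show "z \<in> K" unfolding c(2)
      using c(1) G(1) by (intro subring_finsum[OF K_subring] funcsetI K_mult) auto
  qed
  have "ideal (K_span G) ?Kr"
    using cK K_span_zero[OF GA] K_span_add[OF GA] K_span_scale[OF GA G(2)] by (rule K_idealI)
  moreover have "G \<subseteq> K_span G" using K_span_base[OF GA G(2)] by auto
  ultimately have "J \<subseteq> K_span G" unfolding G(3) by (rule Kr.genideal_minimal)
  moreover have "G \<subseteq> J" unfolding G(3) using Kr.genideal_self G(1) by simp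
  ultimately show ?thesis using G by blast
qed

definition independent_over :: "'a set \<Rightarrow> bool" where
  "independent_over T \<longleftrightarrow>
    (\<forall>c. (\<forall>t\<in>T. c t \<in> K) \<longrightarrow> (\<Oplus>t\<in>T. c t \<otimes> t) = \<zero> \<longrightarrow> (\<forall>t\<in>T. c t = \<zero>))"

lemma independent_subset:
  assumes "independent_over T" "finite T" "U \<subseteq> T" "T \<subseteq> carrier A"
  shows "independent_over U"
  unfolding independent_over_def
proof (intro allI impI ballI)
  fix c t assume c: "\<forall>t\<in>U. c t \<in> K" "(\<Oplus>t\<in>U. c t \<otimes> t) = \<zero>" and t: "t \<in> U"
  let ?d = "\<lambda>t. if t \<in> U then c t else \<zero>"
  have "(\<Oplus>t\<in>T. ?d t \<otimes> t) = (\<Oplus>t\<in>U. c t \<otimes> t)"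
    using assms c(1) K_A by (intro add.finprod_mono_neutral_cong_right) (auto simp: subset_iff)
  then have "(\<Oplus>t\<in>T. ?d t \<otimes> t) = \<zero>" using c(2) by simp
  moreover have "\<forall>t\<in>T. ?d t \<in> K" using c(1) by simp
  ultimately have "\<forall>t\<in>T. ?d t = \<zero>"
    using assms(1)[unfolded independent_over_def, THEN spec, of ?d] by blast
  moreover have "t \<in> T" using t assms(3) by blast
  ultimately show "c t = \<zero>" using t by auto
qed

lemma independent_single:
  assumes "independent_over {u}" "u \<in> carrier A"
  shows "u \<noteq> \<zero>"
proof
  assume u: "u = \<zero>"
  have "\<one> = \<zero>"
    by (rule assms(1)[unfolded independent_over_def, rule_format, of "\<lambda>_. \<one>" u]) (use u in simp_all)
  then show False by simp
qed

lemma independent_two: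
  assumes ind: "independent_over {u, v}" and "u \<noteq> v" "u \<in> carrier A" "v \<in> carrier A"
    and "c \<in> K" "d \<in> K" "c \<otimes> u \<oplus> d \<otimes> v = \<zero>"
  shows "c = \<zero>" "d = \<zero>"
proof -
  define r where "r = (\<lambda>t. if t = u then c else d)"
  have r: "r u = c" "r v = d" using assms(2) by (auto simp: r_def)
  have cl: "r u \<in> carrier A" "r v \<in> carrier A" unfolding r using K_A assms(5,6) by auto
  have "(\<Oplus>t\<in>{u, v}. r t \<otimes> t) = r u \<otimes> u \<oplus> r v \<otimes> v"
    using cl assms(2-4) by simp
  then have "(\<Oplus>t\<in>{u, v}. r t \<otimes> t) = \<zero>" unfolding r assms(7) .
  moreover have "\<forall>t\<in>{u, v}. r t \<in> K" using r assms(5,6) by simp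
  ultimately have "\<forall>t\<in>{u, v}. r t = \<zero>"
    using ind[unfolded independent_over_def, THEN spec, of r] by blast
  then have "r u = \<zero>" "r v = \<zero>" by blast+
  then show "c = \<zero>" "d = \<zero>" unfolding r .
qed

lemma independent_three:
  assumes ind: "independent_over {u, v, w}" and "u \<noteq> v" "u \<noteq> w" "v \<noteq> w"
    "u \<in> carrier A" "v \<in> carrier A" "w \<in> carrier A"
    and "c \<in> K" "d \<in> K" "e \<in> K" "c \<otimes> u \<oplus> (d \<otimes> v \<oplus> e \<otimes> w) = \<zero>"
  shows "c = \<zero>" "d = \<zero>" "e = \<zero>"
proof -
  define r where "r = (\<lambda>t. if t = u then c else if t = v then d else e)"
  have r: "r u = c" "r v = d" "r w = e" using assms(2-4) by (auto simp: r_def)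
  have cl: "r u \<in> carrier A" "r v \<in> carrier A" "r w \<in> carrier A"
    unfolding r using K_A assms(8-10) by auto
  have "(\<Oplus>t\<in>{u, v, w}. r t \<otimes> t) = r u \<otimes> u \<oplus> (r v \<otimes> v \<oplus> r w \<otimes> w)"
    using cl assms(2-7) by simp
  then have "(\<Oplus>t\<in>{u, v, w}. r t \<otimes> t) = \<zero>" unfolding r assms(11) .
  moreover have "\<forall>t\<in>{u, v, w}. r t \<in> K" using r assms(8-10) by simp
  ultimately have "\<forall>t\<in>{u, v, w}. r t = \<zero>"
    using ind[unfolded independent_over_def, THEN spec, of r] by blast
  then have "r u = \<zero>" "r v = \<zero>" "r w = \<zero>" by blast+
  then show "c = \<zero>" "d = \<zero>" "e = \<zero>" unfolding r .
qed

end

section \<open>Local structure of the invariants and of the kernel of the squared derivation\<close>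

locale ga_action_at = ga_action +
  fixes m
  assumes factorial: "factorial_domain A"
    and loc_triv: "locally_trivial A \<delta>"
    and m_maximal: "maximalideal m (A\<lparr>carrier := ker\<rparr>)"
begin

abbreviation "C \<equiv> A\<lparr>carrier := ker\<rparr>"
abbreviation "S \<equiv> ker - m"

lemma C_cring: "cring C"
  using ker_ring_domain by (simp add: domain_def)

lemma m_ker: "x \<in> m \<Longrightarrow> x \<in> ker"
  and m_zero: "\<zero> \<in> m"
  and m_add: "x \<in> m \<Longrightarrow> y \<in> m \<Longrightarrow> x \<oplus> y \<in> m"
  and m_mult: "x \<in> m \<Longrightarrow> c \<in> ker \<Longrightarrow> c \<otimes> x \<in> m"
  and m_one: "\<one> \<notin> m"
  and m_prime: "x \<in> ker \<Longrightarrow> y \<in> ker \<Longrightarrow> x \<otimes> y \<in> m \<Longrightarrow> x \<in> m \<or> y \<in> m"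
proof -
  interpret M: maximalideal m C by (rule m_maximal)
  interpret P: primeideal m C by (rule cring.maximalideal_prime[OF C_cring m_maximal])
  show "x \<in> m \<Longrightarrow> x \<in> ker" for x using M.Icarr by simp
  show "\<zero> \<in> m" using additive_subgroup.zero_closed[OF M.additive_subgroup_axioms] by simp
  show "x \<in> m \<Longrightarrow> y \<in> m \<Longrightarrow> x \<oplus> y \<in> m" for x y
    using additive_subgroup.a_closed[OF M.additive_subgroup_axioms] by simp
  show "x \<in> m \<Longrightarrow> c \<in> ker \<Longrightarrow> c \<otimes> x \<in> m" for x c using M.I_l_closed by simp
  show "\<one> \<notin> m" using M.one_imp_carrier M.I_notcarr by auto
  show "x \<in> ker \<Longrightarrow> y \<in> ker \<Longrightarrow> x \<otimes> y \<in> m \<Longrightarrow> x \<in> m \<or> y \<in> m" for x y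
    using P.I_prime by simp
qed

lemma S_mult_closed: "s \<in> S \<Longrightarrow> t \<in> S \<Longrightarrow> s \<otimes> t \<in> S"
  using m_prime[of s t] by auto

sublocale clearing_denominators A ker S
proof (intro clearing_denominators.intro clearing_denominators_axioms.intro domain_axioms ker_subring)
  show "S \<subseteq> ker" "\<one> \<in> S" "\<zero> \<notin> S" using m_one m_zero by auto
qed (rule S_mult_closed)

lemma S_minus_m:
  assumes "s \<in> S" "x \<in> m" shows "s \<ominus> x \<in> S"
proof -
  have c: "s \<in> carrier A" "x \<in> carrier A" using assms m_ker ker_carrier by auto
  have "(s \<ominus> x) \<oplus> x = s" using c by (simp add: a_minus_def a_assoc l_neg)
  then have "s \<ominus> x \<notin> m" using m_add[OF _ assms(2), of "s \<ominus> x"] assms(1) by auto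
  then show ?thesis using assms m_ker by auto
qed

lemma S_factor:
  assumes "s \<in> S" "w \<in> carrier A" "y \<in> carrier A" "s = w \<otimes> y"
  shows "w \<in> S" "y \<in> S"
proof -
  have "s \<in> ker" "s \<noteq> \<zero>" "s \<notin> m" using assms(1) m_zero by auto
  note s = this[unfolded assms(4)]
  have k: "w \<in> ker" "y \<in> ker"
    using ker_factor[OF assms(2,3) s(1,2)] ker_factor2[OF assms(2,3) s(1,2)] .
  have "w \<notin> m" using m_mult[of w y] k s(3) unfolding m_comm[OF assms(2,3)] by blast
  moreover have "y \<notin> m" using m_mult[of y w] k s(3) by blast
  ultimately show "w \<in> S" "y \<in> S" using k by blast+
qed

abbreviation "plinth \<equiv> plinth_ideal A \<delta>"

lemma plinth_iff: "j \<in> plinth \<longleftrightarrow> j \<in> ker \<and> (\<exists>t\<in>carrier A. j = \<delta> t)"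
  by (auto simp: plinth_ideal_def invariant_ring_eq)

text \<open>The elements of \<open>A\<close> that \<open>w\<close> divides locally form an ideal containing the plinth ideal, hence
  containing \<open>1\<close> by local triviality. So \<open>w\<close> divides an element of \<open>S\<close>, and \<open>S\<close> is closed under factors
  because the kernel is. This is the form in which local triviality is used throughout.\<close>

lemma common_divisor_of_plinth:
  assumes w: "w \<in> carrier A" and div: "\<And>j. j \<in> plinth \<Longrightarrow> \<exists>s\<in>S. \<exists>y\<in>carrier A. s \<otimes> j = w \<otimes> y"
  shows "w \<in> S"
proof -
  define J where "J = {a \<in> carrier A. \<exists>s\<in>S. \<exists>y\<in>carrier A. s \<otimes> a = w \<otimes> y}"
  have "ideal J A"
  proof (rule idealI[OF ring_axioms])
    show "subgroup J (add_monoid A)"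
    proof (rule add.subgroupI)
      show "J \<subseteq> carrier A" by (auto simp: J_def)
      have "\<one> \<otimes> \<zero> = w \<otimes> \<zero>" using w by simp
      then have "\<zero> \<in> J" using S_one unfolding J_def by blast
      then show "J \<noteq> {}" by auto
    next
      fix a assume "a \<in> J"
      then obtain s y where 1: "a \<in> carrier A" "s \<in> S" "y \<in> carrier A" "s \<otimes> a = w \<otimes> y"
        unfolding J_def by blast
      have "s \<otimes> (\<ominus> a) = w \<otimes> (\<ominus> y)" using 1 w S_A[OF 1(2)] by (simp add: r_minus)
      then show "\<ominus> a \<in> J" using 1 unfolding J_def by blast
    next
      fix a b assume "a \<in> J" "b \<in> J"
      then obtain s y t z where 1: "a \<in> carrier A" "s \<in> S" "y \<in> carrier A" "s \<otimes> a = w \<otimes> y"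
        and 2: "b \<in> carrier A" "t \<in> S" "z \<in> carrier A" "t \<otimes> b = w \<otimes> z"
        unfolding J_def by blast
      have sc: "s \<in> carrier A" "t \<in> carrier A" using 1 2 S_A by auto
      have "(s \<otimes> t) \<otimes> (a \<oplus> b) = t \<otimes> (s \<otimes> a) \<oplus> s \<otimes> (t \<otimes> b)"
        using 1(1) 2(1) sc by (simp add: r_distr m_ac)
      also have "\<dots> = w \<otimes> (t \<otimes> y \<oplus> s \<otimes> z)"
        unfolding 1(4) 2(4) using 1 2 sc w by (simp add: r_distr m_ac)
      finally show "a \<oplus> b \<in> J"
        using 1 2 sc S_mult_closed[OF 1(2) 2(2)] unfolding J_def by blast
    qed
  next
    fix a x assume "a \<in> J" and x: "x \<in> carrier A"
    then obtain s y where 1: "a \<in> carrier A" "s \<in> S" "y \<in> carrier A" "s \<otimes> a = w \<otimes> y"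
      unfolding J_def by blast
    have sc: "s \<in> carrier A" using 1 S_A by auto
    have "s \<otimes> (x \<otimes> a) = x \<otimes> (s \<otimes> a)" using 1(1) sc x by (simp add: m_ac)
    also have "\<dots> = w \<otimes> (x \<otimes> y)" unfolding 1(4) using 1 x w by (simp add: m_ac)
    finally show xa: "x \<otimes> a \<in> J" using 1 x unfolding J_def by blast
    show "a \<otimes> x \<in> J" using xa m_comm[OF 1(1) x] by simp
  qed
  moreover have "plinth \<subseteq> J" using div plinth_iff ker_carrier unfolding J_def by blast
  ultimately have "Idl plinth \<subseteq> J" by (rule genideal_minimal)
  then have "\<one> \<in> J" using loc_triv by (auto simp: locally_trivial_def)
  then obtain s y where s: "s \<in> S" "y \<in> carrier A" "s \<otimes> \<one> = w \<otimes> y" by (auto simp: J_def)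
  then show ?thesis using S_factor(1)[OF s(1) w s(2)] S_A by simp
qed

text \<open>Non-invertibility is not built in: the elements considered below lie in \<open>m\<close>, and an element of
  \<open>m\<close> has no inverse because the kernel is factorially closed.\<close>

definition prime_elt :: "'a \<Rightarrow> bool" where
  "prime_elt p \<longleftrightarrow> p \<in> carrier A \<and> p \<noteq> \<zero> \<and>
    (\<forall>a\<in>carrier A. \<forall>b\<in>carrier A. p divides a \<otimes> b \<longrightarrow> p divides a \<or> p divides b)"

text \<open>The product of the irreducible factors lies in the prime ideal \<open>m\<close>, and each of them lies in the
  kernel because the kernel is factorially closed; so one of them lies in \<open>m\<close>.\<close>

lemma prime_factor_in_m:
  assumes "r \<in> m" "r \<noteq> \<zero>"
  shows "\<exists>p\<in>m. prime_elt p \<and> p divides r"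
proof -
  interpret U: factorial_domain A by (rule factorial)
  have rk: "r \<in> ker" "r \<in> carrier A" using assms m_ker ker_carrier by auto
  obtain fs where fs: "set fs \<subseteq> carrier (mult_of A)" "wfactors (mult_of A) fs r"
    using U.wfactors_exist[of r] rk assms by auto
  have irr: "\<forall>f\<in>set fs. irreducible (mult_of A) f"
    and assoc: "foldr (\<otimes>) fs \<one> \<sim>\<^bsub>mult_of A\<^esub> r"
    using fs(2) by (auto simp: wfactors_def)
  have "r divides\<^bsub>mult_of A\<^esub> foldr (\<otimes>) fs \<one>" using assoc by (simp add: associated_def)
  then obtain u where u: "u \<in> carrier A" "u \<noteq> \<zero>" "foldr (\<otimes>) fs \<one> = r \<otimes> u" by (auto simp: factor_def)
  have "foldr (\<otimes>) fs \<one> divides\<^bsub>mult_of A\<^esub> r" using assoc by (simp add: associated_def)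
  then obtain v where v: "v \<in> carrier A" "v \<noteq> \<zero>" "r = foldr (\<otimes>) fs \<one> \<otimes> v" by (auto simp: factor_def)
  have "r \<otimes> (u \<otimes> v) = (r \<otimes> u) \<otimes> v" using u(1) v(1) rk(2) by (simp add: m_assoc)
  also have "\<dots> = r" unfolding u(3)[symmetric] by (rule v(3)[symmetric])
  finally have "r \<otimes> (u \<otimes> v) = r \<otimes> \<one>" using rk(2) by simp
  then have uv: "u \<otimes> v = \<one>" using m_lcancel[OF assms(2) rk(2), of "u \<otimes> v" \<one>] u(1) v(1) by simp
  have "u \<in> ker" using ker_factor[OF u(1) v(1)] uv by simp
  then have prod: "foldr (\<otimes>) fs \<one> \<in> m" unfolding u(3) m_comm[OF rk(2) u(1)] by (rule m_mult[OF assms(1)])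
  have "\<exists>p\<in>set fs. p \<in> m \<and> p divides foldr (\<otimes>) fs \<one>"
    if "set fs \<subseteq> carrier A - {\<zero>}" "foldr (\<otimes>) fs \<one> \<in> m" for fs
    using that
  proof (induction fs)
    case Nil
    then show ?case using m_one by simp
  next
    case (Cons f fs)
    have cl: "foldr (\<otimes>) gs \<one> \<in> carrier A \<and> foldr (\<otimes>) gs \<one> \<noteq> \<zero>" if "set gs \<subseteq> carrier A - {\<zero>}" for gs
      using that by (induction gs) (auto simp: integral_iff)
    have fs: "foldr (\<otimes>) fs \<one> \<in> carrier A" "foldr (\<otimes>) fs \<one> \<noteq> \<zero>" using cl[of fs] Cons.prems(1) by auto
    have f: "f \<in> carrier A" "f \<noteq> \<zero>" using Cons.prems(1) by auto
    have P: "f \<otimes> foldr (\<otimes>) fs \<one> \<in> m" using Cons.prems(2) by simp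
    have nz: "f \<otimes> foldr (\<otimes>) fs \<one> \<noteq> \<zero>" using f fs by (simp add: integral_iff)
    have "f \<in> ker" "foldr (\<otimes>) fs \<one> \<in> ker"
      using ker_factor[OF f(1) fs(1) m_ker[OF P] nz] ker_factor2[OF f(1) fs(1) m_ker[OF P] nz] .
    then consider "f \<in> m" | "foldr (\<otimes>) fs \<one> \<in> m" using m_prime P by blast
    then show ?case
    proof cases
      case 1
      have "f divides foldr (\<otimes>) (f # fs) \<one>" unfolding factor_def using fs(1) by auto
      then show ?thesis using 1 by auto
    next
      case 2
      then obtain p where p: "p \<in> set fs" "p \<in> m" "p divides foldr (\<otimes>) fs \<one>"
        using Cons.IH Cons.prems(1) by auto
      then obtain q where q: "q \<in> carrier A" "foldr (\<otimes>) fs \<one> = p \<otimes> q" by (auto simp: factor_def)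
      have pc: "p \<in> carrier A" using p(2) m_ker ker_carrier by auto
      have "foldr (\<otimes>) (f # fs) \<one> = p \<otimes> (f \<otimes> q)" using f pc q by (simp add: m_ac)
      then have "p divides foldr (\<otimes>) (f # fs) \<one>" using q f by (auto simp: factor_def)
      then show ?thesis using p by auto
    qed
  qed
  from this[of fs] fs(1) prod obtain p where p: "p \<in> set fs" "p \<in> m" "p divides foldr (\<otimes>) fs \<one>"
    by auto
  have pc: "p \<in> carrier A" "p \<noteq> \<zero>" using p(1) fs(1) by auto
  have "prime (mult_of A) p"
    using U.irreducible_prime[of p] irr p(1) fs(1) by auto
  then have rp: "ring_prime p" using ring_primeI'[of p] pc by auto
  have "prime_elt p"
    unfolding prime_elt_def
  proof (intro conjI ballI impI)
    fix a b assume ab: "a \<in> carrier A" "b \<in> carrier A" "p divides a \<otimes> b"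
    then show "p divides a \<or> p divides b"
      using ring_primeE(3)[OF _ rp] pc(1) by (auto simp: prime_def)
  qed (use pc in auto)
  moreover have "p divides r"
  proof -
    obtain q where q: "q \<in> carrier A" "foldr (\<otimes>) fs \<one> = p \<otimes> q" using p(3) by (auto simp: factor_def)
    then have "r = p \<otimes> (q \<otimes> v)" using v pc q by (simp add: m_assoc)
    then show ?thesis using q v by (auto simp: factor_def)
  qed
  ultimately show ?thesis using p(2) by blast
qed

text \<open>Dividing out a greatest common divisor \<open>g\<close>. Coprimality is stated in the form in which it is used:
  each quotient is a nonzerodivisor modulo the other one.\<close>

lemma coprime_parts:
  assumes "p \<in> carrier A" "p \<noteq> \<zero>" "q \<in> carrier A" "q \<noteq> \<zero>"
  obtains g a b where "g \<in> carrier A" "a \<in> carrier A" "b \<in> carrier A" "p = g \<otimes> a" "q = g \<otimes> b"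
    "\<And>c. c \<in> carrier A \<Longrightarrow> b divides a \<otimes> c \<Longrightarrow> b divides c"
    "\<And>c. c \<in> carrier A \<Longrightarrow> a divides b \<otimes> c \<Longrightarrow> a divides c"
proof -
  interpret U: factorial_domain A by (rule factorial)
  have in_M: "p \<in> carrier (mult_of A)" "q \<in> carrier (mult_of A)" using assms by auto
  obtain g where g: "g \<in> carrier (mult_of A)" "g gcdof\<^bsub>mult_of A\<^esub> p q"
    using U.gcdof_exists[OF in_M] by auto
  then have "g divides\<^bsub>mult_of A\<^esub> p" "g divides\<^bsub>mult_of A\<^esub> q" by (auto simp: isgcd_def)
  then obtain a b where a: "a \<in> carrier A" "a \<noteq> \<zero>" "p = g \<otimes> a" and b: "b \<in> carrier A" "b \<noteq> \<zero>" "q = g \<otimes> b"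
    by (auto simp: factor_def)
  have gc: "g \<in> carrier A" "g \<noteq> \<zero>" using g(1) by auto
  have cop: "b divides c"
    if a: "a \<in> carrier A" "a \<noteq> \<zero>" "p = g \<otimes> a" and b: "b \<in> carrier A" "b \<noteq> \<zero>" "q = g \<otimes> b"
      and gcd: "\<And>d. d \<in> carrier (mult_of A) \<Longrightarrow> d divides\<^bsub>mult_of A\<^esub> p \<Longrightarrow> d divides\<^bsub>mult_of A\<^esub> q \<Longrightarrow> d divides\<^bsub>mult_of A\<^esub> g"
      and c: "c \<in> carrier A" "b divides a \<otimes> c" and pq: "p \<in> carrier A" "p \<noteq> \<zero>" "q \<in> carrier A" "q \<noteq> \<zero>"
    for a b c p q
  proof (cases "c = \<zero>")
    case True
    then show ?thesis using b by (auto simp: factor_def intro: bexI[of _ \<zero>])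
  next
    case False
    \<comment> \<open>A gcd \<open>h\<close> of \<open>p c = g a c\<close> and \<open>q c = g b c\<close> is divisible by \<open>g b\<close> and by \<open>c\<close>;
      its quotient by \<open>c\<close> divides \<open>p\<close> and \<open>q\<close>, hence \<open>g\<close>.\<close>
    have M: "p \<otimes> c \<in> carrier (mult_of A)" "q \<otimes> c \<in> carrier (mult_of A)"
      using pq c False by (auto simp: integral_iff)
    obtain h where h: "h \<in> carrier (mult_of A)" "h gcdof\<^bsub>mult_of A\<^esub> (p \<otimes> c) (q \<otimes> c)"
      using U.gcdof_exists[OF M] by auto
    have hd: "h divides\<^bsub>mult_of A\<^esub> (p \<otimes> c)" "h divides\<^bsub>mult_of A\<^esub> (q \<otimes> c)"
      and hg: "\<And>d. d \<in> carrier (mult_of A) \<Longrightarrow> d divides\<^bsub>mult_of A\<^esub> (p \<otimes> c) \<Longrightarrow> d divides\<^bsub>mult_of A\<^esub> (q \<otimes> c) \<Longrightarrow> d divides\<^bsub>mult_of A\<^esub> h"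
      using h(2) by (auto simp: isgcd_def)
    have cM: "c \<in> carrier (mult_of A)" using c False by auto
    have "c divides\<^bsub>mult_of A\<^esub> (r \<otimes> c)" if "r \<in> carrier A" "r \<noteq> \<zero>" for r
      unfolding factor_def using that m_comm[OF that(1) c(1)] by (intro bexI[of _ r]) auto
    then have "c divides\<^bsub>mult_of A\<^esub> h" using pq by (intro hg cM) blast+
    then obtain k where k: "k \<in> carrier A" "k \<noteq> \<zero>" "h = c \<otimes> k" by (auto simp: factor_def)
    have quot: "k divides\<^bsub>mult_of A\<^esub> r" if r: "r \<in> carrier A" "r \<noteq> \<zero>" and d: "h divides\<^bsub>mult_of A\<^esub> (r \<otimes> c)" for r
    proof -
      obtain l where l: "l \<in> carrier A" "l \<noteq> \<zero>" "r \<otimes> c = h \<otimes> l" using d by (auto simp: factor_def)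
      then have "c \<otimes> r = c \<otimes> (k \<otimes> l)" using k c r by (simp add: m_ac)
      then have "r = k \<otimes> l" using m_lcancel[OF False c(1) r(1), of "k \<otimes> l"] k l by simp
      then show ?thesis using l by (auto simp: factor_def)
    qed
    have "k divides\<^bsub>mult_of A\<^esub> g" using k quot[OF pq(1,2) hd(1)] quot[OF pq(3,4) hd(2)] by (intro gcd) auto
    then obtain e where e: "e \<in> carrier A" "g = k \<otimes> e" by (auto simp: factor_def)
    obtain f where f: "f \<in> carrier A" "a \<otimes> c = b \<otimes> f" using c(2) by (auto simp: factor_def)
    have f0: "f \<noteq> \<zero>" using f a(1,2) c(1) False b(1) by (metis integral r_null)
    have qM: "q \<in> carrier (mult_of A)" using pq by auto
    have "p \<otimes> c = q \<otimes> f" using a b c f gc by (simp add: m_assoc)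
    then have "q divides\<^bsub>mult_of A\<^esub> (p \<otimes> c)" using f(1) f0 by (auto simp: factor_def)
    moreover have "q divides\<^bsub>mult_of A\<^esub> (q \<otimes> c)" using c(1) False by (auto simp: factor_def)
    ultimately have "q divides\<^bsub>mult_of A\<^esub> h" by (rule hg[OF qM])
    then obtain n where n: "n \<in> carrier A" "h = q \<otimes> n" by (auto simp: factor_def)
    \<comment> \<open>Now \<open>g c = e h = e q n = g (b e n)\<close>.\<close>
    have "g \<otimes> c = e \<otimes> h" unfolding e(2) k(3) using e k c by (simp add: m_ac)
    also have "\<dots> = g \<otimes> (b \<otimes> (e \<otimes> n))" unfolding n(2) b(3) using e n b gc by (simp add: m_ac)
    finally have "c = b \<otimes> (e \<otimes> n)" using m_lcancel[OF gc(2,1) c(1), of "b \<otimes> (e \<otimes> n)"] b e n by simp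
    then show ?thesis using e n by (auto simp: factor_def)
  qed
  have gcd: "\<And>d. d \<in> carrier (mult_of A) \<Longrightarrow> d divides\<^bsub>mult_of A\<^esub> p \<Longrightarrow> d divides\<^bsub>mult_of A\<^esub> q \<Longrightarrow> d divides\<^bsub>mult_of A\<^esub> g"
    using g(2) by (auto simp: isgcd_def)
  show ?thesis
    by (rule that[OF gc(1) a(1) b(1) a(3) b(3)])
      (use cop[OF a b gcd _ _ assms] cop[OF b a gcd _ _ assms(3,4,1,2)] in blast)+
qed

end

context ga_action_at
begin

text \<open>Replacing one generator by a prime factor that lies in \<open>m\<close> does not shrink the ideal they
  generate. If this prime \<open>x\<close> divided the other generator, it would divide \<open>m\<close> locally, hence the
  plinth ideal, and local triviality forbids this.\<close>

lemma prime_parameters: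
  assumes pl: "plinth \<subseteq> m" and "x0 \<in> m" "y0 \<in> m"
    and gen: "\<And>r. r \<in> m \<Longrightarrow> \<exists>s\<in>S. \<exists>p\<in>ker. \<exists>q\<in>ker. s \<otimes> r = p \<otimes> x0 \<oplus> q \<otimes> y0"
  shows "\<exists>x\<in>m. \<exists>y\<in>m. prime_elt x \<and> \<not> x divides y \<and>
    (\<forall>r\<in>m. \<exists>s\<in>S. \<exists>p\<in>ker. \<exists>q\<in>ker. s \<otimes> r = p \<otimes> x \<oplus> q \<otimes> y)"
proof -
  note kA = ker_carrier
  have no_single: False
    if w: "w \<in> m" and d: "\<And>r. r \<in> m \<Longrightarrow> \<exists>s\<in>S. \<exists>y\<in>carrier A. s \<otimes> r = w \<otimes> y" for w
  proof -
    have "w \<in> S"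
      by (rule common_divisor_of_plinth) (use w m_ker kA d pl in blast)+
    then show False using w by auto
  qed
  have main: ?thesis
    if x: "x \<in> m" "x \<noteq> \<zero>" and y: "y \<in> m"
      and g: "\<And>r. r \<in> m \<Longrightarrow> \<exists>s\<in>S. \<exists>p\<in>ker. \<exists>q\<in>ker. s \<otimes> r = p \<otimes> x \<oplus> q \<otimes> y" for x y
  proof -
    obtain z where z: "z \<in> m" "prime_elt z" "z divides x" using prime_factor_in_m[OF x] by blast
    have zA: "z \<in> carrier A" using z(1) m_ker kA by blast
    obtain c where c: "c \<in> carrier A" "x = z \<otimes> c" using z(3) by (auto simp: factor_def)
    have "z \<otimes> c \<in> ker" "z \<otimes> c \<noteq> \<zero>" using x m_ker c(2) by auto
    then have ck: "c \<in> ker" by (rule ker_factor2[OF zA c(1)])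
    have yA: "y \<in> carrier A" using y m_ker kA by blast
    have g': "\<exists>s\<in>S. \<exists>p\<in>ker. \<exists>q\<in>ker. s \<otimes> r = p \<otimes> z \<oplus> q \<otimes> y" if rm: "r \<in> m" for r
    proof -
      obtain s p q where 1: "s \<in> S" "p \<in> ker" "q \<in> ker" "s \<otimes> r = p \<otimes> x \<oplus> q \<otimes> y"
        using g[OF rm] by blast
      have "p \<otimes> x = (p \<otimes> c) \<otimes> z" unfolding c(2) using kA[OF 1(2)] zA c(1) by (simp add: m_ac)
      then have "s \<otimes> r = (p \<otimes> c) \<otimes> z \<oplus> q \<otimes> y" using 1(4) by simp
      moreover have "p \<otimes> c \<in> ker" using 1(2) ck by (rule mult_ker)
      ultimately show ?thesis using 1(1,3) by blast
    qed
    have "\<not> z divides y"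
    proof
      assume "z divides y"
      then obtain d where d: "d \<in> carrier A" "y = z \<otimes> d" by (auto simp: factor_def)
      show False
      proof (rule no_single[OF z(1)])
        fix r assume "r \<in> m"
        then obtain s p q where 1: "s \<in> S" "p \<in> ker" "q \<in> ker" "s \<otimes> r = p \<otimes> z \<oplus> q \<otimes> y"
          using g' by blast
        have "s \<otimes> r = z \<otimes> (p \<oplus> q \<otimes> d)"
          unfolding 1(4) d(2) using kA[OF 1(2)] kA[OF 1(3)] zA d(1) by (simp add: r_distr m_ac)
        moreover have "p \<oplus> q \<otimes> d \<in> carrier A" using kA[OF 1(2)] kA[OF 1(3)] d(1) by simp
        ultimately show "\<exists>s\<in>S. \<exists>y\<in>carrier A. s \<otimes> r = z \<otimes> y" using 1(1) by blast
      qed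
    qed
    then show ?thesis using z(1,2) y g' by blast
  qed
  show ?thesis
  proof (cases "x0 = \<zero>")
    case False
    then show ?thesis using main[OF assms(2) False assms(3)] gen by blast
  next
    case True
    have y0A: "y0 \<in> carrier A" using assms(3) m_ker kA by blast
    have x0A: "x0 \<in> carrier A" using assms(2) m_ker kA by blast
    have "y0 \<noteq> \<zero>"
    proof
      assume y0: "y0 = \<zero>"
      show False
      proof (rule no_single[OF m_zero])
        fix r assume "r \<in> m"
        then obtain s p q where 1: "s \<in> S" "p \<in> ker" "q \<in> ker" "s \<otimes> r = p \<otimes> x0 \<oplus> q \<otimes> y0"
          using gen by blast
        have "s \<otimes> r = \<zero> \<otimes> \<zero>" unfolding 1(4) True y0 using kA[OF 1(2)] kA[OF 1(3)] by simp
        then show "\<exists>s\<in>S. \<exists>y\<in>carrier A. s \<otimes> r = \<zero> \<otimes> y" using 1(1) by blast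
      qed
    qed
    have "\<exists>s\<in>S. \<exists>p\<in>ker. \<exists>q\<in>ker. s \<otimes> r = p \<otimes> y0 \<oplus> q \<otimes> x0" if rm: "r \<in> m" for r
    proof -
      obtain s p q where 1: "s \<in> S" "p \<in> ker" "q \<in> ker" "s \<otimes> r = p \<otimes> x0 \<oplus> q \<otimes> y0"
        using gen[OF rm] by blast
      have "s \<otimes> r = q \<otimes> y0 \<oplus> p \<otimes> x0"
        unfolding 1(4) using kA[OF 1(2)] kA[OF 1(3)] x0A y0A by (simp add: a_comm)
      then show ?thesis using 1(1-3) by blast
    qed
    then show ?thesis using main[OF assms(3) \<open>y0 \<noteq> \<zero>\<close> assms(2)] by blast
  qed
qed

text \<open>The elements with \<open>\<delta> (\<delta> t) = 0\<close>. Over the kernel they form an extension of the plinth ideal by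
  the kernel itself.\<close>

definition slices :: "'a set" where "slices = {t \<in> carrier A. \<delta> t \<in> ker}"

lemma slices_carrier: "slices \<subseteq> carrier A"
  by (auto simp: slices_def)

lemma plinth_ideal_C: "ideal plinth C"
proof (rule K_idealI)
  show "plinth \<subseteq> ker" by (auto simp: plinth_iff)
  have "\<zero> = \<delta> \<zero>" by simp
  then show "\<zero> \<in> plinth" unfolding plinth_iff using zero_ker zero_closed by blast
next
  fix a b assume "a \<in> plinth" "b \<in> plinth"
  then obtain t u where t: "a \<in> ker" "b \<in> ker" "t \<in> carrier A" "u \<in> carrier A" "a = \<delta> t" "b = \<delta> u"
    by (auto simp: plinth_iff)
  have "a \<oplus> b = \<delta> (t \<oplus> u)" "t \<oplus> u \<in> carrier A" using t by (simp_all add: D_add)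
  moreover have "a \<oplus> b \<in> ker" using t(1,2) by (rule add_ker)
  ultimately show "a \<oplus> b \<in> plinth" unfolding plinth_iff by blast
next
  fix k a assume k: "k \<in> ker" and "a \<in> plinth"
  then obtain t where t: "a \<in> ker" "t \<in> carrier A" "a = \<delta> t" by (auto simp: plinth_iff)
  have "k \<otimes> a = \<delta> (k \<otimes> t)" using t k by (simp add: D_ker_mult)
  moreover have "k \<otimes> t \<in> carrier A" using t(2) ker_carrier[OF k] by simp
  moreover have "k \<otimes> a \<in> ker" using k t(1) by (rule mult_ker)
  ultimately show "k \<otimes> a \<in> plinth" unfolding plinth_iff by blast
qed

text \<open>Preimages of generators of the plinth ideal, together with \<open>1\<close>, generate the slices.\<close>

lemma slices_finitely_generated:
  assumes "noetherian_ring C"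
  shows "\<exists>T. locally_generates T slices"
proof -
  obtain G where G: "G \<subseteq> ker" "finite G" "G \<subseteq> plinth" "plinth \<subseteq> K_span G"
    using noetherian_generates[OF assms plinth_ideal_C] by blast
  have "\<forall>g\<in>G. \<exists>t\<in>carrier A. \<delta> t = g" using G(3) unfolding plinth_iff subset_eq by metis
  then obtain pre where pre: "\<And>g. g \<in> G \<Longrightarrow> pre g \<in> carrier A" "\<And>g. g \<in> G \<Longrightarrow> \<delta> (pre g) = g"
    by metis
  define T where "T = insert \<one> (pre ` G)"
  have T: "finite T" "T \<subseteq> slices"
    using G(1,2) pre by (auto simp: T_def slices_def)
  have TA: "T \<subseteq> carrier A" using T(2) slices_carrier by blast
  have "\<exists>s\<in>S. s \<otimes> t \<in> K_span T" if t: "t \<in> slices" for t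
  proof -
    have tA: "t \<in> carrier A" "\<delta> t \<in> ker" using t by (auto simp: slices_def)
    then have "\<delta> t \<in> K_span G" using G(4) plinth_iff by blast
    then obtain c where c: "\<And>g. g \<in> G \<Longrightarrow> c g \<in> ker" "\<delta> t = (\<Oplus>g\<in>G. c g \<otimes> g)" by (rule K_spanE) blast
    have cl: "c g \<otimes> pre g \<in> carrier A" if "g \<in> G" for g
      using that c(1) pre(1) ker_carrier by simp
    define t' where "t' = (\<Oplus>g\<in>G. c g \<otimes> pre g)"
    have t'A: "t' \<in> carrier A" unfolding t'_def using cl by (intro finsum_closed) auto
    have "(\<Oplus>g\<in>H. c g \<otimes> pre g) \<in> K_span T" if "H \<subseteq> G" for H
      using finite_subset[OF that G(2)] that
    proof (induction rule: finite_induct)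
      case empty
      then show ?case using K_span_zero[OF TA] by simp
    next
      case (insert h H)
      have "(\<Oplus>g\<in>insert h H. c g \<otimes> pre g) = c h \<otimes> pre h \<oplus> (\<Oplus>g\<in>H. c g \<otimes> pre g)"
        using insert cl by (intro finsum_insert) auto
      moreover have "c h \<otimes> pre h \<in> K_span T"
        using insert.prems c(1) by (intro K_span_scale[OF TA T(1)] K_span_base[OF TA T(1)]) (auto simp: T_def)
      ultimately show ?case using insert K_span_add[OF TA] by auto
    qed
    then have t'K_span: "t' \<in> K_span T" by (simp add: t'_def)
    have "\<delta> t' = (\<Oplus>g\<in>G. \<delta> (c g \<otimes> pre g))"
      unfolding t'_def using Dn_finsum[OF G(2), of "\<lambda>g. c g \<otimes> pre g" 1] cl by simp
    also have "\<dots> = (\<Oplus>g\<in>G. c g \<otimes> g)"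
      using c(1) pre ker_carrier G(1) by (intro finsum_cong') (auto simp: D_ker_mult)
    finally have eq: "\<delta> t' = \<delta> t" unfolding c(2) .
    have "\<delta> (t \<ominus> t') = \<zero>"
      unfolding D_diff[OF tA(1) t'A] eq using D_closed[OF tA(1)] by (simp add: a_minus_def r_neg)
    then have "t \<ominus> t' \<in> ker" using tA t'A by (intro kerI) auto
    then have "(t \<ominus> t') \<otimes> \<one> \<in> K_span T"
      by (intro K_span_scale[OF TA T(1)] K_span_base[OF TA T(1)]) (auto simp: T_def)
    then have "(t \<ominus> t') \<otimes> \<one> \<oplus> t' \<in> K_span T" using t'K_span by (intro K_span_add[OF TA])
    moreover have "(t \<ominus> t') \<otimes> \<one> \<oplus> t' = t"
      using tA(1) t'A by (simp add: a_minus_def a_assoc l_neg)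
    ultimately show ?thesis using tA(1) S_one by (intro bexI[of _ \<one>]) auto
  qed
  then show ?thesis using T unfolding locally_generates_def by blast
qed

lemma slices_cancel:
  assumes "x \<in> ker" "x \<noteq> \<zero>" "b \<in> carrier A" "x \<otimes> b \<in> slices"
  shows "b \<in> slices"
proof -
  have 1: "x \<otimes> \<delta> b \<in> ker" using assms D_ker_mult[OF assms(1,3)] by (simp add: slices_def)
  have "\<delta> b \<in> ker"
  proof (cases "\<delta> b = \<zero>")
    case False
    then have "x \<otimes> \<delta> b \<noteq> \<zero>" using assms ker_carrier by (simp add: integral_iff)
    then show ?thesis using ker_factor2[OF _ _ 1] assms ker_carrier by simp
  qed simp
  then show ?thesis using assms(3) by (simp add: slices_def)
qed

lemma slices_K_span:
  assumes "finite T" "T \<subseteq> slices" "z \<in> K_span T"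
  shows "z \<in> slices"
proof -
  have TA: "T \<subseteq> carrier A" using assms(2) slices_carrier by blast
  obtain c where c: "\<And>t. t \<in> T \<Longrightarrow> c t \<in> ker" "z = (\<Oplus>t\<in>T. c t \<otimes> t)" using assms(3) by (rule K_spanE) blast
  have "(\<Oplus>t\<in>U. c t \<otimes> t) \<in> slices" if "U \<subseteq> T" for U
    using finite_subset[OF that assms(1)] that
  proof (induction rule: finite_induct)
    case empty
    then show ?case by (simp add: slices_def)
  next
    case (insert u U)
    have u: "c u \<in> ker" "u \<in> slices" "u \<in> carrier A" using insert.prems c(1) assms(2) TA by auto
    have "(\<Oplus>t\<in>insert u U. c t \<otimes> t) = c u \<otimes> u \<oplus> (\<Oplus>t\<in>U. c t \<otimes> t)"
      using insert TA c(1) ker_carrier by (intro finsum_insert) (auto simp: subset_iff)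
    moreover have "(\<Oplus>t\<in>U. c t \<otimes> t) \<in> slices" using insert by simp
    ultimately show ?case using u ker_carrier[OF u(1)]
      by (simp add: slices_def D_add D_ker_mult)
  qed
  then show ?thesis using c(2) by simp
qed

text \<open>Let \<open>T\<close> be a minimal local generating set of the slices and \<open>N\<close> its module of relations.
  Coefficients of a relation lie in \<open>m\<close>, so a relation is locally \<open>x p + y q\<close>. Since \<open>x\<close> is prime
  in \<open>A\<close> and does not divide \<open>y\<close>, it divides the value of \<open>q\<close> on \<open>T\<close>, say with quotient \<open>w\<close>;
  correcting \<open>p\<close> and \<open>q\<close> by multiples of the coordinates of the slice \<open>w\<close> makes both of them
  relations. So \<open>N = x N + y N\<close>, and \<open>N = 0\<close> by Nakayama's lemma. (This is the vanishing of a
  \<open>Tor\<close> against the residue field, read off from the Koszul complex of \<open>x, y\<close>.)\<close>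

lemma slices_locally_free:
  assumes noeth: "noetherian_ring C"
    and x: "x \<in> m" "prime_elt x" and y: "y \<in> m" "\<not> x divides y"
    and par: "\<And>r. r \<in> m \<Longrightarrow> \<exists>s\<in>S. \<exists>p\<in>ker. \<exists>q\<in>ker. s \<otimes> r = p \<otimes> x \<oplus> q \<otimes> y"
  shows "\<exists>T. locally_generates T slices \<and> independent_over T"
proof -
  obtain T0 where T0: "locally_generates T0 slices" using slices_finitely_generated[OF noeth] ..
  obtain T where T: "locally_generates T slices"
    and min: "\<forall>c. (\<forall>t\<in>T. c t \<in> ker) \<longrightarrow> (\<Oplus>t\<in>T. c t \<otimes> t) = \<zero> \<longrightarrow> (\<forall>t\<in>T. c t \<notin> S)"
    using minimal_local_generators[OF T0 slices_carrier] by blast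
  have fin: "finite T" "T \<subseteq> slices" "T \<subseteq> carrier A"
    using T slices_carrier by (auto simp: locally_generates_def)
  define Rel where "Rel = {c. (\<forall>t\<in>T. c t \<in> ker) \<and> (\<Oplus>t\<in>T. c t \<otimes> t) = \<zero>}"
  have xk: "x \<in> ker" "x \<in> carrier A" "x \<noteq> \<zero>"
    using m_ker[OF x(1)] x(2) unfolding prime_elt_def by blast+
  have yk: "y \<in> ker" "y \<in> carrier A" using m_ker[OF y(1)] ker_carrier by blast+
  let ?val = "\<lambda>c. \<Oplus>t\<in>T. c t \<otimes> t"
  have Rel_step: "\<exists>s\<in>S. \<exists>p\<in>Rel. \<exists>q\<in>Rel. \<forall>t\<in>T. s \<otimes> c t = x \<otimes> p t \<oplus> y \<otimes> q t" if c: "c \<in> Rel" for c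
  proof -
    have cm: "c t \<in> m" if "t \<in> T" for t using min c that unfolding Rel_def by blast
    have "\<exists>s\<in>S. \<forall>t\<in>T. \<exists>p\<in>ker. \<exists>q\<in>ker. s \<otimes> c t = p \<otimes> x \<oplus> q \<otimes> y"
    proof (rule common_denominator[OF fin(1)])
      fix t assume "t \<in> T"
      then show "\<exists>s\<in>S. \<exists>p\<in>ker. \<exists>q\<in>ker. s \<otimes> c t = p \<otimes> x \<oplus> q \<otimes> y" using par cm by blast
    next
      fix s s' t assume t: "t \<in> T" and s: "s \<in> S" "s' \<in> S"
        and "\<exists>p\<in>ker. \<exists>q\<in>ker. s \<otimes> c t = p \<otimes> x \<oplus> q \<otimes> y"
      then obtain p q where pq: "p \<in> ker" "q \<in> ker" "s \<otimes> c t = p \<otimes> x \<oplus> q \<otimes> y" by blast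
      have cl: "p \<in> carrier A" "q \<in> carrier A" "s \<in> carrier A" "s' \<in> carrier A" "c t \<in> carrier A"
        using pq s cm[OF t] m_ker ker_carrier S_A by blast+
      have "s' \<otimes> s \<otimes> c t = s' \<otimes> (s \<otimes> c t)" using cl by (simp add: m_assoc)
      also have "\<dots> = (s' \<otimes> p) \<otimes> x \<oplus> (s' \<otimes> q) \<otimes> y"
        unfolding pq(3) using cl xk yk by (simp add: r_distr m_assoc)
      finally show "\<exists>p\<in>ker. \<exists>q\<in>ker. s' \<otimes> s \<otimes> c t = p \<otimes> x \<oplus> q \<otimes> y"
        using pq s mult_ker by blast
    qed
    then obtain s where s: "s \<in> S" "\<forall>t\<in>T. \<exists>p\<in>ker. \<exists>q\<in>ker. s \<otimes> c t = p \<otimes> x \<oplus> q \<otimes> y" by blast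
    then obtain p q where pq: "\<And>t. t \<in> T \<Longrightarrow> p t \<in> ker" "\<And>t. t \<in> T \<Longrightarrow> q t \<in> ker"
      "\<And>t. t \<in> T \<Longrightarrow> s \<otimes> c t = p t \<otimes> x \<oplus> q t \<otimes> y" by metis
    have sA: "s \<in> carrier A" "s \<in> ker" using s S_A by auto
    have ck: "c t \<in> ker" if "t \<in> T" for t using c that by (simp add: Rel_def)
    have vA: "?val p \<in> carrier A" "?val q \<in> carrier A" using K_span_sum_carrier[OF fin(3)] pq by auto
    have "\<zero> = s \<otimes> ?val c" using c sA by (simp add: Rel_def)
    also have "\<dots> = (\<Oplus>t\<in>T. (s \<otimes> c t) \<otimes> t)" using ck sA by (intro K_span_sum_scale[OF fin(3,1)]) auto
    also have "\<dots> = (\<Oplus>t\<in>T. (x \<otimes> p t \<oplus> y \<otimes> q t) \<otimes> t)"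
      using pq xk yk fin(3) ker_carrier by (intro finsum_cong') (auto simp: m_comm subset_iff)
    also have "\<dots> = (\<Oplus>t\<in>T. (x \<otimes> p t) \<otimes> t) \<oplus> (\<Oplus>t\<in>T. (y \<otimes> q t) \<otimes> t)"
      using pq xk yk by (intro K_span_sum_add[OF fin(3), symmetric]) auto
    also have "\<dots> = x \<otimes> ?val p \<oplus> y \<otimes> ?val q"
      using pq xk yk K_span_sum_scale[OF fin(3,1)] by auto
    finally have koszul: "x \<otimes> ?val p \<oplus> y \<otimes> ?val q = \<zero>" by (rule sym)
    have "y \<otimes> ?val q = x \<otimes> (\<ominus> ?val p)"
    proof -
      have "y \<otimes> ?val q \<oplus> x \<otimes> ?val p = \<zero>"
        using koszul xk(2) yk(2) vA a_comm[of "y \<otimes> ?val q" "x \<otimes> ?val p"] by simp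
      then have "\<ominus> (x \<otimes> ?val p) = y \<otimes> ?val q" using xk(2) yk(2) vA by (intro minus_equality) auto
      then show ?thesis using r_minus[OF xk(2) vA(1)] by simp
    qed
    then have "x divides y \<otimes> ?val q" using vA unfolding factor_def by blast
    then have "x divides ?val q" using x(2) y(2) yk vA unfolding prime_elt_def by blast
    then obtain w where w: "w \<in> carrier A" "?val q = x \<otimes> w" by (auto simp: factor_def)
    have "?val q \<in> slices" using slices_K_span[OF fin(1,2)] K_spanI[of T q] pq(2) by blast
    then have "w \<in> slices" using slices_cancel[OF xk(1,3) w(1)] w(2) by simp
    then obtain s' where s': "s' \<in> S" "s' \<otimes> w \<in> K_span T" using locally_generatesD[OF T] by blast
    obtain d where d: "\<And>t. t \<in> T \<Longrightarrow> d t \<in> ker" "s' \<otimes> w = ?val d" using s'(2) by (rule K_spanE) blast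
    have s'A: "s' \<in> carrier A" "s' \<in> ker" using s' S_A by auto
    have "x \<otimes> (?val p \<oplus> y \<otimes> w) = x \<otimes> ?val p \<oplus> y \<otimes> ?val q"
      unfolding w(2) using xk yk vA w by (simp add: r_distr m_ac)
    then have "x \<otimes> (?val p \<oplus> y \<otimes> w) = \<zero>" using koszul by simp
    then have pw: "?val p \<oplus> y \<otimes> w = \<zero>" using xk yk vA w by (simp add: integral_iff)
    define p' where "p' = (\<lambda>t. s' \<otimes> p t \<oplus> y \<otimes> d t)"
    define q' where "q' = (\<lambda>t. s' \<otimes> q t \<oplus> (\<ominus> x) \<otimes> d t)"
    have kt: "s' \<otimes> p t \<in> ker" "y \<otimes> d t \<in> ker" "s' \<otimes> q t \<in> ker" "\<ominus> x \<otimes> d t \<in> ker" if "t \<in> T" for t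
      using that pq d s'A yk xk by auto
    have "?val p' = s' \<otimes> ?val p \<oplus> y \<otimes> ?val d"
      using pq d s'A yk kt K_span_sum_scale[OF fin(3,1)] K_span_sum_add[OF fin(3)] by (simp add: p'_def)
    also have "\<dots> = s' \<otimes> (?val p \<oplus> y \<otimes> w)"
      unfolding d(2)[symmetric] using s'A yk vA w by (simp add: r_distr m_ac)
    finally have p': "p' \<in> Rel" using pw s'A kt by (simp add: Rel_def p'_def)
    have "?val q' = s' \<otimes> ?val q \<oplus> (\<ominus> x) \<otimes> ?val d"
      using pq d s'A xk kt K_span_sum_scale[OF fin(3,1)] K_span_sum_add[OF fin(3)] by (simp add: q'_def)
    also have "\<dots> = \<zero>"
      unfolding d(2)[symmetric] w(2) using s'A xk(2) w(1) by (simp add: l_minus r_minus m_lcomm r_neg)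
    finally have q': "q' \<in> Rel" using kt by (simp add: Rel_def q'_def)
    have "(s' \<otimes> s) \<otimes> c t = x \<otimes> p' t \<oplus> y \<otimes> q' t" if "t \<in> T" for t
    proof -
      have cl: "p t \<in> carrier A" "q t \<in> carrier A" "d t \<in> carrier A" "c t \<in> carrier A"
        using pq(1,2) d(1) ck that ker_carrier by auto
      have "(s' \<otimes> s) \<otimes> c t = s' \<otimes> (p t \<otimes> x \<oplus> q t \<otimes> y)"
        using cl s'A sA pq(3)[OF that] by (simp add: m_assoc)
      also have "\<dots> = s' \<otimes> (x \<otimes> p t) \<oplus> s' \<otimes> (y \<otimes> q t) \<oplus> (x \<otimes> (y \<otimes> d t) \<oplus> \<ominus> (x \<otimes> (y \<otimes> d t)))"
        using cl s'A xk yk by (simp add: r_neg r_distr m_comm)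
      also have "\<dots> = x \<otimes> p' t \<oplus> y \<otimes> q' t"
        using cl s'A xk yk by (simp add: p'_def q'_def r_distr l_minus r_minus m_ac a_ac)
      finally show ?thesis .
    qed
    moreover have "s' \<otimes> s \<in> S" using s' s by (intro S_mult_closed)
    ultimately show ?thesis using p' q' by blast
  qed
  have "c u = \<zero>" if c: "c \<in> Rel" and u: "u \<in> T" for c u
  proof -
    define N where "N = (\<lambda>c. c u) ` Rel"
    have Nk: "N \<subseteq> ker" using u by (auto simp: N_def Rel_def)
    have idN: "ideal N C"
    proof (rule K_idealI[OF Nk])
      have "(\<lambda>_. \<zero>) \<in> Rel"
      proof -
        have "(\<Oplus>t\<in>T. \<zero> \<otimes> t) = (\<Oplus>t\<in>T. \<zero>)" using fin(3) by (intro finsum_cong') auto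
        then show ?thesis by (simp add: Rel_def)
      qed
      then show "\<zero> \<in> N" unfolding N_def by (rule rev_image_eqI) simp
    next
      fix a b assume "a \<in> N" "b \<in> N"
      then obtain p q where 1: "p \<in> Rel" "q \<in> Rel" "a = p u" "b = q u" by (auto simp: N_def)
      have "(\<lambda>t. p t \<oplus> q t) \<in> Rel" using 1 K_span_sum_add[OF fin(3), of p q] by (auto simp: Rel_def)
      then show "a \<oplus> b \<in> N" unfolding N_def 1 by (rule rev_image_eqI) simp
    next
      fix k a assume k: "k \<in> ker" and "a \<in> N"
      then obtain p where 1: "p \<in> Rel" "a = p u" by (auto simp: N_def)
      have "(\<lambda>t. k \<otimes> p t) \<in> Rel"
        using 1 k K_span_sum_scale[OF fin(3,1) k, of p] ker_carrier[OF k] by (auto simp: Rel_def)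
      then show "k \<otimes> a \<in> N" unfolding N_def 1 by (rule rev_image_eqI) simp
    qed
    obtain G where G: "finite G" "G \<subseteq> N" "N \<subseteq> K_span G"
      using noetherian_generates[OF noeth idN] by blast
    have NA: "N \<subseteq> carrier A"
    proof
      fix a assume "a \<in> N"
      then show "a \<in> carrier A" using Nk by (intro ker_carrier) blast
    qed
    have "locally_generates G N" unfolding locally_generates_def
    proof (intro conjI G ballI)
      fix a assume a: "a \<in> N"
      then have "a \<in> carrier A" "a \<in> K_span G" using G(3) NA by blast+
      then have "\<one> \<otimes> a \<in> K_span G" by simp
      then show "\<exists>s\<in>S. s \<otimes> a \<in> K_span G" using S_one by blast
    qed
    then have "N \<subseteq> {\<zero>}"
    proof (rule local_Nakayama[OF _ NA xk(1) yk(1)])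
      fix s c d assume "s \<in> S" "c \<in> ker" "d \<in> ker"
      moreover have "x \<otimes> c \<oplus> y \<otimes> d = c \<otimes> x \<oplus> d \<otimes> y"
        using ker_carrier \<open>c \<in> ker\<close> \<open>d \<in> ker\<close> xk yk by (simp add: m_comm)
      ultimately show "s \<ominus> (x \<otimes> c \<oplus> y \<otimes> d) \<in> S"
        using S_minus_m[of s "c \<otimes> x \<oplus> d \<otimes> y"] m_add m_mult x(1) y(1) by simp
    next
      fix a assume "a \<in> N"
      then obtain c where c: "c \<in> Rel" "a = c u" by (auto simp: N_def)
      obtain s p q where "s \<in> S" "p \<in> Rel" "q \<in> Rel" "\<forall>t\<in>T. s \<otimes> c t = x \<otimes> p t \<oplus> y \<otimes> q t"
        using Rel_step[OF c(1)] by blast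
      then have "s \<in> S" "p u \<in> N" "q u \<in> N" "s \<otimes> a = x \<otimes> p u \<oplus> y \<otimes> q u"
        using u c(2) by (auto simp: N_def)
      then show "\<exists>s\<in>S. \<exists>a'\<in>N. \<exists>a''\<in>N. s \<otimes> a = x \<otimes> a' \<oplus> y \<otimes> a''" by blast
    qed
    then show ?thesis using c by (auto simp: N_def)
  qed
  then have "independent_over T" unfolding independent_over_def Rel_def by blast
  then show ?thesis using T by blast
qed

end

context ga_action_at
begin

text \<open>Once \<open>\<delta> u\<close> is inverted, every slice \<open>z\<close> is a combination of \<open>1\<close> and \<open>u\<close> over the kernel, since
  \<open>\<delta> u z - \<delta> z u\<close> lies in the kernel; so there are at most two independent slices. In terms of three independent slices \<open>u, v, w\<close>, the elements \<open>\<delta> u v - \<delta> v u\<close> and \<open>\<delta> u w - \<delta> w u\<close> lie in the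
  kernel, and their symmetric product gives a relation.\<close>

lemma three_slices_dependent:
  assumes ind: "independent_over {u, v, w}" and d: "u \<noteq> v" "u \<noteq> w" "v \<noteq> w"
    and uvw: "u \<in> slices" "v \<in> slices" "w \<in> slices"
  shows "\<delta> u = \<zero>"
proof (rule ccontr)
  assume u0: "\<delta> u \<noteq> \<zero>"
  have cl: "u \<in> carrier A" "v \<in> carrier A" "w \<in> carrier A" using uvw by (auto simp: slices_def)
  define i j k where "i = \<delta> u" and "j = \<delta> v" and "k = \<delta> w"
  have ker: "i \<in> ker" "j \<in> ker" "k \<in> ker" using uvw by (auto simp: slices_def i_def j_def k_def)
  note ca = ker(1)[THEN ker_carrier] ker(2)[THEN ker_carrier] ker(3)[THEN ker_carrier]
  have D_det: "\<delta> (i \<otimes> z \<ominus> \<delta> z \<otimes> u) = \<zero>" if "z \<in> slices" for z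
  proof -
    have z: "z \<in> carrier A" "\<delta> z \<in> ker" using that by (auto simp: slices_def)
    have "\<delta> (i \<otimes> z \<ominus> \<delta> z \<otimes> u) = i \<otimes> \<delta> z \<ominus> \<delta> z \<otimes> i"
      using z cl ca ker by (simp add: D_diff D_ker_mult i_def)
    then show ?thesis using ca z by (simp add: m_comm)
  qed
  define p where "p = i \<otimes> v \<ominus> j \<otimes> u"
  define q where "q = i \<otimes> w \<ominus> k \<otimes> u"
  have pq: "p \<in> ker" "q \<in> ker"
    unfolding p_def q_def j_def k_def
    using D_det[OF uvw(2)] D_det[OF uvw(3)] cl ca by (auto intro!: kerI simp: j_def k_def)
  note pqA = pq(1)[THEN ker_carrier] pq(2)[THEN ker_carrier]
  have "(p \<otimes> k \<ominus> q \<otimes> j) \<otimes> u \<oplus> ((q \<otimes> i) \<otimes> v \<oplus> (\<ominus> (p \<otimes> i)) \<otimes> w) = q \<otimes> p \<ominus> p \<otimes> q"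
  proof -
    have "q \<otimes> p \<ominus> p \<otimes> q = q \<otimes> (i \<otimes> v \<ominus> j \<otimes> u) \<ominus> p \<otimes> (i \<otimes> w \<ominus> k \<otimes> u)"
      by (simp only: p_def[symmetric] q_def[symmetric])
    also have "\<dots> = (p \<otimes> k \<ominus> q \<otimes> j) \<otimes> u \<oplus> ((q \<otimes> i) \<otimes> v \<oplus> (\<ominus> (p \<otimes> i)) \<otimes> w)"
      using pqA ca cl
      by (simp add: a_minus_def r_distr l_distr minus_add l_minus r_minus m_assoc a_ac)
    finally show ?thesis by (rule sym)
  qed
  then have rel: "(p \<otimes> k \<ominus> q \<otimes> j) \<otimes> u \<oplus> ((q \<otimes> i) \<otimes> v \<oplus> (\<ominus> (p \<otimes> i)) \<otimes> w) = \<zero>"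
    using pqA by (simp add: m_comm)
  have "q \<otimes> i = \<zero>"
    by (rule independent_three(2)[OF ind d cl _ _ _ rel]) (use pq ker in simp_all)
  then have "q = \<zero>" using u0 pqA ca by (simp add: integral_iff i_def)
  then have rel2: "(\<ominus> k) \<otimes> u \<oplus> i \<otimes> w = \<zero>"
    using ca cl by (simp add: q_def a_minus_def l_minus a_comm)
  have "independent_over {u, w}" using independent_subset[OF ind, of "{u, w}"] cl by auto
  then have "i = \<zero>" using independent_two(2)[OF _ d(2) cl(1,3) _ _ rel2] ker by simp
  then show False using u0 by (simp add: i_def)
qed

text \<open>Of three basis elements, two would lie in the kernel by the preceding lemma; but \<open>u\<close> and \<open>v\<close> in the
  kernel satisfy \<open>v u - u v = 0\<close>. One element cannot suffice: \<open>1\<close> and a slice with nonzero derivative would be proportional over the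
  kernel.\<close>

lemma slices_rank_two:
  assumes T: "locally_generates T slices" "independent_over T"
    and s0: "s0 \<in> slices" "\<delta> s0 \<noteq> \<zero>"
  shows "\<exists>u v. u \<noteq> v \<and> T = {u, v}"
proof -
  have fin: "finite T" "T \<subseteq> slices" "T \<subseteq> carrier A"
    using T(1) slices_carrier by (auto simp: locally_generates_def)
  have one: "\<one> \<in> slices" by (simp add: slices_def)
  obtain s where s: "s \<in> S" "s \<otimes> \<one> \<in> K_span T" using locally_generatesD[OF T(1) one] by blast
  obtain r where r: "r \<in> S" "r \<otimes> s0 \<in> K_span T" using locally_generatesD[OF T(1) s0(1)] by blast
  have sr: "s \<in> ker" "s \<noteq> \<zero>" "s \<in> carrier A" "r \<in> ker" "r \<noteq> \<zero>" "r \<in> carrier A"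
    using s r S_nonzero S_A by auto
  have s0A: "s0 \<in> carrier A" "\<delta> s0 \<in> carrier A" using s0 by (auto simp: slices_def)
  have "\<not> 3 \<le> card T"
  proof
    assume "3 \<le> card T"
    then obtain U where U: "U \<subseteq> T" "card U = 3" using obtain_subset_with_card_n by metis
    then obtain u v w where uvw: "U = {u, v, w}" "u \<noteq> v" "v \<noteq> w" "u \<noteq> w" by (auto simp: card_3_iff)
    have ind: "independent_over {u, v, w}"
      using independent_subset[OF T(2) fin(1) U(1) fin(3)] uvw(1) by simp
    have sl: "u \<in> slices" "v \<in> slices" "w \<in> slices" using U(1) uvw(1) fin(2) by auto
    have cl: "u \<in> carrier A" "v \<in> carrier A" using sl by (auto simp: slices_def)
    have "independent_over {v, u, w}" using ind by (simp add: insert_commute)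
    then have "\<delta> v = \<zero>" using three_slices_dependent uvw sl by blast
    moreover have "\<delta> u = \<zero>" using three_slices_dependent[OF ind] uvw sl by blast
    ultimately have k: "u \<in> ker" "v \<in> ker" using cl by (auto intro: kerI)
    have ind2: "independent_over {u, v}" using independent_subset[OF ind, of "{u, v}"] sl slices_carrier by auto
    have "v \<otimes> u \<oplus> (\<ominus> u) \<otimes> v = \<zero>" using cl by (simp add: l_minus r_minus m_comm r_neg)
    then have "v = \<zero>" by (rule independent_two(1)[OF ind2 uvw(2) cl k(2) uminus_ker[OF k(1)]])
    moreover have "independent_over {v}" using independent_subset[OF ind, of "{v}"] sl slices_carrier by auto
    ultimately show False using independent_single cl(2) by blast
  qed
  moreover have "card T \<noteq> 0"
  proof
    assume "card T = 0"
    then have "T = {}" using fin(1) by simp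
    then have "s \<otimes> \<one> = \<zero>" using s(2) by (auto elim: K_spanE)
    then show False using sr by simp
  qed
  moreover have "card T \<noteq> 1"
  proof
    assume "card T = 1"
    then obtain t where t: "T = {t}" by (auto simp: card_1_singleton_iff)
    have tA: "t \<in> carrier A" "\<delta> t \<in> carrier A" using fin(3) t by auto
    have single: "\<exists>c\<in>ker. z = c \<otimes> t" if zT: "z \<in> K_span T" for z
    proof -
      obtain c where c: "\<And>t. t \<in> T \<Longrightarrow> c t \<in> ker" "z = (\<Oplus>t\<in>T. c t \<otimes> t)" using zT by (rule K_spanE) blast
      have ct: "c t \<in> ker" using c(1) t by simp
      have "z = c t \<otimes> t" unfolding c(2) t using ker_carrier[OF ct] tA by simp
      then show ?thesis using ct by blast
    qed
    obtain p where p: "p \<in> ker" "s \<otimes> \<one> = p \<otimes> t" using single[OF s(2)] by blast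
    obtain q where q: "q \<in> ker" "r \<otimes> s0 = q \<otimes> t" using single[OF r(2)] by blast
    have "p \<noteq> \<zero>" using p sr tA by auto
    have "p \<otimes> \<delta> t = \<delta> (s \<otimes> \<one>)" unfolding p(2) using p(1) tA by (simp add: D_ker_mult)
    also have "\<dots> = \<zero>" using sr by (simp add: D_ker)
    finally have "\<delta> t = \<zero>" using \<open>p \<noteq> \<zero>\<close> ker_carrier[OF p(1)] tA by (simp add: integral_iff)
    then have "r \<otimes> \<delta> s0 = \<zero>"
      using D_ker_mult[OF sr(4) s0A(1)] D_ker_mult[OF q(1) tA(1)] q(2) ker_carrier[OF q(1)] by simp
    then show False using s0(2) sr s0A by (simp add: integral_iff)
  qed
  ultimately have "card T = 2" by linarith
  then show ?thesis by (auto simp: card_2_iff)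
qed

text \<open>Otherwise the plinth ideal would be zero, and \<open>0\<close> would be a local unit dividing it.\<close>

lemma local_slice_exists: "\<exists>s0\<in>slices. \<delta> s0 \<noteq> \<zero>"
proof (rule ccontr)
  assume *: "\<not> ?thesis"
  have "\<zero> \<in> S"
  proof (rule common_divisor_of_plinth)
    fix j assume "j \<in> plinth"
    then obtain t where "t \<in> carrier A" "j = \<delta> t" "j \<in> ker" by (auto simp: plinth_iff)
    then have "j = \<zero>" using * by (auto simp: slices_def)
    then have "\<one> \<otimes> j = \<zero> \<otimes> \<zero>" by simp
    then show "\<exists>s\<in>S. \<exists>y\<in>carrier A. s \<otimes> j = \<zero> \<otimes> y" using S_one zero_closed by blast
  qed simp
  then show False using S_nonzero by simp
qed

text \<open>Writing \<open>1\<close> in terms of a local basis \<open>u, v\<close> of the slices gives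
  \<open>p u + q v = s\<close> with \<open>s\<close> a local unit, so \<open>p\<close> and \<open>q\<close> have no common factor in \<open>m\<close>. Applying \<open>\<delta>\<close> shows
  that \<open>(\<delta> v, \<delta> u)\<close> is proportional to \<open>(p, - q)\<close>, with a factor dividing the plinth ideal, that
  is, a local unit.\<close>

lemma local_equation:
  assumes noeth: "noetherian_ring C" and pl: "plinth \<subseteq> m"
    and xy: "x0 \<in> m" "y0 \<in> m"
    and gen: "\<And>r. r \<in> m \<Longrightarrow> \<exists>s\<in>S. \<exists>p\<in>ker. \<exists>q\<in>ker. s \<otimes> r = p \<otimes> x0 \<oplus> q \<otimes> y0"
  shows "\<exists>a\<in>m. \<exists>b\<in>m. \<exists>u\<in>carrier A. \<exists>v\<in>carrier A. \<exists>w\<in>S. \<exists>s\<in>S.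
    a \<otimes> u \<ominus> b \<otimes> v = s \<and> \<delta> u = b \<otimes> w \<and> \<delta> v = a \<otimes> w \<and> a \<noteq> \<zero> \<and> b \<noteq> \<zero> \<and>
    (\<forall>c\<in>carrier A. a divides b \<otimes> c \<longrightarrow> a divides c)"
proof -
  obtain x y where par: "x \<in> m" "y \<in> m" "prime_elt x" "\<not> x divides y"
    "\<And>r. r \<in> m \<Longrightarrow> \<exists>s\<in>S. \<exists>p\<in>ker. \<exists>q\<in>ker. s \<otimes> r = p \<otimes> x \<oplus> q \<otimes> y"
    using prime_parameters[OF pl xy gen] by blast
  obtain T where T: "locally_generates T slices" "independent_over T"
    using slices_locally_free[OF noeth par(1,3,2,4,5)] by blast
  obtain u v where uv: "u \<noteq> v" "T = {u, v}" using slices_rank_two[OF T] local_slice_exists by blast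
  have sl: "u \<in> slices" "v \<in> slices" using T(1) uv(2) by (auto simp: locally_generates_def)
  have cl: "u \<in> carrier A" "v \<in> carrier A" and Dk: "\<delta> u \<in> ker" "\<delta> v \<in> ker"
    using sl by (auto simp: slices_def)
  have Dc: "\<delta> u \<in> carrier A" "\<delta> v \<in> carrier A" using cl by auto
  have pair: "\<exists>c\<in>ker. \<exists>d\<in>ker. z = c \<otimes> u \<oplus> d \<otimes> v" if zT: "z \<in> K_span T" for z
  proof -
    obtain c where c: "\<And>t. t \<in> T \<Longrightarrow> c t \<in> ker" "z = (\<Oplus>t\<in>T. c t \<otimes> t)" using zT by (rule K_spanE) blast
    have k: "c u \<in> ker" "c v \<in> ker" using c(1) uv(2) by auto
    have "z = c u \<otimes> u \<oplus> c v \<otimes> v"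
      unfolding c(2) uv(2) using k[THEN ker_carrier] cl uv(1) by simp
    then show ?thesis using k by blast
  qed
  have D_pair: "\<delta> (c \<otimes> u \<oplus> d \<otimes> v) = c \<otimes> \<delta> u \<oplus> d \<otimes> \<delta> v" if "c \<in> ker" "d \<in> ker" for c d
    using that cl ker_carrier by (simp add: D_add D_ker_mult)
  have plinth_gen: "\<exists>s\<in>S. \<exists>c\<in>ker. \<exists>d\<in>ker. s \<otimes> j = c \<otimes> \<delta> u \<oplus> d \<otimes> \<delta> v" if j: "j \<in> plinth" for j
  proof -
    obtain t where t: "t \<in> carrier A" "j = \<delta> t" "j \<in> ker" using j by (auto simp: plinth_iff)
    then have "t \<in> slices" by (simp add: slices_def)
    then obtain s where s: "s \<in> S" "s \<otimes> t \<in> K_span T" using locally_generatesD[OF T(1)] by blast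
    obtain c d where cd: "c \<in> ker" "d \<in> ker" "s \<otimes> t = c \<otimes> u \<oplus> d \<otimes> v" using pair[OF s(2)] by blast
    have "s \<otimes> j = \<delta> (s \<otimes> t)" unfolding t(2) using s(1) t(1) by (simp add: D_ker_mult)
    also have "\<dots> = c \<otimes> \<delta> u \<oplus> d \<otimes> \<delta> v" unfolding cd(3) using cd by (intro D_pair)
    finally show ?thesis using s cd by blast
  qed
  have Dpl: "\<delta> u \<in> plinth" "\<delta> v \<in> plinth" using cl Dk plinth_iff by blast+
  then have Dm: "\<delta> u \<in> m" "\<delta> v \<in> m" using pl by auto
  have not_principal: False
    if y: "y \<in> m" and div: "\<And>c d. c \<in> ker \<Longrightarrow> d \<in> ker \<Longrightarrow> \<exists>e\<in>carrier A. c \<otimes> \<delta> u \<oplus> d \<otimes> \<delta> v = y \<otimes> e" for y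
  proof -
    have "y \<in> S"
    proof (rule common_divisor_of_plinth)
      show "y \<in> carrier A" using m_ker[OF y] by (rule ker_carrier)
      fix j assume "j \<in> plinth"
      then show "\<exists>s\<in>S. \<exists>e\<in>carrier A. s \<otimes> j = y \<otimes> e" using plinth_gen[of j] div by metis
    qed
    then show False using y by blast
  qed
  have u0: "\<delta> u \<noteq> \<zero>"
  proof
    assume 0: "\<delta> u = \<zero>"
    show False
    proof (rule not_principal[OF Dm(2)])
      fix c d assume "c \<in> ker" "d \<in> ker"
      then show "\<exists>e\<in>carrier A. c \<otimes> \<delta> u \<oplus> d \<otimes> \<delta> v = \<delta> v \<otimes> e"
        unfolding 0 using Dc ker_carrier by (intro bexI[of _ d]) (simp_all add: m_comm)
    qed
  qed
  have v0: "\<delta> v \<noteq> \<zero>"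
  proof
    assume 0: "\<delta> v = \<zero>"
    show False
    proof (rule not_principal[OF Dm(1)])
      fix c d assume "c \<in> ker" "d \<in> ker"
      then show "\<exists>e\<in>carrier A. c \<otimes> \<delta> u \<oplus> d \<otimes> \<delta> v = \<delta> u \<otimes> e"
        unfolding 0 using Dc ker_carrier by (intro bexI[of _ c]) (simp_all add: m_comm)
    qed
  qed
  have "\<one> \<in> slices" by (simp add: slices_def)
  then obtain s where s: "s \<in> S" "s \<otimes> \<one> \<in> K_span T" using locally_generatesD[OF T(1)] by blast
  obtain p q where pq: "p \<in> ker" "q \<in> ker" "s \<otimes> \<one> = p \<otimes> u \<oplus> q \<otimes> v" using pair[OF s(2)] by blast
  note pqA = pq(1)[THEN ker_carrier] pq(2)[THEN ker_carrier]
  have sA: "s \<in> carrier A" "s \<noteq> \<zero>" "s \<in> ker" using s S_A S_nonzero by auto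
  have s_eq: "s = p \<otimes> u \<oplus> q \<otimes> v" using pq(3) sA by simp
  have Dpq: "p \<otimes> \<delta> u \<oplus> q \<otimes> \<delta> v = \<zero>" using D_pair[OF pq(1,2)] s_eq D_ker[OF sA(3)] by simp
  have p0: "p \<noteq> \<zero>"
  proof
    assume 0: "p = \<zero>"
    then have "q \<otimes> \<delta> v = \<zero>" using Dpq pqA Dc by simp
    then have "q = \<zero>" using v0 pqA Dc by (simp add: integral_iff)
    then show False using s_eq 0 sA cl by simp
  qed
  have q0: "q \<noteq> \<zero>"
  proof
    assume 0: "q = \<zero>"
    then have "p \<otimes> \<delta> u = \<zero>" using Dpq pqA Dc by simp
    then show False using p0 u0 pqA Dc by (simp add: integral_iff)
  qed
  obtain g a b where g: "g \<in> carrier A" "a \<in> carrier A" "b \<in> carrier A" "p = g \<otimes> a" "\<ominus> q = g \<otimes> b"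
    and cop: "\<And>c. c \<in> carrier A \<Longrightarrow> b divides a \<otimes> c \<Longrightarrow> b divides c"
      "\<And>c. c \<in> carrier A \<Longrightarrow> a divides b \<otimes> c \<Longrightarrow> a divides c"
    by (rule coprime_parts[of p "\<ominus> q"]) (use pqA p0 q0 in auto)
  have q_eq: "q = \<ominus> (g \<otimes> b)" using g(5) pqA by (metis minus_minus)
  have "g \<otimes> a \<in> ker" "g \<otimes> a \<noteq> \<zero>" using pq(1) p0 unfolding g(4) .
  then have gk: "g \<in> ker" "a \<in> ker" and nz: "g \<noteq> \<zero>" "a \<noteq> \<zero>"
    using ker_factor[OF g(1,2)] ker_factor2[OF g(1,2)] g(1,2) by (simp_all add: integral_iff)
  have "g \<otimes> b \<in> ker" "g \<otimes> b \<noteq> \<zero>" using uminus_ker[OF pq(2)] q0 pqA(2) unfolding g(5)[symmetric] by auto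
  then have bk: "b \<in> ker" and bnz: "b \<noteq> \<zero>"
    using ker_factor2[OF g(1,3)] g(1,3) by (simp_all add: integral_iff)
  define s1 where "s1 = a \<otimes> u \<ominus> b \<otimes> v"
  have s1A: "s1 \<in> carrier A" using g cl by (simp add: s1_def)
  have "s = g \<otimes> s1"
    unfolding s_eq q_eq g(4) s1_def using g cl by (simp add: a_minus_def r_distr l_minus r_minus m_assoc)
  then have gS: "g \<in> S" "s1 \<in> S" using S_factor[OF s(1) g(1) s1A] by blast+
  have proportional: "a \<otimes> \<delta> u = b \<otimes> \<delta> v"
  proof -
    have "g \<otimes> (a \<otimes> \<delta> u) = g \<otimes> (b \<otimes> \<delta> v)"
    proof -
      have "g \<otimes> (a \<otimes> \<delta> u) \<ominus> g \<otimes> (b \<otimes> \<delta> v) = \<zero>"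
        using Dpq g(1-3) Dc unfolding q_eq g(4) by (simp add: l_minus m_assoc a_minus_def)
      then show ?thesis using g(1-3) Dc by (simp add: r_right_minus_eq)
    qed
    then show ?thesis using m_lcancel[OF nz(1) g(1)] g Dc by simp
  qed
  have "b divides a \<otimes> \<delta> u" unfolding proportional factor_def using Dc by blast
  then have "b divides \<delta> u" by (rule cop(1)[OF Dc(1)])
  then obtain w where w: "w \<in> carrier A" "\<delta> u = b \<otimes> w" by (auto simp: factor_def)
  have "b \<otimes> (a \<otimes> w) = b \<otimes> \<delta> v" using proportional unfolding w(2) using g w(1) by (simp add: m_lcomm)
  then have vw: "\<delta> v = a \<otimes> w" using m_lcancel[OF bnz g(3)] g w(1) Dc by simp
  have wS: "w \<in> S"
  proof (rule common_divisor_of_plinth[OF w(1)])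
    fix j assume "j \<in> plinth"
    then obtain s c d where 1: "s \<in> S" "c \<in> ker" "d \<in> ker" "s \<otimes> j = c \<otimes> \<delta> u \<oplus> d \<otimes> \<delta> v"
      using plinth_gen by blast
    note cd = ker_carrier[OF 1(2)] ker_carrier[OF 1(3)]
    have "s \<otimes> j = w \<otimes> (c \<otimes> b \<oplus> d \<otimes> a)"
      unfolding 1(4) w(2) vw using cd g w(1) by (simp add: r_distr m_ac)
    moreover have "c \<otimes> b \<oplus> d \<otimes> a \<in> carrier A" using cd g by simp
    ultimately show "\<exists>s\<in>S. \<exists>y\<in>carrier A. s \<otimes> j = w \<otimes> y" using 1(1) by blast
  qed
  have "b \<otimes> w \<in> m" "a \<otimes> w \<in> m" using Dm unfolding w(2) vw .
  then have "a \<in> m" "b \<in> m" using m_prime gk(2) bk wS by blast+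
  then show ?thesis using cl wS gS(2) w(2) vw nz(2) bnz cop(2) unfolding s1_def by blast
qed

end

section \<open>Two local generators of the maximal ideal\<close>

context subring_localization
begin

lemma L_cring: "cring L" by (rule R.localization_cring)

lemma fraction_ideal:
  assumes N: "N \<subseteq> R" "\<zero> \<in> N" "\<And>a b. a \<in> N \<Longrightarrow> b \<in> N \<Longrightarrow> a \<oplus> b \<in> N"
    "\<And>k a. k \<in> R \<Longrightarrow> a \<in> N \<Longrightarrow> k \<otimes> a \<in> N"
  shows "ideal {fraction Rr S a t | a t. a \<in> N \<and> t \<in> S} L"
proof (rule idealI)
  interpret L: cring L by (rule L_cring)
  let ?I = "{fraction Rr S a t | a t. a \<in> N \<and> t \<in> S}"
  have RA: "x \<in> carrier A" if "x \<in> R" for x using that by (rule R_carrier)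
  have S_R: "x \<in> R" if "x \<in> S" for x using that S_subring by blast
  have one: "\<one> \<in> S" by (rule A.S_one)
  show "ring L" by (rule L.ring_axioms)
  show "subgroup ?I (add_monoid L)"
  proof (rule L.add.subgroupI)
    show "?I \<subseteq> carrier L" using N(1) R.carrier_localization by auto
    show "?I \<noteq> {}" using N(2) one by blast
  next
    fix x assume "x \<in> ?I"
    then obtain a t where 1: "x = fraction Rr S a t" "a \<in> N" "t \<in> S" by blast
    have aR: "a \<in> R" using 1 N(1) by blast
    have mR: "\<ominus> a \<in> R" using subringE(5)[OF subring_axioms aR] .
    have x: "x \<in> carrier L" using 1 aR R.fraction_closed by simp
    have "\<ominus> a = (\<ominus> \<one>) \<otimes> a" using RA[OF aR] by (simp add: A.l_minus)
    also have "\<dots> \<in> N" using subringE(3,5)[OF subring_axioms] 1 by (intro N(4)) auto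
    finally have mN: "\<ominus> a \<in> N" .
    have "fraction Rr S (\<ominus> a) t \<oplus>\<^bsub>L\<^esub> x = fraction Rr S (\<ominus> a \<otimes> t \<oplus> a \<otimes> t) (t \<otimes> t)"
      unfolding 1(1) using R.fraction_add[of "\<ominus> a" t a t] mR aR 1(3) by simp
    also have "\<ominus> a \<otimes> t \<oplus> a \<otimes> t = \<zero>" using RA[OF aR] RA[OF S_R[OF 1(3)]] by (simp add: A.l_minus A.l_neg)
    also have "fraction Rr S \<zero> (t \<otimes> t) = \<zero>\<^bsub>L\<^esub>"
      using R.fraction_eq_zero[of \<zero> "t \<otimes> t"] N(1,2) A.S_mult[OF 1(3,3)] by auto
    finally have "\<ominus>\<^bsub>L\<^esub> x = fraction Rr S (\<ominus> a) t"
      using x mR 1(3) R.fraction_closed by (intro L.minus_equality) auto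
    then show "\<ominus>\<^bsub>L\<^esub> x \<in> ?I" using mN 1(3) by blast
  next
    fix x y assume "x \<in> ?I" "y \<in> ?I"
    then obtain a t b r where 1: "x = fraction Rr S a t" "a \<in> N" "t \<in> S"
      and 2: "y = fraction Rr S b r" "b \<in> N" "r \<in> S" by blast
    have cl: "a \<in> R" "b \<in> R" "t \<in> R" "r \<in> R" using 1 2 N(1) S_R by blast+
    have "x \<oplus>\<^bsub>L\<^esub> y = fraction Rr S (a \<otimes> r \<oplus> b \<otimes> t) (t \<otimes> r)"
      unfolding 1(1) 2(1) using R.fraction_add[of a t b r] cl 1(3) 2(3) by simp
    moreover have "a \<otimes> r \<oplus> b \<otimes> t \<in> N"
    proof -
      have "r \<otimes> a \<oplus> t \<otimes> b \<in> N" using cl 1 2 N(3,4) by blast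
      then show ?thesis using cl RA by (simp add: A.m_comm)
    qed
    ultimately show "x \<oplus>\<^bsub>L\<^esub> y \<in> ?I" using A.S_mult[OF 1(3) 2(3)] by blast
  qed
  fix x y assume "x \<in> ?I" and y: "y \<in> carrier L"
  then obtain a t where 1: "x = fraction Rr S a t" "a \<in> N" "t \<in> S" by blast
  obtain b r where 2: "y = fraction Rr S b r" "b \<in> R" "r \<in> S" using y by (rule L_cases)
  have cl: "a \<in> R" "t \<in> R" "r \<in> R" using 1 2 N(1) S_R by blast+
  have "y \<otimes>\<^bsub>L\<^esub> x = fraction Rr S (b \<otimes> a) (r \<otimes> t)"
    unfolding 1(1) 2(1) using R.fraction_mult[of b r a t] cl 1(3) 2 by simp
  then show yx: "y \<otimes>\<^bsub>L\<^esub> x \<in> ?I" using N(4)[OF 2(2) 1(2)] A.S_mult[OF 2(3) 1(3)] by blast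
  have "x \<in> carrier L" using 1 cl R.fraction_closed by simp
  then show "x \<otimes>\<^bsub>L\<^esub> y \<in> ?I" using yx y by (simp add: L.m_comm)
qed

lemma fraction_in_ideal:
  assumes J: "ideal J L" and a: "a \<in> R" "s \<in> S"
  shows "fraction Rr S a s \<in> J \<longleftrightarrow> fraction Rr S a \<one> \<in> J"
proof -
  interpret J: ideal J L by fact
  interpret L: cring L by (rule L_cring)
  have one: "\<one> \<in> S" "\<one> \<in> R" using A.S_one S_subring by auto
  have cl: "fraction Rr S \<one> s \<in> carrier L" "fraction Rr S s \<one> \<in> carrier L" "fraction Rr S a \<one> \<in> carrier L"
    using R.fraction_closed a one S_subring by auto
  have eq: "fraction Rr S a s = fraction Rr S a \<one> \<otimes>\<^bsub>L\<^esub> fraction Rr S \<one> s"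
    using R.fraction_split[of a s] a by simp
  show ?thesis
  proof
    assume "fraction Rr S a \<one> \<in> J"
    then show "fraction Rr S a s \<in> J" unfolding eq using cl by (intro J.I_r_closed)
  next
    assume *: "fraction Rr S a s \<in> J"
    have u: "fraction Rr S s \<one> \<otimes>\<^bsub>L\<^esub> fraction Rr S \<one> s = \<one>\<^bsub>L\<^esub>" using R.fraction_unit[OF a(2)] by simp
    have "fraction Rr S a s \<otimes>\<^bsub>L\<^esub> fraction Rr S s \<one> = fraction Rr S a \<one> \<otimes>\<^bsub>L\<^esub> (fraction Rr S s \<one> \<otimes>\<^bsub>L\<^esub> fraction Rr S \<one> s)"
      unfolding eq using cl by (simp only: L.m_ac)
    also have "\<dots> = fraction Rr S a \<one>" unfolding u using cl by simp
    finally show "fraction Rr S a \<one> \<in> J" using J.I_r_closed[OF * cl(2)] by simp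
  qed
qed

text \<open>Contraction along \<open>R \<rightarrow> L\<close> keeps chains of primes strict, because an ideal of \<open>L\<close> contains a
  fraction iff it contains the numerator. Hence dimension bounds pass from \<open>R\<close> to \<open>L\<close>.\<close>

lemma contract_prime:
  assumes "primeideal P L"
  shows "primeideal {a \<in> R. fraction Rr S a \<one> \<in> P} Rr"
proof -
  interpret P: primeideal P L by fact
  interpret L: cring L by (rule L_cring)
  have hom: "(\<lambda>a. fraction Rr S a \<one>) \<in> ring_hom Rr L" using R.localization_hom by simp
  interpret h: ring_hom_cring Rr L "\<lambda>a. fraction Rr S a \<one>"
    by (rule ring_hom_cringI[OF R.is_cring L_cring hom])
  have id: "ideal {a \<in> R. fraction Rr S a \<one> \<in> P} Rr"
    using h.ring.ideal_vimage[OF P.is_ideal] by simp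
  show ?thesis
  proof (rule primeidealI[OF id R.is_cring])
    show "carrier Rr \<noteq> {a \<in> R. fraction Rr S a \<one> \<in> P}"
    proof
      assume "carrier Rr = {a \<in> R. fraction Rr S a \<one> \<in> P}"
      moreover have "\<one> \<in> carrier Rr" using subringE(3)[OF subring_axioms] by simp
      ultimately have "fraction Rr S \<one> \<one> \<in> P" by blast
      then have "\<one>\<^bsub>L\<^esub> \<in> P" by (simp add: R.one_localization)
      then show False using P.one_imp_carrier P.I_notcarr by blast
    qed
    fix a b assume ab: "a \<in> carrier Rr" "b \<in> carrier Rr" "a \<otimes>\<^bsub>Rr\<^esub> b \<in> {a \<in> R. fraction Rr S a \<one> \<in> P}"
    have "fraction Rr S a \<one> \<otimes>\<^bsub>L\<^esub> fraction Rr S b \<one> \<in> P"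
      using ab(3) h.hom_mult[OF ab(1,2)] by simp
    from P.I_prime[OF h.hom_closed[OF ab(1)] h.hom_closed[OF ab(2)] this]
    show "a \<in> {a \<in> R. fraction Rr S a \<one> \<in> P} \<or> b \<in> {a \<in> R. fraction Rr S a \<one> \<in> P}"
      using ab(1,2) by simp
  qed
qed

lemma contract_strict:
  assumes "ideal P L" "ideal Q L" "P \<subset> Q"
  shows "{a \<in> R. fraction Rr S a \<one> \<in> P} \<subset> {a \<in> R. fraction Rr S a \<one> \<in> Q}"
proof -
  obtain x where x: "x \<in> Q" "x \<notin> P" using assms(3) by auto
  interpret Q: ideal Q L by fact
  obtain a s where a: "x = fraction Rr S a s" "a \<in> R" "s \<in> S" using Q.Icarr[OF x(1)] by (rule L_cases)
  have "fraction Rr S a \<one> \<in> Q" "fraction Rr S a \<one> \<notin> P"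
    using x fraction_in_ideal[OF assms(1) a(2,3)] fraction_in_ideal[OF assms(2) a(2,3)] a(1) by auto
  then show ?thesis using assms(3) a(2) by blast
qed

end

context ga_action_at
begin

sublocale loc: subring_localization A ker S
proof (intro subring_localization.intro subring_localization_axioms.intro ker_subring)
  show "domain_mult_subset A S"
    by (intro domain_mult_subset.intro mult_subset.intro mult_subset_axioms.intro
        domain_mult_subset_axioms.intro is_cring domain_axioms)
      (use S_A S_nonzero S_mult_closed S_one in auto)
qed auto

lemma fraction_in_m:
  assumes "a \<in> ker" "s \<in> S" "fraction C S a s = fraction C S r t" "r \<in> m" "t \<in> S"
  shows "a \<in> m"
proof -
  have "a \<otimes> t = r \<otimes> s"
    using loc.R.fraction_eq_cross[of a s r t] assms m_ker by simp
  moreover have "r \<otimes> s \<in> m"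
    using m_mult[OF assms(4), of s] assms(2) m_ker[OF assms(4)] ker_carrier by (simp add: m_comm)
  ultimately show ?thesis using m_prime[of a t] assms(1,5) by auto
qed

text \<open>The definition of a regular local ring speaks about some maximal ideal; this identifies it.\<close>

lemma localization_maximal: "maximalideal {fraction C S r t | r t. r \<in> m \<and> t \<in> S} loc.L"
proof (rule maximalidealI)
  let ?M = "{fraction C S r t | r t. r \<in> m \<and> t \<in> S}"
  interpret L: cring loc.L by (rule loc.L_cring)
  show "ideal ?M loc.L"
    by (rule loc.fraction_ideal) (use m_ker m_zero m_add m_mult in auto)
  show "carrier loc.L \<noteq> ?M"
  proof
    assume "carrier loc.L = ?M"
    then have "fraction C S \<one> \<one> \<in> ?M" using L.one_closed by (simp add: loc.R.one_localization)
    then obtain r t where "fraction C S \<one> \<one> = fraction C S r t" "r \<in> m" "t \<in> S" by blast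
    then show False using fraction_in_m[of \<one> \<one>] m_one S_one by blast
  qed
  fix J assume J: "ideal J loc.L" "?M \<subseteq> J" "J \<subseteq> carrier loc.L"
  interpret J: ideal J loc.L by (rule J(1))
  show "J = ?M \<or> J = carrier loc.L"
  proof (cases "J = ?M")
    case False
    then obtain x where x: "x \<in> J" "x \<notin> ?M" using J(2) by blast
    obtain a s where a: "x = fraction C S a s" "a \<in> ker" "s \<in> S" using J.Icarr[OF x(1)] by (rule loc.L_cases)
    have aS: "a \<in> S" using a x(2) by blast
    have "fraction C S a \<one> \<in> J" using loc.fraction_in_ideal[OF J(1) a(2,3)] x(1) a(1) by simp
    moreover have "fraction C S \<one> a \<in> carrier loc.L" using loc.R.fraction_closed[of \<one> a] aS by simp
    ultimately have "fraction C S a \<one> \<otimes>\<^bsub>loc.L\<^esub> fraction C S \<one> a \<in> J" by (rule J.I_r_closed)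
    then have "\<one>\<^bsub>loc.L\<^esub> \<in> J" using loc.R.fraction_unit[OF aS] by simp
    then show ?thesis using J.one_imp_carrier by blast
  qed simp
qed

lemma localization_dimension:
  assumes "affine_variety A" "krull_dim A = 3"
  shows "krull_dim loc.L \<le> 2"
  unfolding krull_dim_def
proof (rule Sup_least)
  fix k assume "k \<in> {enat n | n. \<exists>P. (\<forall>i\<le>n. primeideal (P i) loc.L) \<and> (\<forall>i<n. P i \<subset> P (Suc i))}"
  then obtain n P where n: "k = enat n"
    and P: "\<forall>i\<le>n. primeideal (P i) loc.L" "\<forall>i<n. P i \<subset> P (Suc i)" by blast
  define Q where "Q = (\<lambda>i. {a \<in> ker. fraction C S a \<one> \<in> P i})"
  have Q: "\<forall>i\<le>n. primeideal (Q i) C" "\<forall>i<n. Q i \<subset> Q (Suc i)"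
    unfolding Q_def using P loc.contract_prime loc.contract_strict
    by (auto simp: primeideal_def)
  obtain s0 where s0: "s0 \<in> slices" "\<delta> s0 \<noteq> \<zero>" using local_slice_exists by blast
  have "enat (Suc n) \<le> krull_dim A"
    by (rule invariant_dimension[OF assms(1) _ _ s0(2) Q]) (use s0(1) in \<open>auto simp: slices_def\<close>)
  then have "enat (Suc n) \<le> enat 3" using assms(2) by (simp add: numeral_eq_enat)
  then show "k \<le> 2" by (simp add: n numeral_eq_enat)
qed

text \<open>By regularity \<open>m L\<close> has as many generators as the dimension of \<open>L\<close>, which is at most two; their
  numerators generate \<open>m\<close> locally. Fewer than two generators are padded by zero or repetition.\<close>

lemma local_generators_of_m:
  assumes A: "affine_variety A" "krull_dim A = 3" and reg: "regular_local_ring loc.L"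
  shows "\<exists>x\<in>m. \<exists>y\<in>m. \<forall>r\<in>m. \<exists>s\<in>S. \<exists>p\<in>ker. \<exists>q\<in>ker. s \<otimes> r = p \<otimes> x \<oplus> q \<otimes> y"
proof -
  interpret L: cring loc.L by (rule loc.L_cring)
  let ?M = "{fraction C S r t | r t. r \<in> m \<and> t \<in> S}"
  obtain E where E: "E \<subseteq> carrier loc.L" "finite E" "Idl\<^bsub>loc.L\<^esub> E = ?M" "enat (card E) = krull_dim loc.L"
  proof -
    obtain M where M: "\<forall>m'. maximalideal m' loc.L \<longrightarrow> m' = M"
      "\<exists>E\<subseteq>carrier loc.L. finite E \<and> Idl\<^bsub>loc.L\<^esub> E = M \<and> enat (card E) = krull_dim loc.L"
      using reg unfolding regular_local_ring_def by (elim conjE exE) iprover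
    have "?M = M" using M(1)[THEN spec, THEN mp, OF localization_maximal] .
    then show ?thesis using M(2) that by (elim bexE exE conjE) simp
  qed
  have "enat (card E) \<le> enat 2"
    using E(4) localization_dimension[OF A] by (simp add: numeral_eq_enat)
  then have card: "card E \<le> 2" by simp
  have EM: "E \<subseteq> ?M" using L.genideal_self[OF E(1)] E(3) by simp
  have z: "fraction C S \<zero> \<one> \<in> ?M" using m_zero S_one by blast
  obtain e1 e2 where e: "E \<subseteq> {e1, e2}" "e1 \<in> ?M" "e2 \<in> ?M"
  proof -
    consider "card E = 0" | "card E = 1" | "card E = 2" using card by linarith
    then show ?thesis
    proof cases
      case 1
      then have "E = {}" using E(2) by simp
      then show ?thesis using that[of "fraction C S \<zero> \<one>" "fraction C S \<zero> \<one>"] z by blast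
    next
      case 2
      then obtain e where "E = {e}" by (auto simp: card_1_singleton_iff)
      then show ?thesis using that[of e e] EM by blast
    next
      case 3
      then obtain d e where "E = {d, e}" by (auto simp: card_2_iff)
      then show ?thesis using that[of d e] EM by blast
    qed
  qed
  obtain x s where x: "e1 = fraction C S x s" "x \<in> m" "s \<in> S" using e(2) by blast
  obtain y t where y: "e2 = fraction C S y t" "y \<in> m" "t \<in> S" using e(3) by blast
  have xyA: "x \<in> carrier A" "y \<in> carrier A" "x \<in> ker" "y \<in> ker" using x y m_ker ker_carrier by auto
  define W where "W = {a \<in> ker. \<exists>s\<in>S. \<exists>p\<in>ker. \<exists>q\<in>ker. s \<otimes> a = p \<otimes> x \<oplus> q \<otimes> y}"
  have W: "ideal {fraction C S a t | a t. a \<in> W \<and> t \<in> S} loc.L"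
  proof (rule loc.fraction_ideal)
    show "W \<subseteq> ker" by (auto simp: W_def)
    have "\<one> \<otimes> \<zero> = \<zero> \<otimes> x \<oplus> \<zero> \<otimes> y" using xyA by simp
    then show "\<zero> \<in> W" unfolding W_def using S_one zero_ker by blast
  next
    fix a b assume "a \<in> W" "b \<in> W"
    then obtain s p q r p' q' where 1: "a \<in> ker" "s \<in> S" "p \<in> ker" "q \<in> ker" "s \<otimes> a = p \<otimes> x \<oplus> q \<otimes> y"
      and 2: "b \<in> ker" "r \<in> S" "p' \<in> ker" "q' \<in> ker" "r \<otimes> b = p' \<otimes> x \<oplus> q' \<otimes> y"
      unfolding W_def by blast
    have sr: "s \<in> ker" "r \<in> ker" using 1 2 by auto
    note cl = ker_carrier[OF 1(1)] ker_carrier[OF 1(3)] ker_carrier[OF 1(4)] ker_carrier[OF 2(1)]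
      ker_carrier[OF 2(3)] ker_carrier[OF 2(4)] ker_carrier[OF sr(1)] ker_carrier[OF sr(2)]
    have "(s \<otimes> r) \<otimes> (a \<oplus> b) = r \<otimes> (s \<otimes> a) \<oplus> s \<otimes> (r \<otimes> b)" using cl by (simp add: r_distr m_ac)
    also have "\<dots> = (r \<otimes> p \<oplus> s \<otimes> p') \<otimes> x \<oplus> (r \<otimes> q \<oplus> s \<otimes> q') \<otimes> y"
      unfolding 1(5) 2(5) using cl xyA(1,2) by (simp add: r_distr l_distr m_assoc a_ac)
    finally have "(s \<otimes> r) \<otimes> (a \<oplus> b) = (r \<otimes> p \<oplus> s \<otimes> p') \<otimes> x \<oplus> (r \<otimes> q \<oplus> s \<otimes> q') \<otimes> y" .
    moreover have "r \<otimes> p \<oplus> s \<otimes> p' \<in> ker" "r \<otimes> q \<oplus> s \<otimes> q' \<in> ker" "a \<oplus> b \<in> ker"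
      using 1 2 sr by auto
    ultimately show "a \<oplus> b \<in> W" unfolding W_def using S_mult_closed[OF 1(2) 2(2)] by blast
  next
    fix k a assume k: "k \<in> ker" and "a \<in> W"
    then obtain s p q where 1: "a \<in> ker" "s \<in> S" "p \<in> ker" "q \<in> ker" "s \<otimes> a = p \<otimes> x \<oplus> q \<otimes> y"
      unfolding W_def by blast
    have sk: "s \<in> ker" using 1 by auto
    note cl = ker_carrier[OF 1(1)] ker_carrier[OF 1(3)] ker_carrier[OF 1(4)] ker_carrier[OF k] ker_carrier[OF sk]
    have "s \<otimes> (k \<otimes> a) = k \<otimes> (s \<otimes> a)" using cl by (simp add: m_ac)
    also have "\<dots> = (k \<otimes> p) \<otimes> x \<oplus> (k \<otimes> q) \<otimes> y"
      unfolding 1(5) using cl xyA(1,2) by (simp add: r_distr m_assoc)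
    finally have "s \<otimes> (k \<otimes> a) = (k \<otimes> p) \<otimes> x \<oplus> (k \<otimes> q) \<otimes> y" .
    moreover have "k \<otimes> p \<in> ker" "k \<otimes> q \<in> ker" "k \<otimes> a \<in> ker" using 1 k by auto
    ultimately show "k \<otimes> a \<in> W" unfolding W_def using 1(2) by blast
  qed
  have xW: "x \<in> W" "y \<in> W"
  proof -
    have "\<one> \<otimes> x = \<one> \<otimes> x \<oplus> \<zero> \<otimes> y" "\<one> \<otimes> y = \<zero> \<otimes> x \<oplus> \<one> \<otimes> y" using xyA by simp_all
    then show "x \<in> W" "y \<in> W" unfolding W_def using xyA S_one one_ker zero_ker by blast+
  qed
  have "E \<subseteq> {fraction C S a t | a t. a \<in> W \<and> t \<in> S}" using e(1) x y xW by blast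
  from L.genideal_minimal[OF W this, unfolded E(3)]
  have MW: "?M \<subseteq> {fraction C S a t | a t. a \<in> W \<and> t \<in> S}" .
  have "\<exists>s\<in>S. \<exists>p\<in>ker. \<exists>q\<in>ker. s \<otimes> r = p \<otimes> x \<oplus> q \<otimes> y" if r: "r \<in> m" for r
  proof -
    have "fraction C S r \<one> \<in> ?M" using r S_one by blast
    then obtain a t where at: "fraction C S r \<one> = fraction C S a t" "a \<in> W" "t \<in> S" using MW by blast
    have ak: "a \<in> ker" using at(2) by (simp add: W_def)
    have rA: "r \<in> carrier A" "t \<in> carrier A" using m_ker[OF r] at(3) ker_carrier by auto
    have "r \<otimes> t = a \<otimes> \<one>"
      using loc.R.fraction_eq_cross[of r \<one> a t] m_ker[OF r] S_one ak at(1,3) by simp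
    then have a: "a = r \<otimes> t" using ker_carrier[OF ak] by simp
    obtain s p q where 1: "s \<in> S" "p \<in> ker" "q \<in> ker" "s \<otimes> a = p \<otimes> x \<oplus> q \<otimes> y"
      using at(2) unfolding W_def by blast
    have "(s \<otimes> t) \<otimes> r = s \<otimes> a" unfolding a using S_A[OF 1(1)] rA by (simp add: m_ac)
    then show ?thesis using 1 S_mult_closed[OF 1(1) at(3)] by metis
  qed
  then show ?thesis using x(2) y(2) by blast
qed

end

section \<open>Polynomial algebras\<close>

lemma (in UP_cring) polynomials_generated:
  assumes H: "subring H P" "\<And>r. r \<in> carrier R \<Longrightarrow> up_ring.monom P r 0 \<in> H" "up_ring.monom P \<one> (Suc 0) \<in> H"
  shows "carrier P \<subseteq> H"
proof
  fix p assume p: "p \<in> carrier P"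
  have "up_ring.monom P (up_ring.coeff P p i) i \<in> H" for i
  proof -
    have c: "up_ring.coeff P p i \<in> carrier R" using p by simp
    have "up_ring.monom P (up_ring.coeff P p i) i = up_ring.monom P (up_ring.coeff P p i) 0 \<otimes>\<^bsub>P\<^esub> up_ring.monom P \<one> (Suc 0) [^]\<^bsub>P\<^esub> i"
      using c by (simp add: monom_pow del: monom_mult add: monom_mult[symmetric])
    also have "\<dots> \<in> H" using H(2)[OF c] P.subring_pow[OF H(1,3)] by (rule subringE(6)[OF H(1)])
    finally show ?thesis .
  qed
  then have "(\<Oplus>\<^bsub>P\<^esub>i\<in>{..deg R p}. up_ring.monom P (up_ring.coeff P p i) i) \<in> H"
    by (intro P.subring_finsum[OF H(1)]) auto
  then show "p \<in> H" using up_repr[OF p] by simp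
qed

text \<open>The open sets \<open>a \<noteq> 0\<close> and \<open>b \<noteq> 0\<close> cover the hypersurface \<open>a u - b v = 1\<close>, so membership in \<open>H\<close> is
  checked on each of them. Algebraically, \<open>x = u (a x) - v (b x) - (a u - b v - 1) x\<close> reduces the
  claim for \<open>x\<close> to the claims for \<open>a x\<close> and \<open>b x\<close>, each with one exponent smaller by one. The set \<open>H\<close>
  will be the image of the polynomial ring in one application and the defining ideal of the
  hypersurface in the other.\<close>

lemma (in cring) comaximal_powers:
  assumes car: "a \<in> carrier R" "b \<in> carrier R" "u \<in> carrier R" "v \<in> carrier R" "H \<subseteq> carrier R"
    and closed: "\<And>c x. c \<in> {a, b, u, v} \<Longrightarrow> x \<in> H \<Longrightarrow> c \<otimes> x \<in> H"
    and diff: "\<And>x y. x \<in> H \<Longrightarrow> y \<in> H \<Longrightarrow> x \<ominus> y \<in> H"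
    and unit: "\<And>x. x \<in> carrier R \<Longrightarrow> (a \<otimes> u \<ominus> b \<otimes> v \<ominus> \<one>) \<otimes> x \<in> H"
  shows "x \<in> carrier R \<Longrightarrow> a [^] (k::nat) \<otimes> x \<in> H \<Longrightarrow> b [^] (n::nat) \<otimes> x \<in> H \<Longrightarrow> x \<in> H"
proof (induction "k + n" arbitrary: k n x rule: less_induct)
  case less
  show ?case
  proof (cases "k = 0 \<or> n = 0")
    case True
    then show ?thesis using less.prems by auto
  next
    case False
    then obtain k' n' where kn: "k = Suc k'" "n = Suc n'" by (metis not0_implies_Suc)
    have "a \<otimes> x \<in> H"
    proof (rule less.hyps[of k' n])
      show "a [^] k' \<otimes> (a \<otimes> x) \<in> H" using less.prems(1,2) car kn by (simp add: m_assoc)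
      have "b [^] n \<otimes> (a \<otimes> x) = a \<otimes> (b [^] n \<otimes> x)" using less.prems(1) car by (simp add: m_ac)
      then show "b [^] n \<otimes> (a \<otimes> x) \<in> H" using closed[OF _ less.prems(3), of a] by simp
    qed (use less.prems(1) car kn in auto)
    moreover have "b \<otimes> x \<in> H"
    proof (rule less.hyps[of k n'])
      show "b [^] n' \<otimes> (b \<otimes> x) \<in> H" using less.prems(1,3) car kn by (simp add: m_assoc)
      have "a [^] k \<otimes> (b \<otimes> x) = b \<otimes> (a [^] k \<otimes> x)" using less.prems(1) car by (simp add: m_ac)
      then show "a [^] k \<otimes> (b \<otimes> x) \<in> H" using closed[OF _ less.prems(2), of b] by simp
    qed (use less.prems(1) car kn in auto)
    ultimately have "u \<otimes> (a \<otimes> x) \<in> H" "v \<otimes> (b \<otimes> x) \<in> H" using closed by simp_all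
    then have "(u \<otimes> (a \<otimes> x) \<ominus> v \<otimes> (b \<otimes> x)) \<ominus> (a \<otimes> u \<ominus> b \<otimes> v \<ominus> \<one>) \<otimes> x \<in> H"
      by (intro diff unit[OF less.prems(1)])
    moreover have "(u \<otimes> (a \<otimes> x) \<ominus> v \<otimes> (b \<otimes> x)) \<ominus> (a \<otimes> u \<ominus> b \<otimes> v \<ominus> \<one>) \<otimes> x = x"
    proof -
      define y where "y = (a \<otimes> u \<ominus> b \<otimes> v) \<otimes> x"
      have y: "y \<in> carrier R" using less.prems(1) car by (simp add: y_def)
      have 1: "u \<otimes> (a \<otimes> x) \<ominus> v \<otimes> (b \<otimes> x) = y"
        using less.prems(1) car by (simp add: y_def a_minus_def l_distr r_distr l_minus r_minus m_ac)
      have 2: "(a \<otimes> u \<ominus> b \<otimes> v \<ominus> \<one>) \<otimes> x = y \<ominus> x"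
        using less.prems(1) car by (simp add: y_def a_minus_def l_distr l_minus)
      show ?thesis unfolding 1 2 using y less.prems(1) by (simp add: a_minus_def minus_add r_neg1 r_neg2)
    qed
    ultimately show ?thesis by simp
  qed
qed

text \<open>This is used to eliminate a variable: once each variable is congruent modulo \<open>J\<close>, up to a power
  of \<open>a\<close>, to an element of \<open>T\<close>, the same holds for every polynomial in these variables.\<close>

lemma (in cring) elimination_subring:
  assumes J: "ideal J R" and T: "subring T R" and a: "a \<in> T"
  shows "subring {g \<in> carrier R. \<exists>k::nat. \<exists>t\<in>T. a [^] k \<otimes> g \<ominus> t \<in> J} R" (is "subring ?Q R")
proof -
  interpret J: ideal J R by fact
  have TR: "t \<in> carrier R" if "t \<in> T" for t using that subringE(1)[OF T] by blast
  note aR = TR[OF a]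
  have powT: "a [^] (k::nat) \<in> T" for k by (rule subring_pow[OF T a])
  have Jadd: "x \<oplus> y \<in> J" if "x \<in> J" "y \<in> J" for x y
    using that by (rule additive_subgroup.a_closed[OF J.additive_subgroup_axioms])
  have Q: "g \<in> ?Q" if "g \<in> carrier R" "t \<in> T" "a [^] (k::nat) \<otimes> g \<ominus> t \<in> J" for g t k
    using that by blast
  show ?thesis
  proof (rule subringI)
    show "?Q \<subseteq> carrier R" by auto
    have "a [^] (0::nat) \<otimes> \<one> \<ominus> \<one> = \<zero>" by (simp add: a_minus_def r_neg)
    then have "a [^] (0::nat) \<otimes> \<one> \<ominus> \<one> \<in> J" using J.zero_closed by (simp only:)
    then show "\<one> \<in> ?Q" by (rule Q[OF one_closed subringE(3)[OF T]])
  next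
    fix g assume "g \<in> ?Q"
    then obtain k t where g: "g \<in> carrier R" "t \<in> T" "a [^] (k::nat) \<otimes> g \<ominus> t \<in> J" by blast
    have "a [^] k \<otimes> (\<ominus> g) \<ominus> (\<ominus> t) = (\<ominus> \<one>) \<otimes> (a [^] k \<otimes> g \<ominus> t)"
      using g(1) TR[OF g(2)] aR by (simp add: a_minus_def r_distr l_minus r_minus minus_add)
    also have "\<dots> \<in> J" using g(3) by (intro J.I_l_closed) auto
    finally show "\<ominus> g \<in> ?Q" by (rule Q[OF a_inv_closed[OF g(1)] subringE(5)[OF T g(2)]])
  next
    fix g h assume "g \<in> ?Q" "h \<in> ?Q"
    then obtain k t l r where g: "g \<in> carrier R" "t \<in> T" "a [^] (k::nat) \<otimes> g \<ominus> t \<in> J"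
      and h: "h \<in> carrier R" "r \<in> T" "a [^] (l::nat) \<otimes> h \<ominus> r \<in> J" by blast
    define x y where "x = a [^] k" and "y = a [^] l"
    have xy: "x \<in> carrier R" "y \<in> carrier R" "x \<in> T" "y \<in> T" using aR powT by (auto simp: x_def y_def)
    have pw: "a [^] (k + l) = x \<otimes> y" using aR by (simp add: x_def y_def nat_pow_mult)
    note cl = g(1) h(1) TR[OF g(2)] TR[OF h(2)] xy(1,2)
    have gJ: "x \<otimes> g \<ominus> t \<in> J" "y \<otimes> h \<ominus> r \<in> J" using g(3) h(3) by (simp_all add: x_def y_def)
    have "x \<otimes> y \<otimes> (g \<otimes> h) \<ominus> t \<otimes> r = (y \<otimes> h) \<otimes> (x \<otimes> g \<ominus> t) \<oplus> t \<otimes> (y \<otimes> h \<ominus> r)"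
    proof -
      have "(y \<otimes> h) \<otimes> (x \<otimes> g \<ominus> t) \<oplus> t \<otimes> (y \<otimes> h \<ominus> r) =
          x \<otimes> y \<otimes> (g \<otimes> h) \<oplus> (\<ominus> (t \<otimes> (y \<otimes> h)) \<oplus> (t \<otimes> (y \<otimes> h) \<oplus> \<ominus> (t \<otimes> r)))"
        using cl by (simp add: a_minus_def r_distr r_minus m_ac a_assoc)
      also have "\<dots> = x \<otimes> y \<otimes> (g \<otimes> h) \<ominus> t \<otimes> r" using cl by (simp add: r_neg1 a_minus_def)
      finally show ?thesis by (rule sym)
    qed
    also have "\<dots> \<in> J" using gJ cl by (intro Jadd J.I_l_closed) auto
    finally show "g \<otimes> h \<in> ?Q"
      unfolding pw[symmetric] by (rule Q[OF m_closed[OF g(1) h(1)] subringE(6)[OF T g(2) h(2)]])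
    have "x \<otimes> y \<otimes> (g \<oplus> h) \<ominus> (y \<otimes> t \<oplus> x \<otimes> r) = y \<otimes> (x \<otimes> g \<ominus> t) \<oplus> x \<otimes> (y \<otimes> h \<ominus> r)"
      using cl by (simp add: a_minus_def r_distr r_minus minus_add m_ac a_ac)
    also have "\<dots> \<in> J" using gJ cl by (intro Jadd J.I_l_closed) auto
    finally have *: "x \<otimes> y \<otimes> (g \<oplus> h) \<ominus> (y \<otimes> t \<oplus> x \<otimes> r) \<in> J" .
    have "y \<otimes> t \<oplus> x \<otimes> r \<in> T"
      using subringE(6)[OF T xy(4) g(2)] subringE(6)[OF T xy(3) h(2)] by (rule subringE(7)[OF T])
    then show "g \<oplus> h \<in> ?Q" using *[folded pw] by (rule Q[OF a_closed[OF g(1) h(1)]])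
  qed
qed

section \<open>The localized coordinate ring\<close>

context ga_action_at
begin

abbreviation "inclusion \<equiv> fraction_inclusion A S"
abbreviation "ev z \<equiv> UnivPoly.eval loc.L loc.B inclusion z"
abbreviation "PL \<equiv> UP loc.L"

lemma B_cring: "cring loc.B" by (rule loc.A.localization_cring)

lemma pre_univ: "UP_pre_univ_prop loc.L loc.B inclusion"
  by (rule UP_pre_univ_propI[OF loc.L_cring B_cring loc.fraction_inclusion_hom])

lemma PL_UP_cring: "UP_cring loc.L"
  by (simp add: UP_cring_def loc.L_cring)

lemma PL_cring: "cring PL"
  using UP_cring.UP_cring[OF PL_UP_cring] .

lemma ev_hom: "z \<in> carrier loc.B \<Longrightarrow> ring_hom_cring PL loc.B (ev z)"
  by (rule ring_hom_cringI[OF PL_cring B_cring UP_pre_univ_prop.eval_ring_hom[OF pre_univ]])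

lemma ev_const: "z \<in> carrier loc.B \<Longrightarrow> l \<in> carrier loc.L \<Longrightarrow> ev z (up_ring.monom PL l 0) = inclusion l"
  by (rule UP_pre_univ_prop.eval_const[OF pre_univ])

lemma ev_var: "z \<in> carrier loc.B \<Longrightarrow> ev z (up_ring.monom PL \<one>\<^bsub>loc.L\<^esub> (Suc 0)) = z"
  using UP_pre_univ_prop.eval_monom1[OF pre_univ, of z] by simp

lemma ev_sum: "p \<in> carrier PL \<Longrightarrow>
    ev z p = (\<Oplus>\<^bsub>loc.B\<^esub>i\<in>{..deg loc.L p}. inclusion (up_ring.coeff PL p i) \<otimes>\<^bsub>loc.B\<^esub> z [^]\<^bsub>loc.B\<^esub> i)"
  by (simp add: UnivPoly.eval_def)

lemma monom_PL_closed: "l \<in> carrier loc.L \<Longrightarrow> up_ring.monom PL l n \<in> carrier PL"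
  using UP_ring.monom_closed[of loc.L l n] PL_UP_cring by (simp add: UP_ring_def UP_cring_def cring_def)

lemma ev_image:
  assumes "z \<in> carrier loc.B"
  shows "subring (ev z ` carrier PL) loc.B" "inclusion ` carrier loc.L \<subseteq> ev z ` carrier PL"
    "z \<in> ev z ` carrier PL"
proof -
  interpret E: ring_hom_cring PL loc.B "ev z" by (rule ev_hom[OF assms])
  show "subring (ev z ` carrier PL) loc.B"
    using ring_hom_ring.img_is_subring[OF E.ring.is_ring_hom_ring E.R.carrier_is_subring] .
  show "inclusion ` carrier loc.L \<subseteq> ev z ` carrier PL"
  proof
    fix y assume "y \<in> inclusion ` carrier loc.L"
    then obtain l where "l \<in> carrier loc.L" "y = inclusion l" by blast
    then have "y = ev z (up_ring.monom PL l 0)" "up_ring.monom PL l 0 \<in> carrier PL"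
      using ev_const[OF assms] monom_PL_closed by simp_all
    then show "y \<in> ev z ` carrier PL" by blast
  qed
  have "\<one>\<^bsub>loc.L\<^esub> \<in> carrier loc.L" using loc.L_cring by (simp add: cring.cring_simprules(6))
  from imageI[OF monom_PL_closed[OF this, of "Suc 0"], of "ev z"]
  show "z \<in> ev z ` carrier PL" unfolding ev_var[OF assms] .
qed

lemma ev_image_least:
  assumes "z \<in> H" "subring H loc.B" "inclusion ` carrier loc.L \<subseteq> H"
  shows "ev z ` carrier PL \<subseteq> H"
proof
  interpret B: cring loc.B by (rule B_cring)
  interpret U: UP_cring loc.L PL by (simp_all add: PL_UP_cring)
  fix y assume "y \<in> ev z ` carrier PL"
  then obtain p where p: "p \<in> carrier PL" "y = ev z p" by blast
  have "inclusion (up_ring.coeff PL p i) \<otimes>\<^bsub>loc.B\<^esub> z [^]\<^bsub>loc.B\<^esub> i \<in> H" for i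
    using assms(3) U.coeff_closed[OF p(1)] B.subring_pow[OF assms(2,1)]
    by (intro subringE(6)[OF assms(2)]) auto
  then show "y \<in> H" unfolding p(2) ev_sum[OF p(1)] by (intro B.subring_finsum[OF assms(2)]) auto
qed

abbreviation "quo a \<equiv> fraction A S a \<one>"

lemma quo_hom: "ring_hom_cring A loc.B quo"
  by (rule ring_hom_cringI[OF is_cring B_cring loc.A.localization_hom])

lemma inclusion_quo: "c \<in> ker \<Longrightarrow> inclusion (fraction C S c \<one>) = quo c"
  using loc.fraction_inclusion_fraction[of c \<one>] S_one by simp

lemma fracL_closed: "c \<in> ker \<Longrightarrow> s \<in> S \<Longrightarrow> fraction C S c s \<in> carrier loc.L"
  using loc.R.fraction_closed by simp

lemma quo_unit: "s \<in> S \<Longrightarrow> quo s \<otimes>\<^bsub>loc.B\<^esub> fraction A S \<one> s = \<one>\<^bsub>loc.B\<^esub>"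
  by (rule loc.A.fraction_unit)

lemma inclusion_inverse: "s \<in> S \<Longrightarrow> inclusion (fraction C S \<one> s) = fraction A S \<one> s"
  using loc.fraction_inclusion_fraction[of \<one> s] by simp

text \<open>This transfers \<open>local_slice_generates\<close> from \<open>A\<close> to \<open>B\<close>. The slice is divided by \<open>s \<in> S\<close>, a unit of \<open>L\<close>,
  which is needed to normalize the equation of the hypersurface.\<close>

lemma slice_fraction_generates:
  assumes slc: "slc \<in> carrier A" "\<delta> slc = f" "f \<in> ker" and s: "s \<in> S" and x: "x \<in> carrier loc.B"
  shows "\<exists>k::nat. quo f [^]\<^bsub>loc.B\<^esub> k \<otimes>\<^bsub>loc.B\<^esub> x \<in> ev (fraction A S slc s) ` carrier PL"
proof -
  interpret h: ring_hom_cring A loc.B quo by (rule quo_hom)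
  define z where "z = fraction A S slc s"
  have z: "z \<in> carrier loc.B" unfolding z_def using loc.A.fraction_closed slc(1) s by simp
  define H where "H = ev z ` carrier PL"
  note H = ev_image[OF z, folded H_def]
  have cst: "quo c \<in> H" if "c \<in> ker" for c
    using subsetD[OF H(2) imageI[OF fracL_closed[OF that S_one]]] unfolding inclusion_quo[OF that] .
  have inv: "fraction A S \<one> t \<in> H" if "t \<in> S" for t
    using subsetD[OF H(2) imageI[OF fracL_closed[OF one_ker that]]] unfolding inclusion_inverse[OF that] .
  have sA: "s \<in> carrier A" "s \<in> ker" using s S_A by auto
  have "quo slc = quo s \<otimes>\<^bsub>loc.B\<^esub> z"
    unfolding z_def using slc(1) s sA S_one
    by (simp add: loc.A.fraction_mult loc.A.fraction_eq_cross m_comm)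
  also have "\<dots> \<in> H" using cst[OF sA(2)] H(3) by (rule subringE(6)[OF H(1)])
  finally have slcH: "quo slc \<in> H" .
  have gen: "quo g \<in> H" if "g \<in> generate_ring A (insert slc ker)" for g
  proof -
    have inA: "insert slc ker \<subseteq> carrier A" using slc(1) ker_carrier by blast
    show ?thesis using that
    proof induction
      case one
      show ?case using cst[OF one_ker] .
    next
      case (incl h)
      then show ?case using slcH cst by blast
    next
      case (a_inv h)
      have "h \<in> carrier A" by (rule generate_ring_in_carrier[OF inA a_inv(1)])
      then show ?case using subringE(5)[OF H(1) a_inv(2)] by simp
    next
      case (eng_add h1 h2)
      have "h1 \<in> carrier A" "h2 \<in> carrier A" using generate_ring_in_carrier[OF inA] eng_add(1,2) by blast+
      then show ?case using subringE(7)[OF H(1) eng_add(3,4)] by simp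
    next
      case (eng_mult h1 h2)
      have "h1 \<in> carrier A" "h2 \<in> carrier A" using generate_ring_in_carrier[OF inA] eng_mult(1,2) by blast+
      then show ?case using subringE(6)[OF H(1) eng_mult(3,4)] by simp
    qed
  qed
  obtain t r where t: "x = fraction A S t r" "t \<in> carrier A" "r \<in> S" using x by (rule loc.B_cases)
  obtain k :: nat where k: "f [^] k \<otimes> t \<in> generate_ring A (insert slc ker)"
    using local_slice_generates[OF slc t(2)] by blast
  note fA = ker_carrier[OF slc(3)]
  have xs: "x = quo t \<otimes>\<^bsub>loc.B\<^esub> fraction A S \<one> r" unfolding t(1) by (rule loc.A.fraction_split[OF t(2,3)])
  have rB: "fraction A S \<one> r \<in> carrier loc.B" using loc.A.fraction_closed t(3) by simp
  have "quo f [^]\<^bsub>loc.B\<^esub> k \<otimes>\<^bsub>loc.B\<^esub> x = quo (f [^] k \<otimes> t) \<otimes>\<^bsub>loc.B\<^esub> fraction A S \<one> r"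
    unfolding xs using fA t(2) rB h.hom_closed by (simp add: h.S.m_assoc)
  also have "\<dots> \<in> H" using gen[OF k] inv[OF t(3)] by (rule subringE(6)[OF H(1)])
  finally show ?thesis unfolding H_def z_def by blast
qed

text \<open>Clearing denominators in an equation over \<open>L\<close> leads to an equation for the slice over the kernel.\<close>

lemma slice_fraction_transcendental:
  assumes slc: "slc \<in> carrier A" "\<delta> slc \<in> ker" "\<delta> slc \<noteq> \<zero>" and s: "s \<in> S"
    and p: "p \<in> carrier PL" "ev (fraction A S slc s) p = \<zero>\<^bsub>loc.B\<^esub>"
  shows "p = \<zero>\<^bsub>PL\<^esub>"
proof -
  interpret h: ring_hom_cring A loc.B quo by (rule quo_hom)
  interpret U: UP_cring loc.L PL by (simp_all add: PL_UP_cring)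
  interpret i: ring_hom_cring loc.L loc.B inclusion
    by (rule ring_hom_cringI[OF loc.L_cring B_cring loc.fraction_inclusion_hom])
  define z where "z = fraction A S slc s"
  have z: "z \<in> carrier loc.B" unfolding z_def using loc.A.fraction_closed slc(1) s by simp
  have sA: "s \<in> carrier A" "s \<in> ker" "s \<noteq> \<zero>" using s S_A S_nonzero by auto
  have slcz: "quo s \<otimes>\<^bsub>loc.B\<^esub> z = quo slc"
    unfolding z_def using slc(1) s sA S_one
    by (simp add: loc.A.fraction_mult loc.A.fraction_eq_cross m_comm)
  define q where "q = up_ring.coeff PL p"
  have q: "q i \<in> carrier loc.L" for i unfolding q_def using U.coeff_closed[OF p(1)] .
  define n where "n = deg loc.L p"
  have "\<exists>d\<in>S. \<forall>i\<in>{..n}. \<exists>c\<in>ker. fraction C S d \<one> \<otimes>\<^bsub>loc.L\<^esub> q i = fraction C S c \<one>"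
  proof (rule common_denominator)
    fix i assume "i \<in> {..n}"
    obtain c d where c: "q i = fraction C S c d" "c \<in> ker" "d \<in> S" using q[of i] by (rule loc.L_cases)
    have "fraction C S d \<one> \<otimes>\<^bsub>loc.L\<^esub> q i = fraction C S (d \<otimes> c) (\<one> \<otimes> d)"
      unfolding c(1) using loc.R.fraction_mult[of d \<one> c d] c S_one by simp
    also have "\<dots> = fraction C S c \<one>"
    proof (rule loc.R.fraction_eqI)
      show "d \<otimes> c \<in> carrier C" "c \<in> carrier C" "\<one> \<in> S" using c S_one by auto
      show "\<one> \<otimes> d \<in> S" using S_mult_closed[OF S_one c(3)] .
      show "(d \<otimes> c) \<otimes>\<^bsub>C\<^esub> \<one> = c \<otimes>\<^bsub>C\<^esub> (\<one> \<otimes> d)"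
        using c ker_carrier by (simp add: m_comm)
    qed
    finally show "\<exists>s\<in>S. \<exists>c\<in>ker. fraction C S s \<one> \<otimes>\<^bsub>loc.L\<^esub> q i = fraction C S c \<one>" using c by blast
  next
    fix d d' i assume d: "d \<in> S" "d' \<in> S" and "\<exists>c\<in>ker. fraction C S d \<one> \<otimes>\<^bsub>loc.L\<^esub> q i = fraction C S c \<one>"
    then obtain c where c: "c \<in> ker" "fraction C S d \<one> \<otimes>\<^bsub>loc.L\<^esub> q i = fraction C S c \<one>" by blast
    have dk: "d \<in> ker" "d' \<in> ker" using d by auto
    have dL: "fraction C S d \<one> \<in> carrier loc.L" "fraction C S d' \<one> \<in> carrier loc.L"
      using fracL_closed dk S_one by blast+
    have "fraction C S (d' \<otimes> d) \<one> = fraction C S d' \<one> \<otimes>\<^bsub>loc.L\<^esub> fraction C S d \<one>"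
      using loc.R.fraction_mult[of d' \<one> d \<one>] dk S_one by simp
    then have "fraction C S (d' \<otimes> d) \<one> \<otimes>\<^bsub>loc.L\<^esub> q i = fraction C S d' \<one> \<otimes>\<^bsub>loc.L\<^esub> fraction C S c \<one>"
      using dL q c(2) by (simp add: U.R.m_assoc)
    also have "\<dots> = fraction C S (d' \<otimes> c) \<one>"
      using loc.R.fraction_mult[of d' \<one> c \<one>] dk c(1) S_one by simp
    finally show "\<exists>c\<in>ker. fraction C S (d' \<otimes> d) \<one> \<otimes>\<^bsub>loc.L\<^esub> q i = fraction C S c \<one>"
      using dk c(1) by blast
  qed simp
  then obtain d c where d: "d \<in> S" and c: "\<And>i. i \<le> n \<Longrightarrow> c i \<in> ker"
    "\<And>i. i \<le> n \<Longrightarrow> fraction C S d \<one> \<otimes>\<^bsub>loc.L\<^esub> q i = fraction C S (c i) \<one>"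
    by (metis atMost_iff)
  have dk: "d \<in> ker" "d \<in> carrier A" using d S_A by auto
  define e where "e = (\<lambda>i. c i \<otimes> s [^] (n - i))"
  have e: "e i \<in> ker" if "i \<le> n" for i unfolding e_def using c(1)[OF that] sA(2) by simp
  have eA: "e i \<in> carrier A" if "i \<le> n" for i using e[OF that] by (rule ker_carrier)
  have summand: "(quo d \<otimes>\<^bsub>loc.B\<^esub> quo s [^]\<^bsub>loc.B\<^esub> n) \<otimes>\<^bsub>loc.B\<^esub> (inclusion (q i) \<otimes>\<^bsub>loc.B\<^esub> z [^]\<^bsub>loc.B\<^esub> i)
      = quo (e i \<otimes> slc [^] i)" if i: "i \<le> n" for i
  proof -
    have cl: "quo d \<in> carrier loc.B" "quo s \<in> carrier loc.B" "inclusion (q i) \<in> carrier loc.B"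
      using h.hom_closed dk sA i.hom_closed[OF q] by auto
    have "quo d \<otimes>\<^bsub>loc.B\<^esub> inclusion (q i) = inclusion (fraction C S d \<one> \<otimes>\<^bsub>loc.L\<^esub> q i)"
      using i.hom_mult[OF fracL_closed[OF dk(1) S_one] q] inclusion_quo[OF dk(1)] by simp
    also have "\<dots> = quo (c i)" unfolding c(2)[OF i] by (rule inclusion_quo[OF c(1)[OF i]])
    finally have 1: "quo d \<otimes>\<^bsub>loc.B\<^esub> inclusion (q i) = quo (c i)" .
    have "quo s [^]\<^bsub>loc.B\<^esub> n = quo s [^]\<^bsub>loc.B\<^esub> (n - i) \<otimes>\<^bsub>loc.B\<^esub> quo s [^]\<^bsub>loc.B\<^esub> i"
      using cl(2) i by (simp add: h.S.nat_pow_mult)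
    then have "quo s [^]\<^bsub>loc.B\<^esub> n \<otimes>\<^bsub>loc.B\<^esub> z [^]\<^bsub>loc.B\<^esub> i =
        quo s [^]\<^bsub>loc.B\<^esub> (n - i) \<otimes>\<^bsub>loc.B\<^esub> (quo s \<otimes>\<^bsub>loc.B\<^esub> z) [^]\<^bsub>loc.B\<^esub> i"
      using cl(2) z by (simp add: h.S.m_assoc h.S.nat_pow_distrib)
    then have 2: "quo s [^]\<^bsub>loc.B\<^esub> n \<otimes>\<^bsub>loc.B\<^esub> z [^]\<^bsub>loc.B\<^esub> i = quo (s [^] (n - i) \<otimes> slc [^] i)"
      unfolding slcz using sA slc(1) by simp
    have "(quo d \<otimes>\<^bsub>loc.B\<^esub> quo s [^]\<^bsub>loc.B\<^esub> n) \<otimes>\<^bsub>loc.B\<^esub> (inclusion (q i) \<otimes>\<^bsub>loc.B\<^esub> z [^]\<^bsub>loc.B\<^esub> i) =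
       (quo d \<otimes>\<^bsub>loc.B\<^esub> inclusion (q i)) \<otimes>\<^bsub>loc.B\<^esub> (quo s [^]\<^bsub>loc.B\<^esub> n \<otimes>\<^bsub>loc.B\<^esub> z [^]\<^bsub>loc.B\<^esub> i)"
      using cl z by (simp add: h.S.m_ac)
    also have "\<dots> = quo (c i \<otimes> (s [^] (n - i) \<otimes> slc [^] i))"
      unfolding 1 2 using ker_carrier[OF c(1)[OF i]] sA slc(1) by simp
    also have "\<dots> = quo (e i \<otimes> slc [^] i)"
      unfolding e_def using ker_carrier[OF c(1)[OF i]] sA slc(1) by (simp add: m_assoc)
    finally show ?thesis .
  qed
  have cl: "quo d \<otimes>\<^bsub>loc.B\<^esub> quo s [^]\<^bsub>loc.B\<^esub> n \<in> carrier loc.B" using dk sA h.hom_closed by simp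
  have "\<zero>\<^bsub>loc.B\<^esub> = (quo d \<otimes>\<^bsub>loc.B\<^esub> quo s [^]\<^bsub>loc.B\<^esub> n) \<otimes>\<^bsub>loc.B\<^esub> ev z p"
    using p(2) cl by (simp add: z_def)
  also have "\<dots> = (\<Oplus>\<^bsub>loc.B\<^esub>i\<in>{..n}. (quo d \<otimes>\<^bsub>loc.B\<^esub> quo s [^]\<^bsub>loc.B\<^esub> n) \<otimes>\<^bsub>loc.B\<^esub> (inclusion (q i) \<otimes>\<^bsub>loc.B\<^esub> z [^]\<^bsub>loc.B\<^esub> i))"
    unfolding ev_sum[OF p(1)] q_def[symmetric] n_def[symmetric] using cl z i.hom_closed[OF q]
    by (intro h.S.finsum_rdistr) auto
  also have "\<dots> = (\<Oplus>\<^bsub>loc.B\<^esub>i\<in>{..n}. quo (e i \<otimes> slc [^] i))"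
    using summand eA slc(1) h.hom_closed by (intro h.S.finsum_cong') auto
  also have "\<dots> = quo (\<Oplus>i\<in>{..n}. e i \<otimes> slc [^] i)"
    using eA slc(1) by (subst h.hom_finsum) (auto simp: comp_def)
  finally have "quo (\<Oplus>i\<in>{..n}. e i \<otimes> slc [^] i) = \<zero>\<^bsub>loc.B\<^esub>" by (rule sym)
  moreover have "(\<Oplus>i\<in>{..n}. e i \<otimes> slc [^] i) \<in> carrier A" using eA slc(1) by (intro finsum_closed) auto
  ultimately have sum0: "(\<Oplus>i\<in>{..n}. e i \<otimes> slc [^] i) = \<zero>" using loc.A.fraction_eq_zero S_one by simp
  have e0: "e i = \<zero>" if i: "i \<le> n" for i
    by (rule local_slice_transcendental[OF slc _ sum0 i]) (rule e)
  have q0: "q i = \<zero>\<^bsub>loc.L\<^esub>" if i: "i \<le> n" for i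
  proof -
    have "c i = \<zero>" using e0[OF i] pow_nonzero[OF sA(1,3)] ker_carrier[OF c(1)[OF i]] sA(1)
      by (simp add: e_def integral_iff)
    then have 1: "fraction C S d \<one> \<otimes>\<^bsub>loc.L\<^esub> q i = \<zero>\<^bsub>loc.L\<^esub>"
      using c(2)[OF i] loc.R.zero_localization by simp
    have dL: "fraction C S d \<one> \<in> carrier loc.L" "fraction C S \<one> d \<in> carrier loc.L"
      using fracL_closed dk d S_one by auto
    have "(fraction C S d \<one> \<otimes>\<^bsub>loc.L\<^esub> fraction C S \<one> d) \<otimes>\<^bsub>loc.L\<^esub> q i = \<zero>\<^bsub>loc.L\<^esub>"
    proof -
      have "(fraction C S d \<one> \<otimes>\<^bsub>loc.L\<^esub> fraction C S \<one> d) \<otimes>\<^bsub>loc.L\<^esub> q i =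
          fraction C S \<one> d \<otimes>\<^bsub>loc.L\<^esub> (fraction C S d \<one> \<otimes>\<^bsub>loc.L\<^esub> q i)"
        using dL q by (simp add: U.R.m_ac)
      then show ?thesis unfolding 1 using dL(2) by simp
    qed
    then show ?thesis using loc.R.fraction_unit[OF d] q by simp
  qed
  show ?thesis
  proof (rule U.up_eqI[OF _ p(1)])
    fix i
    show "up_ring.coeff PL p i = up_ring.coeff PL \<zero>\<^bsub>PL\<^esub> i"
      using q0[of i] U.deg_aboveD[OF _ p(1), of i] by (cases "i \<le> n") (auto simp: q_def n_def)
  qed simp
qed

end

lemma (in ring_hom_cring) subring_preimage:
  assumes H: "subring H S"
  shows "subring {x \<in> carrier R. h x \<in> H} R"
  by (rule R.subringI) (auto intro: subringE(3,5,6,7)[OF H])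

lemma (in UP_cring) two_variables_generated:
  assumes H: "subring H (UP P)" and c: "\<And>r. r \<in> carrier R \<Longrightarrow> const2 R r \<in> H"
    and u: "var_u R \<in> H" and v: "var_v R \<in> H"
  shows "carrier (UP P) \<subseteq> H"
proof -
  interpret U: UP_cring P "UP P" by (simp_all add: UP_cring_def P.is_cring)
  interpret e: ring_hom_cring P "UP P" "\<lambda>p. up_ring.monom (UP P) p 0"
    by (rule ring_hom_cringI[OF P.is_cring U.P.is_cring U.const_ring_hom])
  have "carrier P \<subseteq> {p \<in> carrier P. up_ring.monom (UP P) p 0 \<in> H}"
  proof (rule polynomials_generated)
    show "subring {p \<in> carrier P. up_ring.monom (UP P) p 0 \<in> H} P" by (rule e.subring_preimage[OF H])
    fix r assume r: "r \<in> carrier R"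
    then show "up_ring.monom P r 0 \<in> {p \<in> carrier P. up_ring.monom (UP P) p 0 \<in> H}"
      using c[OF r, unfolded const2_def, folded P_def] monom_closed[OF r] by blast
  next
    show "up_ring.monom P \<one> (Suc 0) \<in> {p \<in> carrier P. up_ring.monom (UP P) p 0 \<in> H}"
      using u[unfolded var_u_def, folded P_def] monom_closed[OF R.one_closed] by (simp only: One_nat_def mem_Collect_eq simp_thms)
  qed
  moreover have "up_ring.monom (UP P) \<one>\<^bsub>P\<^esub> (Suc 0) \<in> H"
    using v[unfolded var_v_def, folded P_def] by (simp only: One_nat_def)
  ultimately show ?thesis by (intro U.polynomials_generated[OF H]) auto
qed

section \<open>The two local models\<close>

context ga_action_at
begin

text \<open>A slice becomes a coordinate wherever its derivative is invertible, and here the derivative is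
  invertible in \<open>L\<close> itself, so that no power of it has to be multiplied in.\<close>

lemma slice_isomorphism:
  assumes slc: "slc \<in> carrier A" "\<delta> slc \<in> S"
  shows "ev (fraction A S slc \<one>) \<in> ring_iso PL loc.B"
proof -
  define z where "z = fraction A S slc \<one>"
  have z: "z \<in> carrier loc.B" unfolding z_def using loc.A.fraction_closed slc(1) S_one by simp
  interpret E: ring_hom_cring PL loc.B "ev z" by (rule ev_hom[OF z])
  interpret h: ring_hom_cring A loc.B quo by (rule quo_hom)
  define f where "f = \<delta> slc"
  have f: "f \<in> S" "f \<in> ker" "f \<noteq> \<zero>" "f \<in> carrier A" using slc S_nonzero S_A by (auto simp: f_def)
  note H = ev_image[OF z]
  have "a_kernel PL loc.B (ev z) = {\<zero>\<^bsub>PL\<^esub>}"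
    using slice_fraction_transcendental[OF slc(1) _ _ S_one] f unfolding a_kernel_def' z_def f_def
    by (auto simp: z_def[symmetric])
  then have "inj_on (ev z) (carrier PL)" by (rule E.ring.trivial_ker_imp_inj)
  moreover have "ev z ` carrier PL = carrier loc.B"
  proof
    show "ev z ` carrier PL \<subseteq> carrier loc.B" using E.hom_closed by blast
    show "carrier loc.B \<subseteq> ev z ` carrier PL"
    proof
      fix x assume x: "x \<in> carrier loc.B"
      obtain k :: nat where k: "quo f [^]\<^bsub>loc.B\<^esub> k \<otimes>\<^bsub>loc.B\<^esub> x \<in> ev z ` carrier PL"
        using slice_fraction_generates[OF slc(1) _ f(2) S_one x] unfolding z_def f_def by blast
      define g where "g = fraction A S \<one> f"
      have g: "g \<in> ev z ` carrier PL"
        using subsetD[OF H(2) imageI[OF fracL_closed[OF one_ker f(1)]]]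
        unfolding inclusion_inverse[OF f(1)] g_def .
      have cl: "quo f \<in> carrier loc.B" "g \<in> carrier loc.B"
        using h.hom_closed[OF f(4)] g subringE(1)[OF H(1)] by blast+
      have "g [^]\<^bsub>loc.B\<^esub> k \<otimes>\<^bsub>loc.B\<^esub> (quo f [^]\<^bsub>loc.B\<^esub> k \<otimes>\<^bsub>loc.B\<^esub> x) = (quo f \<otimes>\<^bsub>loc.B\<^esub> g) [^]\<^bsub>loc.B\<^esub> k \<otimes>\<^bsub>loc.B\<^esub> x"
        using cl x by (simp add: E.S.nat_pow_distrib E.S.m_ac)
      also have "\<dots> = x" unfolding g_def quo_unit[OF f(1)] using x by simp
      finally show "x \<in> ev z ` carrier PL"
        using subringE(6)[OF H(1) E.S.subring_pow[OF H(1) g, of k] k] by simp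
    qed
  qed
  ultimately show ?thesis unfolding z_def[symmetric] ring_iso_def bij_betw_def using E.homh by blast
qed

text \<open>As \<open>m\<close> is prime, an element of the radical outside \<open>m\<close> has a power in the plinth ideal outside
  \<open>m\<close>, that is, a slice with derivative in \<open>S\<close>.\<close>

lemma model_outside_plinth:
  assumes "\<not> ideal_radical C plinth \<subseteq> m"
  shows "isomorphic_over C loc.B quo PL (\<lambda>c. up_ring.monom PL (fraction C S c \<one>) 0)"
proof -
  obtain r n where r: "r \<in> ker" "r \<notin> m" "r [^]\<^bsub>C\<^esub> (n::nat) \<in> plinth"
    using assms by (auto simp: ideal_radical_def)
  have "r [^]\<^bsub>C\<^esub> k \<in> ker \<and> r [^]\<^bsub>C\<^esub> k \<notin> m" for k :: nat
    using r(1,2) m_one m_prime by (induction k) auto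
  then have "r [^]\<^bsub>C\<^esub> n \<in> S" by simp
  then obtain slc where slc: "slc \<in> carrier A" "\<delta> slc \<in> S" using r(3) plinth_iff by auto
  define z where "z = fraction A S slc \<one>"
  have z: "z \<in> carrier loc.B" unfolding z_def using loc.A.fraction_closed slc(1) S_one by simp
  have iso: "ev z \<in> ring_iso PL loc.B" unfolding z_def by (rule slice_isomorphism[OF slc])
  have ringPL: "ring PL" using PL_cring by (simp add: cring_def)
  have inv: "inv_into (carrier PL) (ev z) \<in> ring_iso loc.B PL"
    by (rule ring_iso_set_sym[OF ringPL iso])
  have inj: "inj_on (ev z) (carrier PL)" using iso by (simp add: ring_iso_def bij_betw_def)
  have "inv_into (carrier PL) (ev z) (quo c) = up_ring.monom PL (fraction C S c \<one>) 0" if c: "c \<in> ker" for c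
  proof -
    note l = fracL_closed[OF c S_one]
    have "quo c = ev z (up_ring.monom PL (fraction C S c \<one>) 0)"
      using ev_const[OF z l] inclusion_quo[OF c] by simp
    then show ?thesis using inv_into_f_f[OF inj monom_PL_closed[OF l]] by simp
  qed
  then show ?thesis unfolding isomorphic_over_def using inv by (intro bexI[of _ "inv_into (carrier PL) (ev z)"]) auto
qed

text \<open>The equation \<open>a u - b v = s\<close> presents the localized coordinate ring. On the open set where
  \<open>a\<close> (respectively \<open>b\<close>) is invertible, both sides are polynomial rings in \<open>v\<close> (respectively \<open>u\<close>), and
  the two open sets cover because \<open>a u - b v\<close> is a unit on both sides. The variables \<open>u\<close> and \<open>v\<close>
  of the model go to \<open>u / s\<close> and \<open>v / s\<close>, which turns the right-hand side of the equation into \<open>1\<close>.\<close>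

lemma model_inside_plinth:
  assumes ab: "a \<in> ker" "b \<in> ker" "a \<noteq> \<zero>" "b \<noteq> \<zero>" and uv: "u \<in> carrier A" "v \<in> carrier A"
    and w: "w \<in> S" and s: "s \<in> S" and eq: "a \<otimes> u \<ominus> b \<otimes> v = s"
    and Du: "\<delta> u = b \<otimes> w" and Dv: "\<delta> v = a \<otimes> w"
  defines "J \<equiv> hypersurface_ideal loc.L (fraction C S a \<one>) (fraction C S b \<one>)"
  shows "isomorphic_over C loc.B quo (UP PL Quot J)
    (\<lambda>c. J +>\<^bsub>UP PL\<^esub> const2 loc.L (fraction C S c \<one>))"
proof -
  interpret h: ring_hom_cring A loc.B quo by (rule quo_hom)
  interpret L: UP_cring loc.L PL by (simp_all add: PL_UP_cring)
  interpret P: UP_cring PL "UP PL" by (simp_all add: UP_cring_def PL_cring)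
  define zu zv where "zu = fraction A S u s" and "zv = fraction A S v s"
  have z: "zu \<in> carrier loc.B" "zv \<in> carrier loc.B"
    using loc.A.fraction_closed uv s by (simp_all add: zu_def zv_def)
  have wA: "w \<in> carrier A" "w \<in> ker" "w \<noteq> \<zero>" and sA: "s \<in> carrier A" "s \<in> ker"
    using w s S_A S_nonzero by auto
  have abA: "a \<in> carrier A" "b \<in> carrier A" using ab ker_carrier by auto
  have qcl: "quo a \<in> carrier loc.B" "quo b \<in> carrier loc.B" "quo w \<in> carrier loc.B"
    using abA wA by (auto intro: h.hom_closed)
  have relB: "quo a \<otimes>\<^bsub>loc.B\<^esub> zu \<ominus>\<^bsub>loc.B\<^esub> quo b \<otimes>\<^bsub>loc.B\<^esub> zv \<ominus>\<^bsub>loc.B\<^esub> \<one>\<^bsub>loc.B\<^esub> = \<zero>\<^bsub>loc.B\<^esub>"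
  proof -
    define g where "g = fraction A S \<one> s"
    have g: "g \<in> carrier loc.B" unfolding g_def using loc.A.fraction_closed s by simp
    have zg: "zu = quo u \<otimes>\<^bsub>loc.B\<^esub> g" "zv = quo v \<otimes>\<^bsub>loc.B\<^esub> g"
      unfolding zu_def zv_def g_def using loc.A.fraction_split uv s by blast+
    have qu: "quo u \<in> carrier loc.B" "quo v \<in> carrier loc.B" using uv by (auto intro: h.hom_closed)
    have "quo a \<otimes>\<^bsub>loc.B\<^esub> zu \<ominus>\<^bsub>loc.B\<^esub> quo b \<otimes>\<^bsub>loc.B\<^esub> zv =
        (quo a \<otimes>\<^bsub>loc.B\<^esub> quo u \<ominus>\<^bsub>loc.B\<^esub> quo b \<otimes>\<^bsub>loc.B\<^esub> quo v) \<otimes>\<^bsub>loc.B\<^esub> g"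
      unfolding zg using qcl qu g by (simp add: a_minus_def h.S.l_distr h.S.l_minus h.S.m_assoc)
    also have "quo a \<otimes>\<^bsub>loc.B\<^esub> quo u \<ominus>\<^bsub>loc.B\<^esub> quo b \<otimes>\<^bsub>loc.B\<^esub> quo v = quo (a \<otimes> u \<ominus> b \<otimes> v)"
      using abA uv by (simp add: a_minus_def)
    also have "\<dots> \<otimes>\<^bsub>loc.B\<^esub> g = \<one>\<^bsub>loc.B\<^esub>" unfolding eq g_def by (rule quo_unit[OF s])
    finally show ?thesis by (simp add: a_minus_def h.S.r_neg)
  qed
  \<comment> \<open>\<open>L[u, v]\<close> is \<open>L[u][v]\<close>, so the evaluation map is built in two stages.\<close>
  have pre2: "UP_pre_univ_prop PL loc.B (ev zu)"
    by (rule UP_pre_univ_propI[OF PL_cring B_cring]) (rule ring_hom_cring.homh[OF ev_hom[OF z(1)]])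
  define \<Phi> where "\<Phi> = UnivPoly.eval PL loc.B (ev zu) zv"
  interpret \<Phi>: ring_hom_cring "UP PL" loc.B \<Phi>
    unfolding \<Phi>_def
    by (rule ring_hom_cringI[OF P.P.is_cring B_cring UP_pre_univ_prop.eval_ring_hom[OF pre2 z(2)]])
  have \<Phi>_cst: "\<Phi> (up_ring.monom (UP PL) p 0) = ev zu p" if "p \<in> carrier PL" for p
    unfolding \<Phi>_def by (rule UP_pre_univ_prop.eval_const[OF pre2 z(2) that])
  have oneL: "\<one>\<^bsub>loc.L\<^esub> \<in> carrier loc.L" by simp
  have c2: "const2 loc.L l \<in> carrier (UP PL)" if "l \<in> carrier loc.L" for l
    using that monom_PL_closed by (simp add: const2_def)
  have vu: "var_u loc.L \<in> carrier (UP PL)" using monom_PL_closed[OF oneL] by (simp add: var_u_def)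
  have vv: "var_v loc.L \<in> carrier (UP PL)" by (simp add: var_v_def)
  have \<Phi>_c2: "\<Phi> (const2 loc.L l) = inclusion l" if "l \<in> carrier loc.L" for l
    using \<Phi>_cst[OF monom_PL_closed[OF that]] ev_const[OF z(1) that] by (simp add: const2_def)
  have \<Phi>_u: "\<Phi> (var_u loc.L) = zu"
    using \<Phi>_cst[OF monom_PL_closed[OF oneL]] ev_var[OF z(1)] by (simp add: var_u_def)
  have \<Phi>_v: "\<Phi> (var_v loc.L) = zv"
    unfolding \<Phi>_def var_v_def using UP_pre_univ_prop.eval_monom1[OF pre2 z(2)] by simp
  \<comment> \<open>An element of \<open>B\<close> is in the image after multiplication by a power of \<open>b\<close>, because \<open>u / s\<close>
    generates where \<open>\<delta> u = b w\<close> is invertible, and likewise after multiplication by a power of \<open>a\<close>.\<close>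
  define H where "H = \<Phi> ` carrier (UP PL)"
  have H: "subring H loc.B"
    unfolding H_def using ring_hom_ring.img_is_subring[OF \<Phi>.ring.is_ring_hom_ring P.P.carrier_is_subring] .
  have HB: "H \<subseteq> carrier loc.B" by (rule subringE(1)[OF H])
  have incH: "inclusion ` carrier loc.L \<subseteq> H"
  proof
    fix y assume "y \<in> inclusion ` carrier loc.L"
    then obtain l where l: "l \<in> carrier loc.L" "y = inclusion l" by blast
    show "y \<in> H" unfolding l(2) H_def \<Phi>_c2[OF l(1), symmetric] by (rule imageI[OF c2[OF l(1)]])
  qed
  have zH: "zu \<in> H" "zv \<in> H"
    unfolding H_def using imageI[OF vu, of \<Phi>] imageI[OF vv, of \<Phi>] by (simp_all add: \<Phi>_u \<Phi>_v)
  have evH: "ev zu ` carrier PL \<subseteq> H" "ev zv ` carrier PL \<subseteq> H"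
    using ev_image_least[OF zH(1) H incH] ev_image_least[OF zH(2) H incH] .
  have quoH: "quo c \<in> H" if "c \<in> ker" for c
    using subsetD[OF incH imageI[OF fracL_closed[OF that S_one]]] unfolding inclusion_quo[OF that] .
  define g where "g = fraction A S \<one> w"
  have gH: "g \<in> H"
    using subsetD[OF incH imageI[OF fracL_closed[OF one_ker w]]] unfolding inclusion_inverse[OF w] g_def .
  have gB: "g \<in> carrier loc.B" using gH HB by blast
  have powH: "\<exists>k::nat. quo c [^]\<^bsub>loc.B\<^esub> k \<otimes>\<^bsub>loc.B\<^esub> x \<in> H"
    if y: "y \<in> carrier A" "\<delta> y = c \<otimes> w" "c \<in> ker" and img: "ev (fraction A S y s) ` carrier PL \<subseteq> H"
      and x: "x \<in> carrier loc.B" for c x y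
  proof -
    obtain k :: nat where k: "quo (c \<otimes> w) [^]\<^bsub>loc.B\<^esub> k \<otimes>\<^bsub>loc.B\<^esub> x \<in> H"
      using slice_fraction_generates[OF y(1,2) mult_ker[OF y(3) wA(2)] s x] img by blast
    note cA = ker_carrier[OF y(3)]
    have qc: "quo c \<in> carrier loc.B" by (rule h.hom_closed[OF cA])
    have "g [^]\<^bsub>loc.B\<^esub> k \<otimes>\<^bsub>loc.B\<^esub> (quo (c \<otimes> w) [^]\<^bsub>loc.B\<^esub> k \<otimes>\<^bsub>loc.B\<^esub> x) =
        (quo w \<otimes>\<^bsub>loc.B\<^esub> g) [^]\<^bsub>loc.B\<^esub> k \<otimes>\<^bsub>loc.B\<^esub> (quo c [^]\<^bsub>loc.B\<^esub> k \<otimes>\<^bsub>loc.B\<^esub> x)"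
      using cA wA(1) qc qcl(3) gB x by (simp add: h.S.nat_pow_distrib h.S.m_ac)
    also have "\<dots> = quo c [^]\<^bsub>loc.B\<^esub> k \<otimes>\<^bsub>loc.B\<^esub> x" unfolding g_def quo_unit[OF w] using qc x by simp
    finally show ?thesis
      using subringE(6)[OF H h.S.subring_pow[OF H gH, of k] k] by (intro exI[of _ k]) simp
  qed
  have surj: "\<Phi> ` carrier (UP PL) = carrier loc.B"
  proof
    show "\<Phi> ` carrier (UP PL) \<subseteq> carrier loc.B" using HB unfolding H_def .
    show "carrier loc.B \<subseteq> \<Phi> ` carrier (UP PL)"
    proof
      fix x assume x: "x \<in> carrier loc.B"
      obtain k :: nat where k: "quo a [^]\<^bsub>loc.B\<^esub> k \<otimes>\<^bsub>loc.B\<^esub> x \<in> H"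
        using powH[OF uv(2) Dv ab(1) _ x] evH(2) unfolding zv_def by blast
      obtain n :: nat where n: "quo b [^]\<^bsub>loc.B\<^esub> n \<otimes>\<^bsub>loc.B\<^esub> x \<in> H"
        using powH[OF uv(1) Du ab(2) _ x] evH(1) unfolding zu_def by blast
      have "x \<in> H"
      proof (rule h.S.comaximal_powers[OF qcl(1,2) z HB _ _ _ x k n])
        fix c y assume "c \<in> {quo a, quo b, zu, zv}" "y \<in> H"
        then show "c \<otimes>\<^bsub>loc.B\<^esub> y \<in> H" using quoH ab(1,2) zH subringE(6)[OF H] by blast
      next
        fix y y' assume "y \<in> H" "y' \<in> H"
        then show "y \<ominus>\<^bsub>loc.B\<^esub> y' \<in> H"
          unfolding a_minus_def using subringE(5,7)[OF H] by blast
      next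
        fix y assume "y \<in> carrier loc.B"
        then show "(quo a \<otimes>\<^bsub>loc.B\<^esub> zu \<ominus>\<^bsub>loc.B\<^esub> quo b \<otimes>\<^bsub>loc.B\<^esub> zv \<ominus>\<^bsub>loc.B\<^esub> \<one>\<^bsub>loc.B\<^esub>) \<otimes>\<^bsub>loc.B\<^esub> y \<in> H"
          unfolding relB using subringE(2)[OF H] by simp
      qed
      then show "x \<in> \<Phi> ` carrier (UP PL)" unfolding H_def .
    qed
  qed
  \<comment> \<open>Modulo \<open>J\<close> and up to a power of \<open>b\<close>, every polynomial is one in \<open>u\<close> alone; if it vanishes under
    \<open>\<Phi>\<close>, it is zero, as \<open>u / s\<close> is transcendental. The same holds for \<open>a\<close> and \<open>v\<close>.\<close>
  define \<alpha> \<beta> where "\<alpha> = const2 loc.L (fraction C S a \<one>)" and "\<beta> = const2 loc.L (fraction C S b \<one>)"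
  have \<alpha>\<beta>: "\<alpha> \<in> carrier (UP PL)" "\<beta> \<in> carrier (UP PL)"
    unfolding \<alpha>_def \<beta>_def using c2 fracL_closed ab(1,2) S_one by blast+
  define U V where "U = var_u loc.L" and "V = var_v loc.L"
  have UV: "U \<in> carrier (UP PL)" "V \<in> carrier (UP PL)" using vu vv by (simp_all add: U_def V_def)
  define e where "e = \<alpha> \<otimes>\<^bsub>UP PL\<^esub> U \<ominus>\<^bsub>UP PL\<^esub> \<beta> \<otimes>\<^bsub>UP PL\<^esub> V \<ominus>\<^bsub>UP PL\<^esub> \<one>\<^bsub>UP PL\<^esub>"
  have eP: "e \<in> carrier (UP PL)" unfolding e_def using \<alpha>\<beta> UV by simp
  have J: "J = Idl\<^bsub>UP PL\<^esub> {e}" by (simp add: J_def hypersurface_ideal_def e_def \<alpha>_def \<beta>_def U_def V_def)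
  interpret J: ideal J "UP PL" unfolding J using eP by (intro P.P.genideal_ideal) simp
  have eJ: "e \<in> J" unfolding J using eP by (intro P.P.genideal_self') 
  have \<Phi>\<alpha>: "\<Phi> \<alpha> = quo a" "\<Phi> \<beta> = quo b"
    unfolding \<alpha>_def \<beta>_def using \<Phi>_c2 fracL_closed ab(1,2) S_one inclusion_quo by simp_all
  have \<Phi>e: "\<Phi> e = \<zero>\<^bsub>loc.B\<^esub>"
    using relB \<alpha>\<beta> UV unfolding e_def by (simp add: a_minus_def \<Phi>\<alpha> \<Phi>_u[folded U_def] \<Phi>_v[folded V_def])
  have J_ker: "J \<subseteq> a_kernel (UP PL) loc.B \<Phi>"
  proof -
    have "{e} \<subseteq> a_kernel (UP PL) loc.B \<Phi>" unfolding a_kernel_def' using eP \<Phi>e by blast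
    then show ?thesis unfolding J by (rule P.P.genideal_minimal[OF \<Phi>.ring.kernel_is_ideal])
  qed
  have \<Phi>J: "\<Phi> x = \<zero>\<^bsub>loc.B\<^esub>" if "x \<in> J" for x
    using subsetD[OF J_ker that] unfolding a_kernel_def' by blast
  have eliminate: "\<exists>k::nat. c [^]\<^bsub>UP PL\<^esub> k \<otimes>\<^bsub>UP PL\<^esub> x \<in> J"
    if \<theta>: "ring_hom_cring PL (UP PL) \<theta>" and \<Phi>\<theta>: "\<And>p. p \<in> carrier PL \<Longrightarrow> \<Phi> (\<theta> p) = ev (fraction A S y s) p"
      and y: "y \<in> carrier A" "\<delta> y \<in> ker" "\<delta> y \<noteq> \<zero>"
      and cs: "\<And>l. l \<in> carrier loc.L \<Longrightarrow> const2 loc.L l \<in> \<theta> ` carrier PL"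
      and c: "c \<in> \<theta> ` carrier PL"
      and gens: "\<And>g. g \<in> {U, V} \<Longrightarrow> \<exists>k::nat. \<exists>t\<in>\<theta> ` carrier PL. c [^]\<^bsub>UP PL\<^esub> k \<otimes>\<^bsub>UP PL\<^esub> g \<ominus>\<^bsub>UP PL\<^esub> t \<in> J"
      and x: "x \<in> carrier (UP PL)" "\<Phi> x = \<zero>\<^bsub>loc.B\<^esub>" for \<theta> y c x
  proof -
    interpret \<theta>: ring_hom_cring PL "UP PL" \<theta> by (rule \<theta>)
    define T where "T = \<theta> ` carrier PL"
    have T: "subring T (UP PL)"
      unfolding T_def using ring_hom_ring.img_is_subring[OF \<theta>.ring.is_ring_hom_ring L.P.carrier_is_subring] .
    have cP: "c \<in> carrier (UP PL)" using c \<theta>.hom_closed by blast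
    let ?Q = "{g \<in> carrier (UP PL). \<exists>k::nat. \<exists>t\<in>T. c [^]\<^bsub>UP PL\<^esub> k \<otimes>\<^bsub>UP PL\<^esub> g \<ominus>\<^bsub>UP PL\<^esub> t \<in> J}"
    have Q: "subring ?Q (UP PL)"
      by (rule P.P.elimination_subring[OF J.is_ideal T c[folded T_def]])
    have "carrier (UP PL) \<subseteq> ?Q"
    proof (rule L.two_variables_generated[OF Q])
      fix l assume l: "l \<in> carrier loc.L"
      have "c [^]\<^bsub>UP PL\<^esub> (0::nat) \<otimes>\<^bsub>UP PL\<^esub> const2 loc.L l \<ominus>\<^bsub>UP PL\<^esub> const2 loc.L l = \<zero>\<^bsub>UP PL\<^esub>"
        using c2[OF l] by (simp add: a_minus_def P.P.r_neg)
      then have "c [^]\<^bsub>UP PL\<^esub> (0::nat) \<otimes>\<^bsub>UP PL\<^esub> const2 loc.L l \<ominus>\<^bsub>UP PL\<^esub> const2 loc.L l \<in> J"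
        using additive_subgroup.zero_closed[OF J.additive_subgroup_axioms] by (simp only:)
      then show "const2 loc.L l \<in> ?Q" using cs[OF l] c2[OF l] unfolding T_def by blast
    qed (use gens[of U] gens[of V] UV in \<open>auto simp: U_def V_def T_def\<close>)
    then obtain k t where k: "t \<in> T" "c [^]\<^bsub>UP PL\<^esub> (k::nat) \<otimes>\<^bsub>UP PL\<^esub> x \<ominus>\<^bsub>UP PL\<^esub> t \<in> J" using x(1) by blast
    obtain p where p: "p \<in> carrier PL" "t = \<theta> p" using k(1) by (auto simp: T_def)
    have tP: "t \<in> carrier (UP PL)" unfolding p(2) by (rule \<theta>.hom_closed[OF p(1)])
    have "\<zero>\<^bsub>loc.B\<^esub> = \<Phi> (c [^]\<^bsub>UP PL\<^esub> k \<otimes>\<^bsub>UP PL\<^esub> x \<ominus>\<^bsub>UP PL\<^esub> t)" using \<Phi>J[OF k(2)] by simp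
    also have "\<dots> = \<ominus>\<^bsub>loc.B\<^esub> \<Phi> t" using cP x tP \<Phi>.hom_closed by (simp add: a_minus_def)
    finally have "\<Phi> t = \<zero>\<^bsub>loc.B\<^esub>" using \<Phi>.hom_closed[OF tP] by (metis h.S.minus_minus h.S.minus_zero)
    then have "ev (fraction A S y s) p = \<zero>\<^bsub>loc.B\<^esub>" using \<Phi>\<theta>[OF p(1)] p(2) by simp
    then have "p = \<zero>\<^bsub>PL\<^esub>" by (rule slice_fraction_transcendental[OF y s p(1)])
    then have "t = \<zero>\<^bsub>UP PL\<^esub>" using p(2) by simp
    then show ?thesis using k(2) cP x by (intro exI[of _ k]) (simp add: a_minus_def)
  qed
  have J_mult: "r \<otimes>\<^bsub>UP PL\<^esub> x \<in> J" if "x \<in> J" "r \<in> carrier (UP PL)" for r x using J.I_l_closed[OF that] .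
  have ker_J: "x \<in> J" if x: "x \<in> carrier (UP PL)" "\<Phi> x = \<zero>\<^bsub>loc.B\<^esub>" for x
  proof -
    \<comment> \<open>The polynomials in \<open>u\<close> alone are the constants of \<open>L[u][v]\<close>.\<close>
    have \<theta>u: "ring_hom_cring PL (UP PL) (\<lambda>p. up_ring.monom (UP PL) p 0)"
      by (rule ring_hom_cringI[OF PL_cring P.P.is_cring P.const_ring_hom])
    have imu: "const2 loc.L l \<in> (\<lambda>p. up_ring.monom (UP PL) p 0) ` carrier PL" if "l \<in> carrier loc.L" for l
      unfolding const2_def by (rule imageI[OF monom_PL_closed[OF that]])
    have Uim: "U \<in> (\<lambda>p. up_ring.monom (UP PL) p 0) ` carrier PL"
      unfolding U_def var_u_def by (rule imageI[OF monom_PL_closed[OF oneL]])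
    have subu: "subring ((\<lambda>p. up_ring.monom (UP PL) p 0) ` carrier PL) (UP PL)"
    proof -
      interpret \<theta>u: ring_hom_cring PL "UP PL" "\<lambda>p. up_ring.monom (UP PL) p 0" by (rule \<theta>u)
      show ?thesis using ring_hom_ring.img_is_subring[OF \<theta>u.ring.is_ring_hom_ring L.P.carrier_is_subring] .
    qed
    have Dnz: "\<delta> u \<in> ker" "\<delta> u \<noteq> \<zero>" "\<delta> v \<in> ker" "\<delta> v \<noteq> \<zero>"
      unfolding Du Dv using ab abA wA by (simp_all add: integral_iff)
    have \<alpha>L: "fraction C S a \<one> \<in> carrier loc.L" "fraction C S b \<one> \<in> carrier loc.L"
      using fracL_closed ab(1,2) S_one by blast+
    have self: "c [^]\<^bsub>UP PL\<^esub> (0::nat) \<otimes>\<^bsub>UP PL\<^esub> g \<ominus>\<^bsub>UP PL\<^esub> g \<in> J" if g: "g \<in> carrier (UP PL)" for c g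
    proof -
      have "c [^]\<^bsub>UP PL\<^esub> (0::nat) \<otimes>\<^bsub>UP PL\<^esub> g \<ominus>\<^bsub>UP PL\<^esub> g = \<zero>\<^bsub>UP PL\<^esub>"
        using g by (simp add: a_minus_def P.P.r_neg)
      then show ?thesis using additive_subgroup.zero_closed[OF J.additive_subgroup_axioms] by (simp only:)
    qed
    have prods: "\<alpha> \<otimes>\<^bsub>UP PL\<^esub> U \<in> carrier (UP PL)" "\<beta> \<otimes>\<^bsub>UP PL\<^esub> V \<in> carrier (UP PL)" using \<alpha>\<beta> UV by simp_all
    obtain n :: nat where n: "\<beta> [^]\<^bsub>UP PL\<^esub> n \<otimes>\<^bsub>UP PL\<^esub> x \<in> J"
    proof -
      let ?T = "(\<lambda>p. up_ring.monom (UP PL) p 0) ` carrier PL"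
      have "\<exists>k::nat. \<beta> [^]\<^bsub>UP PL\<^esub> k \<otimes>\<^bsub>UP PL\<^esub> x \<in> J"
      proof (rule eliminate[OF \<theta>u _ uv(1) Dnz(1,2) imu _ _ x])
        show "\<Phi> (up_ring.monom (UP PL) p 0) = ev (fraction A S u s) p" if "p \<in> carrier PL" for p
          using \<Phi>_cst[OF that] by (simp add: zu_def)
        show "\<beta> \<in> ?T" unfolding \<beta>_def by (rule imu[OF \<alpha>L(2)])
        fix g assume "g \<in> {U, V}"
        then show "\<exists>k::nat. \<exists>t\<in>?T. \<beta> [^]\<^bsub>UP PL\<^esub> k \<otimes>\<^bsub>UP PL\<^esub> g \<ominus>\<^bsub>UP PL\<^esub> t \<in> J"
        proof (elim insertE emptyE)
          assume "g = U"
          then show ?thesis using self[OF UV(1)] Uim by blast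
        next
          assume gV: "g = V"
          define t where "t = \<alpha> \<otimes>\<^bsub>UP PL\<^esub> U \<oplus>\<^bsub>UP PL\<^esub> \<ominus>\<^bsub>UP PL\<^esub> \<one>\<^bsub>UP PL\<^esub>"
          have "\<alpha> \<in> ?T" unfolding \<alpha>_def by (rule imu[OF \<alpha>L(1)])
          then have tT: "t \<in> ?T" unfolding t_def
            by (intro subringE(7)[OF subu] subringE(6)[OF subu] subringE(5)[OF subu] subringE(3)[OF subu] Uim)
          have "\<beta> [^]\<^bsub>UP PL\<^esub> (1::nat) \<otimes>\<^bsub>UP PL\<^esub> V \<ominus>\<^bsub>UP PL\<^esub> t = \<ominus>\<^bsub>UP PL\<^esub> e"
            unfolding t_def e_def using prods \<alpha>\<beta>
            by (simp add: a_minus_def P.P.minus_add P.P.a_ac)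
          also have "\<dots> \<in> J" using additive_subgroup.a_inv_closed[OF J.additive_subgroup_axioms eJ] .
          finally show ?thesis unfolding gV using tT by blast
        qed
      qed
      then show ?thesis using that by blast
    qed
    \<comment> \<open>The polynomials in \<open>v\<close> alone are not a layer of \<open>L[u][v]\<close>; they are reached by evaluating \<open>L[v]\<close>.\<close>
    have c2hom: "const2 loc.L \<in> ring_hom loc.L (UP PL)"
      using ring_hom_trans[OF L.const_ring_hom P.const_ring_hom] by (simp add: const2_def[abs_def] comp_def)
    have pre3: "UP_pre_univ_prop loc.L (UP PL) (const2 loc.L)"
      by (rule UP_pre_univ_propI[OF loc.L_cring P.P.is_cring c2hom])
    define \<theta> where "\<theta> = UnivPoly.eval loc.L (UP PL) (const2 loc.L) V"
    have \<theta>v: "ring_hom_cring PL (UP PL) \<theta>" unfolding \<theta>_def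
      by (rule ring_hom_cringI[OF PL_cring P.P.is_cring UP_pre_univ_prop.eval_ring_hom[OF pre3 UV(2)]])
    have imv: "const2 loc.L l \<in> \<theta> ` carrier PL" if l: "l \<in> carrier loc.L" for l
    proof -
      have "\<theta> (up_ring.monom PL l 0) = const2 loc.L l"
        unfolding \<theta>_def by (rule UP_pre_univ_prop.eval_const[OF pre3 UV(2) l])
      then show ?thesis using imageI[OF monom_PL_closed[OF l, of 0], of \<theta>] by simp
    qed
    have Vim: "V \<in> \<theta> ` carrier PL"
    proof -
      have "\<theta> (up_ring.monom PL \<one>\<^bsub>loc.L\<^esub> 1) = V"
        unfolding \<theta>_def by (rule UP_pre_univ_prop.eval_monom1[OF pre3 UV(2)])
      then show ?thesis using imageI[OF monom_PL_closed[OF oneL, of 1], of \<theta>] by simp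
    qed
    have subv: "subring (\<theta> ` carrier PL) (UP PL)"
    proof -
      interpret \<theta>v: ring_hom_cring PL "UP PL" \<theta> by (rule \<theta>v)
      show ?thesis using ring_hom_ring.img_is_subring[OF \<theta>v.ring.is_ring_hom_ring L.P.carrier_is_subring] .
    qed
    have \<Phi>\<theta>: "\<Phi> (\<theta> p) = ev zv p" if p: "p \<in> carrier PL" for p
    proof -
      have cl: "up_ring.coeff PL p i \<in> carrier loc.L" for i by (rule L.coeff_closed[OF p])
      have tm: "const2 loc.L (up_ring.coeff PL p i) \<otimes>\<^bsub>UP PL\<^esub> V [^]\<^bsub>UP PL\<^esub> i \<in> carrier (UP PL)" for i
        using c2[OF cl] UV(2) by simp
      have img: "\<Phi> (const2 loc.L (up_ring.coeff PL p i) \<otimes>\<^bsub>UP PL\<^esub> V [^]\<^bsub>UP PL\<^esub> i) =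
          inclusion (up_ring.coeff PL p i) \<otimes>\<^bsub>loc.B\<^esub> zv [^]\<^bsub>loc.B\<^esub> i" for i
        using c2[OF cl] UV(2) \<Phi>_c2[OF cl] \<Phi>_v[folded V_def] by simp
      have "\<theta> p = (\<Oplus>\<^bsub>UP PL\<^esub>i\<in>{..deg loc.L p}. const2 loc.L (up_ring.coeff PL p i) \<otimes>\<^bsub>UP PL\<^esub> V [^]\<^bsub>UP PL\<^esub> i)"
        unfolding \<theta>_def using p by (simp add: UnivPoly.eval_def)
      then have "\<Phi> (\<theta> p) = (\<Oplus>\<^bsub>loc.B\<^esub>i\<in>{..deg loc.L p}. \<Phi> (const2 loc.L (up_ring.coeff PL p i) \<otimes>\<^bsub>UP PL\<^esub> V [^]\<^bsub>UP PL\<^esub> i))"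
      proof -
        assume *: "\<theta> p = (\<Oplus>\<^bsub>UP PL\<^esub>i\<in>{..deg loc.L p}. const2 loc.L (up_ring.coeff PL p i) \<otimes>\<^bsub>UP PL\<^esub> V [^]\<^bsub>UP PL\<^esub> i)"
        have "(\<lambda>i. const2 loc.L (up_ring.coeff PL p i) \<otimes>\<^bsub>UP PL\<^esub> V [^]\<^bsub>UP PL\<^esub> i)
          \<in> {..deg loc.L p} \<rightarrow> carrier (UP PL)" using tm by blast
        from \<Phi>.hom_finsum[OF this] show ?thesis unfolding * comp_def .
      qed
      then show ?thesis unfolding img ev_sum[OF p] .
    qed
    obtain k :: nat where k: "\<alpha> [^]\<^bsub>UP PL\<^esub> k \<otimes>\<^bsub>UP PL\<^esub> x \<in> J"
    proof -
      have "\<exists>k::nat. \<alpha> [^]\<^bsub>UP PL\<^esub> k \<otimes>\<^bsub>UP PL\<^esub> x \<in> J"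
      proof (rule eliminate[OF \<theta>v _ uv(2) Dnz(3,4) imv _ _ x])
        show "\<Phi> (\<theta> p) = ev (fraction A S v s) p" if "p \<in> carrier PL" for p
          using \<Phi>\<theta>[OF that] by (simp add: zv_def)
        show "\<alpha> \<in> \<theta> ` carrier PL" unfolding \<alpha>_def by (rule imv[OF \<alpha>L(1)])
        fix g assume "g \<in> {U, V}"
        then show "\<exists>k::nat. \<exists>t\<in>\<theta> ` carrier PL. \<alpha> [^]\<^bsub>UP PL\<^esub> k \<otimes>\<^bsub>UP PL\<^esub> g \<ominus>\<^bsub>UP PL\<^esub> t \<in> J"
        proof (elim insertE emptyE)
          assume "g = V"
          then show ?thesis using self[OF UV(2)] Vim by blast
        next
          assume gU: "g = U"
          define t where "t = \<beta> \<otimes>\<^bsub>UP PL\<^esub> V \<oplus>\<^bsub>UP PL\<^esub> \<one>\<^bsub>UP PL\<^esub>"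
          have "\<beta> \<in> \<theta> ` carrier PL" unfolding \<beta>_def by (rule imv[OF \<alpha>L(2)])
          then have tT: "t \<in> \<theta> ` carrier PL" unfolding t_def
            by (intro subringE(7)[OF subv] subringE(6)[OF subv] subringE(3)[OF subv] Vim)
          have "\<alpha> [^]\<^bsub>UP PL\<^esub> (1::nat) \<otimes>\<^bsub>UP PL\<^esub> U \<ominus>\<^bsub>UP PL\<^esub> t = e"
            unfolding t_def e_def using prods \<alpha>\<beta>
            by (simp add: a_minus_def P.P.minus_add P.P.a_ac)
          then have "\<alpha> [^]\<^bsub>UP PL\<^esub> (1::nat) \<otimes>\<^bsub>UP PL\<^esub> U \<ominus>\<^bsub>UP PL\<^esub> t \<in> J" using eJ by (simp only:)
          then show ?thesis unfolding gU using tT by blast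
        qed
      qed
      then show ?thesis using that by blast
    qed
    show "x \<in> J"
    proof (rule P.P.comaximal_powers[OF \<alpha>\<beta> UV J.a_subset _ _ _ x(1) k n])
      fix c y assume "c \<in> {\<alpha>, \<beta>, U, V}" "y \<in> J"
      then show "c \<otimes>\<^bsub>UP PL\<^esub> y \<in> J" using \<alpha>\<beta> UV by (intro J_mult) auto
    next
      fix y y' assume "y \<in> J" "y' \<in> J"
      then show "y \<ominus>\<^bsub>UP PL\<^esub> y' \<in> J"
        unfolding a_minus_def
        using additive_subgroup.a_closed[OF J.additive_subgroup_axioms]
          additive_subgroup.a_inv_closed[OF J.additive_subgroup_axioms] by blast
    next
      fix y assume "y \<in> carrier (UP PL)"
      then have "e \<otimes>\<^bsub>UP PL\<^esub> y \<in> J" by (rule J.I_r_closed[OF eJ])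
      then show "(\<alpha> \<otimes>\<^bsub>UP PL\<^esub> U \<ominus>\<^bsub>UP PL\<^esub> \<beta> \<otimes>\<^bsub>UP PL\<^esub> V \<ominus>\<^bsub>UP PL\<^esub> \<one>\<^bsub>UP PL\<^esub>) \<otimes>\<^bsub>UP PL\<^esub> y \<in> J"
        unfolding e_def .
    qed
  qed
  have kernel: "a_kernel (UP PL) loc.B \<Phi> = J"
    using J_ker ker_J unfolding a_kernel_def' by blast
  have iso: "(\<lambda>x. the_elem (\<Phi> ` x)) \<in> ring_iso (UP PL Quot J) loc.B"
    using \<Phi>.ring.FactRing_iso_set[OF surj] unfolding kernel .
  define \<psi> where "\<psi> = (\<lambda>x. the_elem (\<Phi> ` x))"
  have \<psi>: "\<psi> \<in> ring_iso (UP PL Quot J) loc.B" using iso unfolding \<psi>_def .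
  have inv: "inv_into (carrier (UP PL Quot J)) \<psi> \<in> ring_iso loc.B (UP PL Quot J)"
    by (rule ring_iso_set_sym[OF J.quotient_is_ring \<psi>])
  have inj: "inj_on \<psi> (carrier (UP PL Quot J))" using \<psi> by (simp add: ring_iso_def bij_betw_def)
  have "inv_into (carrier (UP PL Quot J)) \<psi> (quo c) = J +>\<^bsub>UP PL\<^esub> const2 loc.L (fraction C S c \<one>)"
    if c: "c \<in> ker" for c
  proof -
    note l = fracL_closed[OF c S_one]
    have mem: "J +>\<^bsub>UP PL\<^esub> const2 loc.L (fraction C S c \<one>) \<in> carrier (UP PL Quot J)"
      using ring_hom_closed[OF J.rcos_ring_hom c2[OF l]] .
    have "\<psi> (J +>\<^bsub>UP PL\<^esub> const2 loc.L (fraction C S c \<one>)) = \<Phi> (const2 loc.L (fraction C S c \<one>))"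
      unfolding \<psi>_def using \<Phi>.ring.the_elem_simp[OF c2[OF l]] unfolding kernel .
    also have "\<dots> = quo c" using \<Phi>_c2[OF l] inclusion_quo[OF c] by simp
    finally show ?thesis using inv_into_f_f[OF inj mem] by simp
  qed
  then show ?thesis unfolding isomorphic_over_def using inv
    by (intro bexI[of _ "inv_into (carrier (UP PL Quot J)) \<psi>"]) auto
qed

end

context ga_action_at
begin

text \<open>Divisibility by \<open>a\<close> in \<open>A\<close> and in \<open>C\<close> agree on elements of \<open>C\<close>, since the kernel is factorially
  closed; so coprimality in \<open>A\<close> gives regularity in \<open>C\<close>.\<close>

lemma coprime_regular_sequence:
  assumes ab: "a \<in> m" "b \<in> m" "a \<noteq> \<zero>"
    and coprime: "\<And>c. c \<in> carrier A \<Longrightarrow> a divides b \<otimes> c \<Longrightarrow> a divides c"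
  shows "regular_sequence C [a, b]"
proof -
  have k: "a \<in> ker" "b \<in> ker" using ab m_ker by auto
  have kA: "a \<in> carrier A" "b \<in> carrier A" using k ker_carrier by auto
  have idl0: "Idl\<^bsub>C\<^esub> {} \<subseteq> {\<zero>}"
    using loc.R.genideal_minimal[OF loc.R.zeroideal, of "{}"] by simp
  have idla: "Idl\<^bsub>C\<^esub> {a} = {r \<otimes> a | r. r \<in> ker}"
    using loc.R.cgenideal_eq_genideal[of a] k(1) by (simp add: cgenideal_def)
  have zero0: "\<zero> \<in> Idl\<^bsub>C\<^esub> {}"
    using additive_subgroup.zero_closed[OF ideal.axioms(1)[OF loc.R.genideal_ideal[of "{}"]]] by simp
  have first: "r \<in> Idl\<^bsub>C\<^esub> {}" if r: "r \<in> ker" "a \<otimes> r \<in> Idl\<^bsub>C\<^esub> {}" for r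
  proof -
    have "a \<otimes> r = \<zero>" using r(2) idl0 by blast
    then have "r = \<zero>" using kA(1) ab(3) ker_carrier[OF r(1)] by (simp add: integral_iff)
    then show ?thesis using zero0 by simp
  qed
  have second: "r \<in> Idl\<^bsub>C\<^esub> {a}" if r: "r \<in> ker" "b \<otimes> r \<in> Idl\<^bsub>C\<^esub> {a}" for r
  proof -
    note rA = ker_carrier[OF r(1)]
    obtain t where t: "t \<in> ker" "b \<otimes> r = t \<otimes> a" using r(2) unfolding idla by blast
    have "b \<otimes> r = a \<otimes> t" using t ker_carrier[OF t(1)] kA by (simp add: m_comm)
    then have "a divides b \<otimes> r" using ker_carrier[OF t(1)] unfolding factor_def by blast
    then have "a divides r" by (rule coprime[OF rA])
    then obtain c where c: "c \<in> carrier A" "r = a \<otimes> c" unfolding factor_def by blast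
    have "c \<in> ker"
    proof (cases "r = \<zero>")
      case True
      then have "c = \<zero>" using c kA ab(3) by (metis integral)
      then show ?thesis by simp
    next
      case False
      then show ?thesis using ker_factor2[OF kA(1) c(1)] r(1) c(2) by simp
    qed
    moreover have "r = c \<otimes> a" using c kA by (simp add: m_comm)
    ultimately show ?thesis unfolding idla by blast
  qed
  have "Idl\<^bsub>C\<^esub> {a, b} \<subseteq> m"
    using loc.R.genideal_minimal[OF maximalideal.axioms(1)[OF m_maximal]] ab by simp
  then have proper: "Idl\<^bsub>C\<^esub> {a, b} \<noteq> ker" using m_one one_ker by blast
  have "[a, b] ! i \<otimes>\<^bsub>C\<^esub> r \<in> Idl\<^bsub>C\<^esub> (set (take i [a, b])) \<longrightarrow> r \<in> Idl\<^bsub>C\<^esub> (set (take i [a, b]))"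
    if i: "i < 2" and r: "r \<in> ker" for i r
  proof -
    consider "i = 0" | "i = 1" using i by linarith
    then show ?thesis
    proof cases
      case 1
      then show ?thesis using first[OF r] by simp
    next
      case 2
      then show ?thesis using second[OF r] by simp
    qed
  qed
  then show ?thesis unfolding regular_sequence_def using k proper by simp
qed

end

theorem corollary1:
  fixes A :: "(complex, 'a) module" and \<delta> :: "'a \<Rightarrow> 'a" and m :: "'a set"
  defines "C0 \<equiv> invariant_ring A \<delta>"
  defines "I \<equiv> ideal_radical C0 (plinth_ideal A \<delta>)"
  defines "S \<equiv> carrier C0 - m"
  defines "L \<equiv> localization C0 S"
  assumes "smooth_affine_variety A"
    and "factorial_domain A"
    and "krull_dim A = 3"
    and "locally_nilpotent_derivation A \<delta>"
    and "locally_trivial A \<delta>"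
    and "\<not> equivariantly_trivial A \<delta>"
    and "regular_ring C0"
    and "maximalideal m C0"
  shows "(\<not> I \<subseteq> m \<longrightarrow>
           isomorphic_over C0
             (localization A S) (\<lambda>c. fraction A S c \<one>\<^bsub>A\<^esub>)
             (UP L) (\<lambda>c. up_ring.monom (UP L) (fraction C0 S c \<one>\<^bsub>C0\<^esub>) 0)) \<and>
         (I \<subseteq> m \<longrightarrow>
           (\<exists>a\<in>m. \<exists>b\<in>m. regular_sequence C0 [a, b] \<and>
             (let J = hypersurface_ideal L (fraction C0 S a \<one>\<^bsub>C0\<^esub>) (fraction C0 S b \<one>\<^bsub>C0\<^esub>) in
              isomorphic_over C0
                (localization A S) (\<lambda>c. fraction A S c \<one>\<^bsub>A\<^esub>)
                (UP (UP L) Quot J)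
                (\<lambda>c. J +>\<^bsub>UP (UP L)\<^esub> const2 L (fraction C0 S c \<one>\<^bsub>C0\<^esub>)))))"
proof -
  have alg: "algebra (ring_of_type_algebra :: complex ring) A" and dom: "domain A" and fg: "affine_variety A"
    using \<open>smooth_affine_variety A\<close> by (auto simp: smooth_affine_variety_def affine_variety_def)
  interpret domain A by (rule dom)
  interpret G: ga_action A \<delta>
    by (intro ga_action.intro ga_action_axioms.intro dom alg assms(8))
  have C0: "C0 = A\<lparr>carrier := G.ker\<rparr>" unfolding C0_def by (rule G.invariant_ring_eq)
  interpret G: ga_action_at A \<delta> m
    by (intro ga_action_at.intro ga_action_at_axioms.intro G.ga_action_axioms assms(6,9) assms(12)[unfolded C0])
  have S: "S = G.ker - m" by (simp add: S_def C0)
  have L: "L = G.loc.L" by (simp add: L_def C0 S)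
  have noeth: "noetherian_ring G.C"
    using \<open>regular_ring C0\<close> by (simp add: regular_ring_def C0)
  have "primeideal m G.C"
    by (rule cring.maximalideal_prime[OF G.C_cring G.m_maximal])
  then have reg: "regular_local_ring G.loc.L"
    using \<open>regular_ring C0\<close> by (simp add: regular_ring_def C0)
  have I: "I = ideal_radical G.C G.plinth" by (simp add: I_def C0)
  show ?thesis
  proof (intro conjI impI)
    assume "\<not> I \<subseteq> m"
    then show "isomorphic_over C0 (localization A S) (\<lambda>c. fraction A S c \<one>\<^bsub>A\<^esub>)
        (UP L) (\<lambda>c. up_ring.monom (UP L) (fraction C0 S c \<one>\<^bsub>C0\<^esub>) 0)"
      using G.model_outside_plinth unfolding I C0 S L by simp
  next
    assume Im: "I \<subseteq> m"
    have pl: "G.plinth \<subseteq> m"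
    proof
      fix j assume j: "j \<in> G.plinth"
      then have "j \<in> G.ker" using G.plinth_iff by blast
      moreover have "j [^]\<^bsub>G.C\<^esub> (1::nat) = j" using calculation G.ker_carrier by simp
      ultimately have "j \<in> ideal_radical G.C G.plinth" using j unfolding ideal_radical_def
        by (intro CollectI conjI exI[of _ "1::nat"]) auto
      then show "j \<in> m" using Im unfolding I by blast
    qed
    obtain x y where "x \<in> m" "y \<in> m"
      "\<forall>r\<in>m. \<exists>s\<in>G.ker - m. \<exists>p\<in>G.ker. \<exists>q\<in>G.ker. s \<otimes>\<^bsub>A\<^esub> r = p \<otimes>\<^bsub>A\<^esub> x \<oplus>\<^bsub>A\<^esub> q \<otimes>\<^bsub>A\<^esub> y"
      using G.local_generators_of_m[OF fg \<open>krull_dim A = 3\<close> reg] by blast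
    then obtain a b u v w s where ab: "a \<in> m" "b \<in> m" and uv: "u \<in> carrier A" "v \<in> carrier A"
      and ws: "w \<in> G.ker - m" "s \<in> G.ker - m"
      and eq: "a \<otimes>\<^bsub>A\<^esub> u \<ominus>\<^bsub>A\<^esub> b \<otimes>\<^bsub>A\<^esub> v = s" "\<delta> u = b \<otimes>\<^bsub>A\<^esub> w" "\<delta> v = a \<otimes>\<^bsub>A\<^esub> w" "a \<noteq> \<zero>\<^bsub>A\<^esub>" "b \<noteq> \<zero>\<^bsub>A\<^esub>"
      and coprime: "\<forall>c\<in>carrier A. a divides\<^bsub>A\<^esub> b \<otimes>\<^bsub>A\<^esub> c \<longrightarrow> a divides\<^bsub>A\<^esub> c"
      using G.local_equation[OF noeth pl] by metis
    have "regular_sequence G.C [a, b]"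
      using coprime by (intro G.coprime_regular_sequence ab eq(4)) blast
    moreover have "isomorphic_over G.C G.loc.B (\<lambda>c. fraction A (G.ker - m) c \<one>\<^bsub>A\<^esub>)
      (UP (UP G.loc.L) Quot hypersurface_ideal G.loc.L (fraction G.C (G.ker - m) a \<one>\<^bsub>A\<^esub>) (fraction G.C (G.ker - m) b \<one>\<^bsub>A\<^esub>))
      (\<lambda>c. hypersurface_ideal G.loc.L (fraction G.C (G.ker - m) a \<one>\<^bsub>A\<^esub>) (fraction G.C (G.ker - m) b \<one>\<^bsub>A\<^esub>)
         +>\<^bsub>UP (UP G.loc.L)\<^esub> const2 G.loc.L (fraction G.C (G.ker - m) c \<one>\<^bsub>A\<^esub>))"
      by (rule G.model_inside_plinth[OF G.m_ker[OF ab(1)] G.m_ker[OF ab(2)] eq(4,5) uv ws eq(1-3)])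
    ultimately show "\<exists>a\<in>m. \<exists>b\<in>m. regular_sequence C0 [a, b] \<and>
        (let J = hypersurface_ideal L (fraction C0 S a \<one>\<^bsub>C0\<^esub>) (fraction C0 S b \<one>\<^bsub>C0\<^esub>) in
          isomorphic_over C0 (localization A S) (\<lambda>c. fraction A S c \<one>\<^bsub>A\<^esub>)
            (UP (UP L) Quot J) (\<lambda>c. J +>\<^bsub>UP (UP L)\<^esub> const2 L (fraction C0 S c \<one>\<^bsub>C0\<^esub>)))"
      using ab unfolding C0 S L Let_def by (intro bexI[of _ a] bexI[of _ b] conjI) simp_all
  qed
qed

end
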